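(* Let $A$ be a finite dimensional associative algebra over a field $k$ which has a simple preserving duality, and let $\Lambda$ be the set of isomorphism classes of simple left $A$-modules. If for two partial orders $\le_1$ and $\le_2$ on $\Lambda$ both $(A,\le_1)$ and $(A,\le_2)$ are quasi-hereditary, then their essential partial orders coincide: $\le_1^e=\le_2^e$. Equivalently, the standard modules for both partial orders coincide.
   Context: Let $A$-mod be the category of finite dimensional left $A$-modules. For $\lambda\in\Lambda$ let $L(\lambda)$ be the corresponding simple module and $P(\lambda)$ its projective cover. $A$ has a simple preserving duality if there is an involutive contravariant autoequivalence $\mathbf{d}$ of $A$-mod inducing the identity on $\Lambda$ (i.e. $\mathbf{d}L(\lambda)\simeq L(\lambda)$ for all $\lambda$). Given a partial order $\le$ on $\Lambda$, the standard module $\Delta(\lambda)$ is the maximal quotient of $P(\lambda)$ all of whose simple constituents are of the form $L(\mu)$ with $\mu\le\lambda$. The pair $(A,\le)$ is quasi-hereditary if for all $\lambda\in\Lambda$: (1) $[\Delta(\lambda):L(\lambda)]=1$; (2) $P(\lambda)$ has a filtration with each quotient isomorphic to a standard module $\Delta(\mu)$ with $\lambda\le\mu$. Write $(P(\lambda):\Delta(\mu))$ for the multiplicity of $\Delta(\mu)$ in such a filtration. If $(A,\le)$ is quasi-hereditary, its essential partial order $\le^e$ on $\Lambda$ is the partial order transitively generated by the relations: $\mu\le^e\lambda$ when $[\Delta(\lambda):L(\mu)]\neq 0$ or $(P(\mu):\Delta(\lambda))\neq 0$. *)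

theory Defs
  imports "HOL-Algebra.Module" "HOL-Algebra.AbelCoset"
begin

section \<open>Finite-dimensional algebras and left modules\<close>

definition fin_dim :: "'k ring \<Rightarrow> ('k, 'v) module \<Rightarrow> bool" where
  "fin_dim K V \<longleftrightarrow>
     (\<exists>B. finite B \<and> B \<subseteq> carrier V \<and>
        (\<forall>x\<in>carrier V. \<exists>c\<in>B \<rightarrow> carrier K. x = finsum V (\<lambda>b. c b \<odot>\<^bsub>V\<^esub> b) B))"

text \<open>The locale \<^locale>\<open>algebra\<close> of HOL-Algebra assumes commutativity, so it does not fit here.
  The record of \<open>A\<close> carries both its ring structure and its scalar multiplication by \<open>K\<close>.
  The zero algebra is included.\<close>

locale fin_dim_algebra = K: field K + A: ring A + Module.module K A
  for K :: "'k ring" and A :: "('k, 'a) module" +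
  assumes smult_mult_left:
      "\<lbrakk>c \<in> carrier K; x \<in> carrier A; y \<in> carrier A\<rbrakk>
        \<Longrightarrow> (c \<odot>\<^bsub>A\<^esub> x) \<otimes>\<^bsub>A\<^esub> y = c \<odot>\<^bsub>A\<^esub> (x \<otimes>\<^bsub>A\<^esub> y)"
    and smult_mult_right:
      "\<lbrakk>c \<in> carrier K; x \<in> carrier A; y \<in> carrier A\<rbrakk>
        \<Longrightarrow> x \<otimes>\<^bsub>A\<^esub> (c \<odot>\<^bsub>A\<^esub> y) = c \<odot>\<^bsub>A\<^esub> (x \<otimes>\<^bsub>A\<^esub> y)"
    and finite_dimensional: "fin_dim K A"

text \<open>Left modules over a possibly noncommutative ring. The library record for modules extends the
  one for rings; its fields \<open>mult\<close> and \<open>one\<close> play no role for a left module.\<close>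

locale left_module = A: ring A + M: abelian_group M
  for A :: "('k, 'a) module" and M :: "('a, 'm) module" +
  assumes smult_closed:
      "\<lbrakk>a \<in> carrier A; x \<in> carrier M\<rbrakk> \<Longrightarrow> a \<odot>\<^bsub>M\<^esub> x \<in> carrier M"
    and smult_l_distr:
      "\<lbrakk>a \<in> carrier A; b \<in> carrier A; x \<in> carrier M\<rbrakk>
        \<Longrightarrow> (a \<oplus>\<^bsub>A\<^esub> b) \<odot>\<^bsub>M\<^esub> x = a \<odot>\<^bsub>M\<^esub> x \<oplus>\<^bsub>M\<^esub> b \<odot>\<^bsub>M\<^esub> x"
    and smult_r_distr:
      "\<lbrakk>a \<in> carrier A; x \<in> carrier M; y \<in> carrier M\<rbrakk>
        \<Longrightarrow> a \<odot>\<^bsub>M\<^esub> (x \<oplus>\<^bsub>M\<^esub> y) = a \<odot>\<^bsub>M\<^esub> x \<oplus>\<^bsub>M\<^esub> a \<odot>\<^bsub>M\<^esub> y"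
    and smult_assoc:
      "\<lbrakk>a \<in> carrier A; b \<in> carrier A; x \<in> carrier M\<rbrakk>
        \<Longrightarrow> (a \<otimes>\<^bsub>A\<^esub> b) \<odot>\<^bsub>M\<^esub> x = a \<odot>\<^bsub>M\<^esub> (b \<odot>\<^bsub>M\<^esub> x)"
    and smult_one: "x \<in> carrier M \<Longrightarrow> \<one>\<^bsub>A\<^esub> \<odot>\<^bsub>M\<^esub> x = x"

definition restrict_scalars :: "('k, 'a) module \<Rightarrow> ('a, 'm) module \<Rightarrow> ('k, 'm) module" where
  "restrict_scalars A M =
     \<lparr>carrier = carrier M, mult = mult M, one = one M, zero = zero M, add = add M,
      smult = (\<lambda>c x. (c \<odot>\<^bsub>A\<^esub> \<one>\<^bsub>A\<^esub>) \<odot>\<^bsub>M\<^esub> x)\<rparr>"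

text \<open>The objects of the category of finite-dimensional left \<open>A\<close>-modules. The underlying sets are
  taken inside the type \<^typ>\<open>'k list\<close>, which contains a copy of \<open>K\<close> to the power \<open>n\<close> for every
  \<open>n\<close>. Hence every finite-dimensional left \<open>A\<close>-module, on whatever type, is isomorphic to an object
  of this category. The notions below that do not mention the category (homomorphisms,
  isomorphism, quotients, multiplicities) apply to modules on arbitrary types.\<close>

definition amod :: "'k ring \<Rightarrow> ('k, 'a) module \<Rightarrow> ('a, 'k list) module set" where
  "amod K A = {M. left_module A M \<and> fin_dim K (restrict_scalars A M)}"

text \<open>Homomorphisms are extensional functions, so that equality of morphisms is equality of
  functions.\<close>

definition lmod_hom :: "('k, 'a) module \<Rightarrow> ('a, 'm) module \<Rightarrow> ('a, 'n) module \<Rightarrow> ('m \<Rightarrow> 'n) set" where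
  "lmod_hom A M N =
     {f \<in> carrier M \<rightarrow>\<^sub>E carrier N.
        (\<forall>x\<in>carrier M. \<forall>y\<in>carrier M. f (x \<oplus>\<^bsub>M\<^esub> y) = f x \<oplus>\<^bsub>N\<^esub> f y) \<and>
        (\<forall>a\<in>carrier A. \<forall>x\<in>carrier M. f (a \<odot>\<^bsub>M\<^esub> x) = a \<odot>\<^bsub>N\<^esub> f x)}"

definition lmod_iso :: "('k, 'a) module \<Rightarrow> ('a, 'm) module \<Rightarrow> ('a, 'n) module \<Rightarrow> bool" where
  "lmod_iso A M N \<longleftrightarrow> (\<exists>f\<in>lmod_hom A M N. bij_betw f (carrier M) (carrier N))"

definition quot_module :: "('a, 'm) module \<Rightarrow> 'm set \<Rightarrow> ('a, 'm set) module" where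
  "quot_module M N =
     \<lparr>carrier = a_rcosets\<^bsub>M\<^esub> N, mult = undefined, one = undefined, zero = N, add = set_add M,
      smult = (\<lambda>a X. \<Union>x\<in>X. N +>\<^bsub>M\<^esub> (a \<odot>\<^bsub>M\<^esub> x))\<rparr>"

text \<open>The subquotient \<open>N' / N\<close> for submodules \<open>N \<subseteq> N'\<close> of \<open>M\<close>.\<close>

definition subquot :: "('a, 'm) module \<Rightarrow> 'm set \<Rightarrow> 'm set \<Rightarrow> ('a, 'm set) module" where
  "subquot M N' N = quot_module (M\<lparr>carrier := N'\<rparr>) N"


section \<open>Filtrations and multiplicities\<close>

definition simple_lmod :: "('k, 'a) module \<Rightarrow> ('a, 'm) module \<Rightarrow> bool" where
  "simple_lmod A M \<longleftrightarrow> left_module A M \<and> carrier M \<noteq> {\<zero>\<^bsub>M\<^esub>} \<and>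
     (\<forall>N. submodule N A M \<longrightarrow> N = {\<zero>\<^bsub>M\<^esub>} \<or> N = carrier M)"

definition filtration :: "('k, 'a) module \<Rightarrow> ('a, 'm) module \<Rightarrow> 'm set list \<Rightarrow> bool" where
  "filtration A M Ns \<longleftrightarrow> Ns \<noteq> [] \<and> hd Ns = {\<zero>\<^bsub>M\<^esub>} \<and> last Ns = carrier M \<and>
     (\<forall>N\<in>set Ns. submodule N A M) \<and>
     (\<forall>i. Suc i < length Ns \<longrightarrow> Ns ! i \<subseteq> Ns ! Suc i)"

definition factor_count ::
  "('k, 'a) module \<Rightarrow> ('a, 'm) module \<Rightarrow> 'm set list \<Rightarrow> ('a, 'n) module \<Rightarrow> nat" where
  "factor_count A M Ns X =
     card {i. Suc i < length Ns \<and> lmod_iso A (subquot M (Ns ! Suc i) (Ns ! i)) X}"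

definition composition_series :: "('k, 'a) module \<Rightarrow> ('a, 'm) module \<Rightarrow> 'm set list \<Rightarrow> bool" where
  "composition_series A M Ns \<longleftrightarrow> filtration A M Ns \<and>
     (\<forall>i. Suc i < length Ns \<longrightarrow> simple_lmod A (subquot M (Ns ! Suc i) (Ns ! i)))"

text \<open>The multiplicity \<open>[M : L]\<close>. By the Jordan-Hoelder theorem it does not depend on the choice
  of the composition series.\<close>

definition comp_mult :: "('k, 'a) module \<Rightarrow> ('a, 'm) module \<Rightarrow> ('a, 'n) module \<Rightarrow> nat" where
  "comp_mult A M L = factor_count A M (SOME Ns. composition_series A M Ns) L"


section \<open>Simple modules and projective covers\<close>

definition Irr :: "'k ring \<Rightarrow> ('k, 'a) module \<Rightarrow> ('a, 'k list) module set set" where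
  "Irr K A = {L \<in> amod K A. simple_lmod A L} //
     {(L, L'). L \<in> amod K A \<and> simple_lmod A L \<and> L' \<in> amod K A \<and> simple_lmod A L' \<and>
        lmod_iso A L L'}"

definition simple_of :: "('a, 'u) module set \<Rightarrow> ('a, 'u) module" where
  "simple_of l = (SOME L. L \<in> l)"

definition projective :: "'k ring \<Rightarrow> ('k, 'a) module \<Rightarrow> ('a, 'k list) module \<Rightarrow> bool" where
  "projective K A P \<longleftrightarrow> P \<in> amod K A \<and>
     (\<forall>M\<in>amod K A. \<forall>N\<in>amod K A. \<forall>g\<in>lmod_hom A M N. \<forall>f\<in>lmod_hom A P N.
        g ` carrier M = carrier N \<longrightarrow> (\<exists>h\<in>lmod_hom A P M. compose (carrier P) g h = f))"

definition projective_cover ::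
  "'k ring \<Rightarrow> ('k, 'a) module \<Rightarrow> ('a, 'k list) module \<Rightarrow> ('a, 'k list) module \<Rightarrow> bool" where
  "projective_cover K A P L \<longleftrightarrow> projective K A P \<and>
     (\<exists>p\<in>lmod_hom A P L. p ` carrier P = carrier L \<and>
        (\<forall>N. submodule N A P \<and> N <+>\<^bsub>P\<^esub> a_kernel P L p = carrier P \<longrightarrow> N = carrier P))"

definition proj_of ::
  "'k ring \<Rightarrow> ('k, 'a) module \<Rightarrow> ('a, 'k list) module set \<Rightarrow> ('a, 'k list) module" where
  "proj_of K A l = (SOME P. projective_cover K A P (simple_of l))"


section \<open>Duality\<close>

text \<open>A contravariant functor is given by its action \<open>D\<close> on objects and its action on morphisms,
  where \<open>Dm M N f\<close> is the image of \<open>f : M \<rightarrow> N\<close>.\<close>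

definition contravariant_functor ::
  "'k ring \<Rightarrow> ('k, 'a) module \<Rightarrow> (('a, 'k list) module \<Rightarrow> ('a, 'k list) module) \<Rightarrow>
   (('a, 'k list) module \<Rightarrow> ('a, 'k list) module \<Rightarrow> ('k list \<Rightarrow> 'k list) \<Rightarrow> ('k list \<Rightarrow> 'k list)) \<Rightarrow>
   bool" where
  "contravariant_functor K A D Dm \<longleftrightarrow>
     (\<forall>M\<in>amod K A. D M \<in> amod K A) \<and>
     (\<forall>M\<in>amod K A. \<forall>N\<in>amod K A. \<forall>f\<in>lmod_hom A M N. Dm M N f \<in> lmod_hom A (D N) (D M)) \<and>
     (\<forall>M\<in>amod K A. Dm M M (\<lambda>x\<in>carrier M. x) = (\<lambda>x\<in>carrier (D M). x)) \<and>
     (\<forall>L\<in>amod K A. \<forall>M\<in>amod K A. \<forall>N\<in>amod K A. \<forall>f\<in>lmod_hom A L M. \<forall>g\<in>lmod_hom A M N.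
        Dm L N (compose (carrier L) g f) = compose (carrier (D N)) (Dm L M f) (Dm M N g))"

definition contravariant_autoequivalence ::
  "'k ring \<Rightarrow> ('k, 'a) module \<Rightarrow> (('a, 'k list) module \<Rightarrow> ('a, 'k list) module) \<Rightarrow>
   (('a, 'k list) module \<Rightarrow> ('a, 'k list) module \<Rightarrow> ('k list \<Rightarrow> 'k list) \<Rightarrow> ('k list \<Rightarrow> 'k list)) \<Rightarrow>
   bool" where
  "contravariant_autoequivalence K A D Dm \<longleftrightarrow> contravariant_functor K A D Dm \<and>
     (\<forall>M\<in>amod K A. \<forall>N\<in>amod K A.
        bij_betw (Dm M N) (lmod_hom A M N) (lmod_hom A (D N) (D M))) \<and>
     (\<forall>N\<in>amod K A. \<exists>M\<in>amod K A. lmod_iso A (D M) N)"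

text \<open>Involutive: the square of the functor is naturally isomorphic to the identity functor.\<close>

definition involutive_functor ::
  "'k ring \<Rightarrow> ('k, 'a) module \<Rightarrow> (('a, 'k list) module \<Rightarrow> ('a, 'k list) module) \<Rightarrow>
   (('a, 'k list) module \<Rightarrow> ('a, 'k list) module \<Rightarrow> ('k list \<Rightarrow> 'k list) \<Rightarrow> ('k list \<Rightarrow> 'k list)) \<Rightarrow>
   bool" where
  "involutive_functor K A D Dm \<longleftrightarrow>
     (\<exists>h. (\<forall>M\<in>amod K A. h M \<in> lmod_hom A M (D (D M)) \<and>
             bij_betw (h M) (carrier M) (carrier (D (D M)))) \<and>
          (\<forall>M\<in>amod K A. \<forall>N\<in>amod K A. \<forall>f\<in>lmod_hom A M N.
             compose (carrier M) (Dm (D N) (D M) (Dm M N f)) (h M) =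
             compose (carrier M) (h N) f))"

definition has_simple_preserving_duality :: "'k ring \<Rightarrow> ('k, 'a) module \<Rightarrow> bool" where
  "has_simple_preserving_duality K A \<longleftrightarrow>
     (\<exists>D Dm. contravariant_autoequivalence K A D Dm \<and> involutive_functor K A D Dm \<and>
        (\<forall>l\<in>Irr K A. lmod_iso A (D (simple_of l)) (simple_of l)))"


section \<open>Quasi-hereditary structures\<close>

text \<open>Throughout, \<open>(m, l) \<in> r\<close> means that \<open>m\<close> is at most \<open>l\<close> in the partial order \<open>r\<close> on the set of
  isomorphism classes of simple modules. The standard module is the quotient of the projective
  cover by the smallest submodule \<open>N\<close> for which all simple constituents of the quotient belong to
  classes below \<open>l\<close>; the order on sets used by \<open>LEAST\<close> is inclusion.\<close>

definition standard_module ::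
  "'k ring \<Rightarrow> ('k, 'a) module \<Rightarrow> ('a, 'k list) module set rel \<Rightarrow> ('a, 'k list) module set \<Rightarrow>
   ('a, 'k list set) module" where
  "standard_module K A r l =
     quot_module (proj_of K A l)
       (LEAST N. submodule N A (proj_of K A l) \<and>
          (\<forall>m\<in>Irr K A. comp_mult A (quot_module (proj_of K A l) N) (simple_of m) \<noteq> 0
             \<longrightarrow> (m, l) \<in> r))"

definition standard_filtration ::
  "'k ring \<Rightarrow> ('k, 'a) module \<Rightarrow> ('a, 'k list) module set rel \<Rightarrow> ('a, 'k list) module set \<Rightarrow>
   'k list set list \<Rightarrow> bool" where
  "standard_filtration K A r l Ns \<longleftrightarrow> filtration A (proj_of K A l) Ns \<and>
     (\<forall>i. Suc i < length Ns \<longrightarrow>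
        (\<exists>m\<in>Irr K A. (l, m) \<in> r \<and>
           lmod_iso A (subquot (proj_of K A l) (Ns ! Suc i) (Ns ! i)) (standard_module K A r m)))"

definition quasi_hereditary ::
  "'k ring \<Rightarrow> ('k, 'a) module \<Rightarrow> ('a, 'k list) module set rel \<Rightarrow> bool" where
  "quasi_hereditary K A r \<longleftrightarrow>
     (\<forall>l\<in>Irr K A. comp_mult A (standard_module K A r l) (simple_of l) = 1 \<and>
        (\<exists>Ns. standard_filtration K A r l Ns))"

text \<open>The multiplicity \<open>(P(l) : \<Delta>(m))\<close>. In a quasi-hereditary algebra it does not depend on the
  choice of the filtration.\<close>

definition standard_mult ::
  "'k ring \<Rightarrow> ('k, 'a) module \<Rightarrow> ('a, 'k list) module set rel \<Rightarrow> ('a, 'k list) module set \<Rightarrow>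
   ('a, 'k list) module set \<Rightarrow> nat" where
  "standard_mult K A r l m =
     factor_count A (proj_of K A l) (SOME Ns. standard_filtration K A r l Ns)
       (standard_module K A r m)"

text \<open>In the quasi-hereditary case the generating relation is reflexive on the isomorphism classes,
  because the multiplicity of \<open>L(l)\<close> in \<open>\<Delta>(l)\<close> is 1, so the transitive closure is reflexive too.\<close>

definition essential_order ::
  "'k ring \<Rightarrow> ('k, 'a) module \<Rightarrow> ('a, 'k list) module set rel \<Rightarrow> ('a, 'k list) module set rel" where
  "essential_order K A r =
     {(m, l). m \<in> Irr K A \<and> l \<in> Irr K A \<and>
        (comp_mult A (standard_module K A r l) (simple_of m) \<noteq> 0 \<or>
         standard_mult K A r m l \<noteq> 0)}\<^sup>+"

end

theory Submission
  imports Defs Complex_Main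
begin

text \<open>Let \<open>d\<close> be the matrix of the multiplicities \<open>[\<Delta>(l) : L(m)]\<close>, \<open>p\<close> that of \<open>(P(l) : \<Delta>(m))\<close>, and
  \<open>c = p d\<close> the Cartan matrix, which does not depend on the order. The matrices \<open>p\<close> and \<open>d\<close> are triangular
  in opposite directions. Computing the dimension of \<open>Hom(P(l), D P(m))\<close> once by projectivity of \<open>P(l)\<close> and
  once by injectivity of \<open>D P(m)\<close> shows that \<open>c\<close> becomes symmetric after rescaling by the dimensions
  \<open>e l\<close> of \<open>End(L(l))\<close>. A symmetric matrix with such a triangular factorization has the form
  \<open>d\<^sup>T F d\<close> with \<open>F\<close> diagonal and positive, which gives BGG reciprocity without Ext groups. For two orders,
  the integral matrix \<open>T = d2 d1\<^sup>-\<^sup>1\<close> is then an isometry between two positive diagonal forms, so \<open>T\<close>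
  and the transpose of its inverse have entries of equal sign; this forces \<open>T\<close> to be a signed permutation
  matrix, and triangularity and nonnegativity of \<open>d1\<close> and \<open>d2\<close> force \<open>T = 1\<close>. So the multiplicities in the
  standard modules agree, which makes the defining submodules of \<open>P(l)\<close> equal.

  The duality is not assumed to be \<open>K\<close>-linear. Therefore dimensions are only compared along exact sequences,
  never along the bijections of hom sets that the duality provides.\<close>

text \<open>For a single order the triangular factorization of the rescaled Cartan matrix would be
  unique by Gauss elimination. Here the two orders need not have a common refinement, so there is no
  common triangular shape, and two real factorizations of one positive form can differ. Integrality
  replaces the common shape: a sum of nonnegative integers equal to 1 has exactly one nonzero term,
  and this is applied to the diagonal entries of \<open>T T\<^sup>-\<^sup>1\<close>. The entries of
  \<open>F\<close> are \<open>(P(l) : \<Delta>(l)) / e l\<close>; the top factor of a standard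
  filtration makes them positive, and their exact value never enters.

  Multiplicities are defined through chosen series, and \<open>D\<close> is given as an equivalence,
  without exactness or additivity. Dimensions settle the first point:
  \<open>e l * [M : L(l)]\<close> is the dimension of Hom(P(l), M). Exactness of \<open>D\<close> is
  recovered from its being full, faithful and essentially surjective.\<close>

lemma submodule_iff:
  assumes "abelian_group V"
  shows "submodule S R V \<longleftrightarrow> S \<subseteq> carrier V \<and> \<zero>\<^bsub>V\<^esub> \<in> S \<and> (\<forall>x\<in>S. \<forall>y\<in>S. x \<oplus>\<^bsub>V\<^esub> y \<in> S)
    \<and> (\<forall>x\<in>S. \<ominus>\<^bsub>V\<^esub> x \<in> S) \<and> (\<forall>a\<in>carrier R. \<forall>x\<in>S. a \<odot>\<^bsub>V\<^esub> x \<in> S)"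
  (is "?L \<longleftrightarrow> ?R")
proof
  interpret abelian_group V by fact
  assume L: ?L
  then interpret submodule S R V .
  show ?R
    using subset one_closed m_closed m_inv_closed smult_closed
    by (auto simp: a_inv_def)
next
  interpret abelian_group V by fact
  assume R: ?R
  then show ?L
    by (intro submodule.intro subgroup.intro) (auto simp: submodule_axioms_def a_inv_def)
qed

lemma submoduleD:
  assumes "abelian_group V" and "submodule S R V"
  shows "S \<subseteq> carrier V" "\<zero>\<^bsub>V\<^esub> \<in> S" "\<And>x y. x \<in> S \<Longrightarrow> y \<in> S \<Longrightarrow> x \<oplus>\<^bsub>V\<^esub> y \<in> S"
    "\<And>x. x \<in> S \<Longrightarrow> \<ominus>\<^bsub>V\<^esub> x \<in> S" "\<And>a x. a \<in> carrier R \<Longrightarrow> x \<in> S \<Longrightarrow> a \<odot>\<^bsub>V\<^esub> x \<in> S"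
  using assms(2) unfolding submodule_iff[OF assms(1)] by simp_all

lemma submodule_minus:
  assumes "abelian_group V" and "submodule S R V" and "x \<in> S" and "y \<in> S"
  shows "x \<ominus>\<^bsub>V\<^esub> y \<in> S"
  using submoduleD[OF assms(1,2)] assms(3,4) by (simp add: a_minus_def)

lemma submodule_Int:
  assumes "abelian_group V" and "submodule S R V" and "T \<noteq> {}" and "\<And>S. S \<in> T \<Longrightarrow> submodule S R V"
  shows "submodule (\<Inter>T) R V"
  using assms(1,3,4) by (fastforce simp: submodule_iff[OF assms(1)])

text \<open>No axioms are imposed on \<open>R\<close> and \<open>f\<close> need not be extensional.
  Hence \<open>A\<close>-homomorphisms, \<open>K\<close>-linear maps, evaluations at a point and
  composition maps between hom spaces are all instances, and the results on lengths serve each of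
  them.\<close>

definition lin_map ::
  "('r, 'x) ring_scheme \<Rightarrow> ('r, 'v) module \<Rightarrow> ('r, 'w) module \<Rightarrow> ('v \<Rightarrow> 'w) \<Rightarrow> bool" where
  "lin_map R V W f \<longleftrightarrow> abelian_group V \<and> abelian_group W \<and> f \<in> carrier V \<rightarrow> carrier W \<and>
     (\<forall>x\<in>carrier V. \<forall>y\<in>carrier V. f (x \<oplus>\<^bsub>V\<^esub> y) = f x \<oplus>\<^bsub>W\<^esub> f y) \<and>
     (\<forall>a\<in>carrier R. \<forall>x\<in>carrier V. f (a \<odot>\<^bsub>V\<^esub> x) = a \<odot>\<^bsub>W\<^esub> f x)"

lemma lin_mapD:
  assumes "lin_map R V W f"
  shows "abelian_group V" "abelian_group W" "\<And>x. x \<in> carrier V \<Longrightarrow> f x \<in> carrier W"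
    "\<And>x y. x \<in> carrier V \<Longrightarrow> y \<in> carrier V \<Longrightarrow> f (x \<oplus>\<^bsub>V\<^esub> y) = f x \<oplus>\<^bsub>W\<^esub> f y"
    "\<And>a x. a \<in> carrier R \<Longrightarrow> x \<in> carrier V \<Longrightarrow> f (a \<odot>\<^bsub>V\<^esub> x) = a \<odot>\<^bsub>W\<^esub> f x"
  using assms by (auto simp: lin_map_def)

lemma lin_map_zero:
  assumes "lin_map R V W f"
  shows "f \<zero>\<^bsub>V\<^esub> = \<zero>\<^bsub>W\<^esub>"
proof -
  interpret V: abelian_group V using assms by (rule lin_mapD)
  interpret W: abelian_group W using assms by (rule lin_mapD)
  have "f (\<zero>\<^bsub>V\<^esub> \<oplus>\<^bsub>V\<^esub> \<zero>\<^bsub>V\<^esub>) = f \<zero>\<^bsub>V\<^esub> \<oplus>\<^bsub>W\<^esub> f \<zero>\<^bsub>V\<^esub>"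
    by (rule lin_mapD(4)[OF assms]) auto
  moreover have "f \<zero>\<^bsub>V\<^esub> \<in> carrier W"
    by (rule lin_mapD(3)[OF assms]) auto
  ultimately show ?thesis
    by simp
qed

lemma lin_map_neg:
  assumes "lin_map R V W f" and "x \<in> carrier V"
  shows "f (\<ominus>\<^bsub>V\<^esub> x) = \<ominus>\<^bsub>W\<^esub> f x"
proof -
  interpret V: abelian_group V using assms(1) by (rule lin_mapD)
  interpret W: abelian_group W using assms(1) by (rule lin_mapD)
  have "f (\<ominus>\<^bsub>V\<^esub> x \<oplus>\<^bsub>V\<^esub> x) = f (\<ominus>\<^bsub>V\<^esub> x) \<oplus>\<^bsub>W\<^esub> f x"
    by (rule lin_mapD(4)[OF assms(1)]) (auto simp: assms)
  then have "f (\<ominus>\<^bsub>V\<^esub> x) \<oplus>\<^bsub>W\<^esub> f x = \<zero>\<^bsub>W\<^esub>"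
    by (simp add: assms V.l_neg lin_map_zero[OF assms(1)])
  then show ?thesis
    using lin_mapD(3)[OF assms(1)] assms(2) by (metis V.a_inv_closed W.minus_equality)
qed

lemma lin_map_minus:
  assumes "lin_map R V W f" and "x \<in> carrier V" and "y \<in> carrier V"
  shows "f (x \<ominus>\<^bsub>V\<^esub> y) = f x \<ominus>\<^bsub>W\<^esub> f y"
proof -
  interpret V: abelian_group V using assms(1) by (rule lin_mapD)
  show ?thesis
    using assms lin_mapD(4)[OF assms(1)] lin_map_neg[OF assms(1)] by (simp add: a_minus_def)
qed

text \<open>The preimage is taken inside \<open>S\<close>, so that \<open>U\<close> equal to zero
  gives the kernel of \<open>f\<close> restricted to \<open>S\<close>.\<close>

lemma submodule_vimage:
  assumes "lin_map R V W f" and "submodule S R V" and "submodule U R W"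
  shows "submodule {x \<in> S. f x \<in> U} R V"
  using submoduleD[OF lin_mapD(1)[OF assms(1)] assms(2)] submoduleD[OF lin_mapD(2)[OF assms(1)] assms(3)]
    lin_mapD[OF assms(1)] lin_map_neg[OF assms(1)] lin_map_zero[OF assms(1)]
  by (auto simp: submodule_iff[OF lin_mapD(1)[OF assms(1)]] subset_iff)

lemma submodule_image:
  assumes "lin_map R V W f" and "submodule S R V"
  shows "submodule (f ` S) R W"
proof -
  note f = lin_mapD[OF assms(1)] and S = submoduleD[OF lin_mapD(1)[OF assms(1)] assms(2)]
  have "\<zero>\<^bsub>W\<^esub> \<in> f ` S"
    using lin_map_zero[OF assms(1)] S(2) by (metis imageI)
  moreover have "\<ominus>\<^bsub>W\<^esub> f x \<in> f ` S" if "x \<in> S" for x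
    using that S lin_map_neg[OF assms(1), of x] by (metis imageI subsetD)
  moreover have "f x \<oplus>\<^bsub>W\<^esub> f y \<in> f ` S" if "x \<in> S" "y \<in> S" for x y
    using that S(1,3) f(4)[of x y] by (metis imageI subsetD)
  moreover have "a \<odot>\<^bsub>W\<^esub> f x \<in> f ` S" if "x \<in> S" "a \<in> carrier R" for a x
    using that S(1,5) f(5)[of a x] by (metis imageI subsetD)
  ultimately show ?thesis
    using f(3) S(1) by (auto simp: submodule_iff[OF f(2)])
qed

lemma submodule_zero:
  assumes "abelian_group V" and "\<And>a. a \<in> carrier R \<Longrightarrow> a \<odot>\<^bsub>V\<^esub> \<zero>\<^bsub>V\<^esub> = \<zero>\<^bsub>V\<^esub>"
  shows "submodule {\<zero>\<^bsub>V\<^esub>} R V"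
proof -
  interpret abelian_group V by fact
  show ?thesis using assms by (auto simp: submodule_iff)
qed

lemma submodule_carrier:
  assumes "abelian_group V" and "\<And>a x. a \<in> carrier R \<Longrightarrow> x \<in> carrier V \<Longrightarrow> a \<odot>\<^bsub>V\<^esub> x \<in> carrier V"
  shows "submodule (carrier V) R V"
proof -
  interpret abelian_group V by fact
  show ?thesis using assms by (auto simp: submodule_iff)
qed

section \<open>Lengths\<close>

text \<open>Only the carrier of \<open>R\<close> matters here, so \<open>A\<close>-submodules and \<open>K\<close>-subspaces are covered by the same
  notion; for \<open>R = K\<close> the length is the dimension.\<close>

inductive sub_chain ::
  "('r, 'x) ring_scheme \<Rightarrow> ('r, 'v) module \<Rightarrow> nat \<Rightarrow> 'v set \<Rightarrow> bool" for R V where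
  base: "submodule S R V \<Longrightarrow> sub_chain R V 0 S"
| step: "sub_chain R V n S \<Longrightarrow> S \<subset> S' \<Longrightarrow> submodule S' R V \<Longrightarrow> sub_chain R V (Suc n) S'"

lemma sub_chain_submodule: "sub_chain R V n S \<Longrightarrow> submodule S R V"
  by (induction rule: sub_chain.induct) auto

text \<open>Only the last member of the chain is replaced; a strict inclusion into it stays
  strict.\<close>

lemma sub_chain_mono:
  assumes "sub_chain R V n S" and "S \<subseteq> S'" and "submodule S' R V"
  shows "sub_chain R V n S'"
  using assms
proof (induction arbitrary: S' rule: sub_chain.induct)
  case (step n S S'')
  then have "S \<subset> S'"
    by blast
  with step show ?case
    by (blast intro: sub_chain.step)
qed (blast intro: sub_chain.base)

definition finite_length :: "('r, 'x) ring_scheme \<Rightarrow> ('r, 'v) module \<Rightarrow> 'v set \<Rightarrow> bool" where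
  "finite_length R V S \<longleftrightarrow> submodule S R V \<and> (\<exists>b. \<forall>n. sub_chain R V n S \<longrightarrow> n \<le> b)"

text \<open>With the maximal length of a chain, additivity along exact sequences comes from
  splitting and joining chains, without bases and without a Jordan-Hoelder theorem. The value is
  meaningful under \<open>finite_length\<close>.\<close>

definition len :: "('r, 'x) ring_scheme \<Rightarrow> ('r, 'v) module \<Rightarrow> 'v set \<Rightarrow> nat" where
  "len R V S = (GREATEST n. sub_chain R V n S)"

lemma sub_chain_len:
  assumes "finite_length R V S"
  shows "sub_chain R V (len R V S) S"
proof -
  obtain b where "\<And>n. sub_chain R V n S \<Longrightarrow> n \<le> b" and "submodule S R V"
    using assms by (auto simp: finite_length_def)
  then show ?thesis
    unfolding len_def using sub_chain.base by (metis (no_types, lifting) GreatestI_nat)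
qed

lemma sub_chain_le_len:
  assumes "finite_length R V S" and "sub_chain R V n S"
  shows "n \<le> len R V S"
proof -
  obtain b where "\<And>n. sub_chain R V n S \<Longrightarrow> n \<le> b"
    using assms by (auto simp: finite_length_def)
  then show ?thesis
    using assms(2) unfolding len_def by (metis (no_types, lifting) Greatest_le_nat)
qed

lemma finite_length_mono:
  assumes "finite_length R V S'" and "S \<subseteq> S'" and "submodule S R V"
  shows "finite_length R V S"
  unfolding finite_length_def
  by (metis assms finite_length_def sub_chain_mono)

lemma len_mono:
  assumes "finite_length R V S'" and "S \<subseteq> S'" and "submodule S R V"
  shows "len R V S \<le> len R V S'"
proof -
  have "submodule S' R V"
    using assms(1) by (simp add: finite_length_def)
  then show ?thesis
    using sub_chain_le_len[OF assms(1)] sub_chain_mono[OF sub_chain_len assms(2)]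
      finite_length_mono[OF assms] by blast
qed

lemma len_strict_mono:
  assumes "finite_length R V S'" and "S \<subset> S'" and "submodule S R V"
  shows "len R V S < len R V S'"
proof -
  have "finite_length R V S"
    using assms by (blast intro: finite_length_mono)
  then have "sub_chain R V (Suc (len R V S)) S'"
    using assms by (simp add: finite_length_def sub_chain.step[OF sub_chain_len])
  then show ?thesis
    using sub_chain_le_len[OF assms(1)] by fastforce
qed

text \<open>Each strict step enlarges the kernel part or the image. If both stayed the same, every
  \<open>x\<close> in \<open>S'\<close> would have the same image as some \<open>y\<close> in
  \<open>S\<close>, the difference would lie in the kernel part of \<open>S'\<close> and thus in
  \<open>S\<close>, and so would \<open>x\<close>.\<close>

lemma sub_chain_split:
  assumes f: "lin_map R V W f" and Z: "submodule {\<zero>\<^bsub>W\<^esub>} R W" and "sub_chain R V n S"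
  shows "\<exists>a b. sub_chain R V a {x \<in> S. f x = \<zero>\<^bsub>W\<^esub>} \<and> sub_chain R W b (f ` S) \<and> n \<le> a + b"
  using assms(3)
proof (induction rule: sub_chain.induct)
  case (base S)
  then show ?case
    using submodule_vimage[OF f _ Z] submodule_image[OF f] by (fastforce intro: sub_chain.base)
next
  case (step n S S')
  interpret V: abelian_group V using f by (rule lin_mapD)
  interpret W: abelian_group W using f by (rule lin_mapD)
  obtain a b where ab: "sub_chain R V a {x \<in> S. f x = \<zero>\<^bsub>W\<^esub>}" "sub_chain R W b (f ` S)" "n \<le> a + b"
    using step by blast
  have sub: "submodule {x \<in> S'. f x = \<zero>\<^bsub>W\<^esub>} R V" "submodule (f ` S') R W"
    using submodule_vimage[OF f _ Z] submodule_image[OF f] step by fastforce+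
  have S: "submodule S R V"
    using step by (blast intro: sub_chain_submodule)
  note DS = submoduleD[OF lin_mapD(1)[OF f] S] and DS' = submoduleD[OF lin_mapD(1)[OF f] step(3)]
  have "{x \<in> S. f x = \<zero>\<^bsub>W\<^esub>} \<subset> {x \<in> S'. f x = \<zero>\<^bsub>W\<^esub>} \<or> f ` S \<subset> f ` S'"
  proof (rule ccontr)
    assume "\<not> ?thesis"
    then have ker: "{x \<in> S'. f x = \<zero>\<^bsub>W\<^esub>} \<subseteq> S" and im: "f ` S' = f ` S"
      using step(2) by blast+
    have "x \<in> S" if x: "x \<in> S'" for x
    proof -
      obtain y where y: "y \<in> S" "f x = f y"
        using im x by blast
      then have xy: "x \<in> carrier V" "y \<in> carrier V" "y \<in> S'"
        using x DS(1) DS'(1) step(2) by auto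
      then have "f (x \<ominus>\<^bsub>V\<^esub> y) = \<zero>\<^bsub>W\<^esub>"
        using y lin_map_minus[OF f xy(1,2)] lin_mapD(3)[OF f xy(2)] by (simp add: a_minus_def W.r_neg)
      then have "x \<ominus>\<^bsub>V\<^esub> y \<in> S"
        using ker submodule_minus[OF lin_mapD(1)[OF f] step(3) x xy(3)] by blast
      then have "x \<ominus>\<^bsub>V\<^esub> y \<oplus>\<^bsub>V\<^esub> y \<in> S"
        using DS(3) y by blast
      then show ?thesis
        using xy by (simp add: a_minus_def V.a_assoc V.l_neg)
    qed
    then show False
      using step(2) by blast
  qed
  then show ?case
  proof
    assume "{x \<in> S. f x = \<zero>\<^bsub>W\<^esub>} \<subset> {x \<in> S'. f x = \<zero>\<^bsub>W\<^esub>}"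
    then have "sub_chain R V (Suc a) {x \<in> S'. f x = \<zero>\<^bsub>W\<^esub>}"
      by (rule sub_chain.step[OF ab(1) _ sub(1)])
    moreover have "sub_chain R W b (f ` S')"
      by (rule sub_chain_mono[OF ab(2) _ sub(2)]) (use step(2) in blast)
    ultimately show ?thesis
      using ab(3) by (intro exI[of _ "Suc a"] exI[of _ b]) simp
  next
    assume "f ` S \<subset> f ` S'"
    moreover have "sub_chain R V a {x \<in> S'. f x = \<zero>\<^bsub>W\<^esub>}"
      by (rule sub_chain_mono[OF ab(1) _ sub(1)]) (use step(2) in auto)
    ultimately show ?thesis
      using ab(3) sub_chain.step[OF ab(2) _ sub(2)] by (intro exI[of _ a] exI[of _ "Suc b"]) simp
  qed
qed

lemma sub_chain_join:
  assumes f: "lin_map R V W f" and Z: "submodule {\<zero>\<^bsub>W\<^esub>} R W" and S: "submodule S R V"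
    and ker: "sub_chain R V a {x \<in> S. f x = \<zero>\<^bsub>W\<^esub>}" and im: "sub_chain R W b U" and U: "U \<subseteq> f ` S"
  shows "sub_chain R V (a + b) {x \<in> S. f x \<in> U}"
  using im U
proof (induction rule: sub_chain.induct)
  case (base U)
  then have "submodule {x \<in> S. f x \<in> U} R V"
    using submodule_vimage[OF f S] by blast
  moreover have "\<zero>\<^bsub>W\<^esub> \<in> U"
    using submoduleD(2)[OF lin_mapD(2)[OF f] base(1)] .
  then have "{x \<in> S. f x = \<zero>\<^bsub>W\<^esub>} \<subseteq> {x \<in> S. f x \<in> U}"
    by auto
  ultimately show ?case
    using sub_chain_mono[OF ker, of "{x \<in> S. f x \<in> U}"] by simp
next
  case (step n U U')
  then have "sub_chain R V (a + n) {x \<in> S. f x \<in> U}"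
    by blast
  moreover have "{x \<in> S. f x \<in> U} \<subset> {x \<in> S. f x \<in> U'}"
    using step by blast
  ultimately show ?case
    using sub_chain.step[OF _ _ submodule_vimage[OF f S step(3)]] by simp
qed

lemma finite_length_exact:
  assumes f: "lin_map R V W f" and Z: "submodule {\<zero>\<^bsub>W\<^esub>} R W" and S: "submodule S R V"
    and ker: "finite_length R V {x \<in> S. f x = \<zero>\<^bsub>W\<^esub>}" and im: "finite_length R W (f ` S)"
  shows "finite_length R V S"
proof -
  have "n \<le> len R V {x \<in> S. f x = \<zero>\<^bsub>W\<^esub>} + len R W (f ` S)" if "sub_chain R V n S" for n
    using sub_chain_split[OF f Z that] sub_chain_le_len[OF ker] sub_chain_le_len[OF im] by fastforce
  then show ?thesis
    using S by (auto simp: finite_length_def)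
qed

lemma len_exact:
  assumes f: "lin_map R V W f" and Z: "submodule {\<zero>\<^bsub>W\<^esub>} R W" and S: "finite_length R V S"
  shows "finite_length R W (f ` S)"
    and "len R V S = len R V {x \<in> S. f x = \<zero>\<^bsub>W\<^esub>} + len R W (f ` S)"
proof -
  have sub: "submodule S R V"
    using S by (simp add: finite_length_def)
  have K: "submodule {x \<in> S. f x = \<zero>\<^bsub>W\<^esub>} R V"
    using submodule_vimage[OF f sub Z] by simp
  have eq: "{x \<in> S. f x \<in> f ` S} = S"
    by blast
  have kerl: "finite_length R V {x \<in> S. f x = \<zero>\<^bsub>W\<^esub>}"
    by (rule finite_length_mono[OF S _ K]) auto
  have join: "sub_chain R V (len R V {x \<in> S. f x = \<zero>\<^bsub>W\<^esub>} + b) S" if "sub_chain R W b (f ` S)" for b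
    using sub_chain_join[OF f Z sub sub_chain_len[OF kerl] that] eq by simp
  show im: "finite_length R W (f ` S)"
    unfolding finite_length_def
    using submodule_image[OF f sub] sub_chain_le_len[OF S join] by (meson add_leD2)
  show "len R V S = len R V {x \<in> S. f x = \<zero>\<^bsub>W\<^esub>} + len R W (f ` S)"
  proof (rule antisym)
    show "len R V S \<le> len R V {x \<in> S. f x = \<zero>\<^bsub>W\<^esub>} + len R W (f ` S)"
      using sub_chain_split[OF f Z sub_chain_len[OF S]] sub_chain_le_len[OF kerl] sub_chain_le_len[OF im]
      by fastforce
    show "len R V {x \<in> S. f x = \<zero>\<^bsub>W\<^esub>} + len R W (f ` S) \<le> len R V S"
      using join[OF sub_chain_len[OF im]] sub_chain_le_len[OF S] by blast
  qed
qed

lemma sub_chain_zero: 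
  assumes "abelian_group V" and "sub_chain R V n {\<zero>\<^bsub>V\<^esub>}"
  shows "n = 0"
proof (rule ccontr)
  assume "n \<noteq> 0"
  with assms(2) obtain S where "submodule S R V" "S \<subset> {\<zero>\<^bsub>V\<^esub>}"
    by cases (auto dest: sub_chain_submodule)
  then show False
    using submoduleD(2)[OF assms(1)] by fastforce
qed

lemma len_zero:
  assumes "abelian_group V" and "submodule {\<zero>\<^bsub>V\<^esub>} R V"
  shows "finite_length R V {\<zero>\<^bsub>V\<^esub>}" and "len R V {\<zero>\<^bsub>V\<^esub>} = 0"
proof -
  show *: "finite_length R V {\<zero>\<^bsub>V\<^esub>}"
    using assms sub_chain_zero unfolding finite_length_def by blast
  show "len R V {\<zero>\<^bsub>V\<^esub>} = 0"
    using sub_chain_zero[OF assms(1) sub_chain_len[OF *]] .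
qed

lemma len_eq_0_iff:
  assumes "abelian_group V" and "submodule {\<zero>\<^bsub>V\<^esub>} R V" and "finite_length R V S"
  shows "len R V S = 0 \<longleftrightarrow> S = {\<zero>\<^bsub>V\<^esub>}"
proof
  assume "len R V S = 0"
  moreover have "{\<zero>\<^bsub>V\<^esub>} \<subseteq> S"
    using submoduleD(2)[OF assms(1)] assms(3) by (auto simp: finite_length_def)
  ultimately show "S = {\<zero>\<^bsub>V\<^esub>}"
    using len_strict_mono[OF assms(3) _ assms(2)] by (metis less_nat_zero_code psubsetI)
qed (use len_zero assms in simp)

lemma len_inj:
  assumes f: "lin_map R V W f" and Z: "submodule {\<zero>\<^bsub>W\<^esub>} R W" and ZV: "submodule {\<zero>\<^bsub>V\<^esub>} R V"
    and inj: "inj_on f S" and S: "submodule S R V"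
  shows "finite_length R V S \<longleftrightarrow> finite_length R W (f ` S)"
    and "finite_length R V S \<Longrightarrow> len R V S = len R W (f ` S)"
proof -
  have ker: "{x \<in> S. f x = \<zero>\<^bsub>W\<^esub>} = {\<zero>\<^bsub>V\<^esub>}"
    using lin_map_zero[OF f] submoduleD(2)[OF lin_mapD(1)[OF f] S] inj_on_contraD[OF inj] by fastforce
  note z = len_zero[OF lin_mapD(1)[OF f] ZV]
  show "finite_length R V S \<longleftrightarrow> finite_length R W (f ` S)"
    using finite_length_exact[OF f Z S] len_exact[OF f Z, of S] z ker by auto
  show "finite_length R V S \<Longrightarrow> len R V S = len R W (f ` S)"
    using len_exact[OF f Z, of S] z ker by auto
qed

text \<open>A member of maximal length is maximal, since proper inclusion strictly raises the
  length. The family \<open>P\<close> is arbitrary; it is used for proper submodules and for spans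
  of finite sets.\<close>

lemma ex_maximal_submodule:
  assumes "finite_length R V S" and "P S0" and "\<And>N. P N \<Longrightarrow> submodule N R V \<and> N \<subseteq> S"
  obtains N where "P N" and "\<And>N'. P N' \<Longrightarrow> N \<subseteq> N' \<Longrightarrow> N' = N"
proof -
  \<comment> \<open>\<open>ARG_MAX\<close> on naturals asks for a strict bound, hence the
    \<open>Suc\<close>.\<close>
  have b: "\<forall>N. P N \<longrightarrow> len R V N < Suc (len R V S)"
    using len_mono[OF assms(1)] assms(3) by (simp add: less_Suc_eq_le)
  define N where "N = (ARG_MAX (len R V) N. P N)"
  have N: "P N" and max: "\<And>N'. P N' \<Longrightarrow> len R V N' \<le> len R V N"
    using arg_max_nat_lemma[of P S0 "len R V", OF assms(2) b] unfolding N_def by simp_all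
  have "N' = N" if N': "P N'" "N \<subseteq> N'" for N'
  proof (rule ccontr)
    assume "N' \<noteq> N"
    then have "len R V N < len R V N'"
      using N N' assms(3) finite_length_mono[OF assms(1)] by (intro len_strict_mono) auto
    then show False
      using max[OF N'(1)] by simp
  qed
  then show ?thesis
    using that N by blast
qed

lemma ex_minimal_submodule:
  assumes "finite_length R V S" and "P S0" and "\<And>N. P N \<Longrightarrow> submodule N R V \<and> N \<subseteq> S"
  obtains N where "P N" and "\<And>N'. P N' \<Longrightarrow> N' \<subseteq> N \<Longrightarrow> N' = N"
proof -
  define N where "N = (ARG_MIN (len R V) N. P N)"
  have N: "P N" and min: "\<And>N'. P N' \<Longrightarrow> len R V N \<le> len R V N'"
    using arg_min_nat_lemma[of P S0 "len R V", OF assms(2)] unfolding N_def by simp_all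
  have "N' = N" if N': "P N'" "N' \<subseteq> N" for N'
  proof (rule ccontr)
    assume "N' \<noteq> N"
    then have "len R V N' < len R V N"
      using N N' assms(3) finite_length_mono[OF assms(1)] by (intro len_strict_mono) auto
    then show False
      using min[OF N'(1)] by simp
  qed
  then show ?thesis
    using that N by blast
qed

section \<open>Left modules and their homomorphisms\<close>

lemma left_module_abelian_group: "left_module A M \<Longrightarrow> abelian_group M"
  by (simp add: left_module_def)

text \<open>Every axiom is an equation between images of elements of \<open>M\<close>, so it
  descends along the surjection. Nothing is assumed about \<open>Q\<close> beforehand, which makes
  this the common source of quotient modules and of modules carried over to another type.\<close>

lemma left_module_image:
  assumes M: "left_module A M" and surj: "f ` carrier M = carrier Q" and zero: "f \<zero>\<^bsub>M\<^esub> = \<zero>\<^bsub>Q\<^esub>"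
    and add: "\<And>x y. x \<in> carrier M \<Longrightarrow> y \<in> carrier M \<Longrightarrow> f (x \<oplus>\<^bsub>M\<^esub> y) = f x \<oplus>\<^bsub>Q\<^esub> f y"
    and smult: "\<And>a x. a \<in> carrier A \<Longrightarrow> x \<in> carrier M \<Longrightarrow> f (a \<odot>\<^bsub>M\<^esub> x) = a \<odot>\<^bsub>Q\<^esub> f x"
  shows "left_module A Q"
proof -
  interpret M: left_module A M by fact
  have ex: "\<exists>x\<in>carrier M. f x = y" if "y \<in> carrier Q" for y
    using that unfolding surj[symmetric] by auto
  have mem: "f x \<in> carrier Q" if "x \<in> carrier M" for x
    using that unfolding surj[symmetric] by (rule imageI)
  have "abelian_group Q"
  proof (rule abelian_groupI)
    fix x y z assume "x \<in> carrier Q" "y \<in> carrier Q" "z \<in> carrier Q"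
    then obtain x' y' z' where x: "x' \<in> carrier M" "f x' = x" and y: "y' \<in> carrier M" "f y' = y"
      and z: "z' \<in> carrier M" "f z' = z"
      using ex by metis
    show "x \<oplus>\<^bsub>Q\<^esub> y \<oplus>\<^bsub>Q\<^esub> z = x \<oplus>\<^bsub>Q\<^esub> (y \<oplus>\<^bsub>Q\<^esub> z)"
      using x y z M.M.a_assoc by (metis add M.M.a_closed)
  next
    fix x y assume "x \<in> carrier Q" "y \<in> carrier Q"
    then obtain x' y' where x: "x' \<in> carrier M" "f x' = x" and y: "y' \<in> carrier M" "f y' = y"
      using ex by metis
    show "x \<oplus>\<^bsub>Q\<^esub> y \<in> carrier Q"
      using x y by (metis add mem M.M.a_closed)
    show "x \<oplus>\<^bsub>Q\<^esub> y = y \<oplus>\<^bsub>Q\<^esub> x"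
      using x y by (metis add M.M.a_comm)
  next
    show "\<zero>\<^bsub>Q\<^esub> \<in> carrier Q"
      using mem zero by force
  next
    fix x assume "x \<in> carrier Q"
    then obtain x' where x: "x' \<in> carrier M" "f x' = x"
      using ex by metis
    show "\<zero>\<^bsub>Q\<^esub> \<oplus>\<^bsub>Q\<^esub> x = x"
      using x by (metis add zero M.M.l_zero M.M.zero_closed)
    show "\<exists>y\<in>carrier Q. y \<oplus>\<^bsub>Q\<^esub> x = \<zero>\<^bsub>Q\<^esub>"
      using x by (metis add zero M.M.l_neg M.M.a_inv_closed mem)
  qed
  moreover have "ring A" ..
  moreover have "left_module_axioms A Q"
  proof
    fix a b x assume ab: "a \<in> carrier A" "b \<in> carrier A" and "x \<in> carrier Q"
    then obtain x' where x: "x' \<in> carrier M" "f x' = x"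
      using ex by metis
    show "(a \<oplus>\<^bsub>A\<^esub> b) \<odot>\<^bsub>Q\<^esub> x = a \<odot>\<^bsub>Q\<^esub> x \<oplus>\<^bsub>Q\<^esub> b \<odot>\<^bsub>Q\<^esub> x"
      using ab x by (metis add smult M.smult_closed M.smult_l_distr M.A.a_closed)
    show "(a \<otimes>\<^bsub>A\<^esub> b) \<odot>\<^bsub>Q\<^esub> x = a \<odot>\<^bsub>Q\<^esub> (b \<odot>\<^bsub>Q\<^esub> x)"
      using ab x by (metis smult M.smult_closed M.smult_assoc M.A.m_closed)
  next
    fix a x assume ab: "a \<in> carrier A" and "x \<in> carrier Q"
    then obtain x' where x: "x' \<in> carrier M" "f x' = x"
      using ex by metis
    show "a \<odot>\<^bsub>Q\<^esub> x \<in> carrier Q"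
      using ab x by (metis smult mem M.smult_closed)
  next
    fix x assume "x \<in> carrier Q"
    then obtain x' where x: "x' \<in> carrier M" "f x' = x"
      using ex by metis
    show "\<one>\<^bsub>A\<^esub> \<odot>\<^bsub>Q\<^esub> x = x"
      using x by (metis smult M.smult_one M.A.one_closed)
  next
    fix a x y assume ab: "a \<in> carrier A" and "x \<in> carrier Q" "y \<in> carrier Q"
    then obtain x' y' where x: "x' \<in> carrier M" "f x' = x" and y: "y' \<in> carrier M" "f y' = y"
      using ex by metis
    show "a \<odot>\<^bsub>Q\<^esub> (x \<oplus>\<^bsub>Q\<^esub> y) = a \<odot>\<^bsub>Q\<^esub> x \<oplus>\<^bsub>Q\<^esub> a \<odot>\<^bsub>Q\<^esub> y"
      using ab x y by (metis add smult M.smult_closed M.smult_r_distr M.M.a_closed)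
  qed
  ultimately show ?thesis
    by (simp add: left_module_def)
qed

lemma left_module_smult_zero:
  assumes "left_module A M" and "a \<in> carrier A"
  shows "a \<odot>\<^bsub>M\<^esub> \<zero>\<^bsub>M\<^esub> = \<zero>\<^bsub>M\<^esub>"
proof -
  interpret left_module A M by fact
  have "a \<odot>\<^bsub>M\<^esub> (\<zero>\<^bsub>M\<^esub> \<oplus>\<^bsub>M\<^esub> \<zero>\<^bsub>M\<^esub>) = a \<odot>\<^bsub>M\<^esub> \<zero>\<^bsub>M\<^esub> \<oplus>\<^bsub>M\<^esub> a \<odot>\<^bsub>M\<^esub> \<zero>\<^bsub>M\<^esub>"
    using assms by (intro smult_r_distr) auto
  moreover have "a \<odot>\<^bsub>M\<^esub> \<zero>\<^bsub>M\<^esub> \<in> carrier M"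
    using assms by (simp add: smult_closed)
  ultimately show ?thesis
    by simp
qed

lemma zero_submodule:
  assumes "left_module A M"
  shows "submodule {\<zero>\<^bsub>M\<^esub>} A M"
  using submodule_zero[OF left_module_abelian_group[OF assms]] left_module_smult_zero[OF assms] by blast

lemma carrier_submodule:
  assumes "left_module A M"
  shows "submodule (carrier M) A M"
  by (rule submodule_carrier[OF left_module_abelian_group[OF assms] left_module.smult_closed[OF assms]])

lemma abelian_group_sub:
  assumes "abelian_group V" and "submodule N R V"
  shows "abelian_group (V\<lparr>carrier := N\<rparr>)"
proof -
  interpret V: abelian_group V by fact
  note N = submoduleD[OF assms]
  show ?thesis
  proof (rule abelian_groupI)
    fix x assume "x \<in> carrier (V\<lparr>carrier := N\<rparr>)"
    then have "x \<in> N" "x \<in> carrier V"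
      using N(1) by auto
    then show "\<exists>y\<in>carrier (V\<lparr>carrier := N\<rparr>). y \<oplus>\<^bsub>V\<lparr>carrier := N\<rparr>\<^esub> x = \<zero>\<^bsub>V\<lparr>carrier := N\<rparr>\<^esub>"
      using N(4) V.l_neg by auto
  qed (use N V.a_assoc V.a_comm in \<open>auto simp: subset_iff\<close>)
qed

lemma a_inv_sub:
  assumes "abelian_group V" and "submodule N R V" and "x \<in> N"
  shows "\<ominus>\<^bsub>V\<lparr>carrier := N\<rparr>\<^esub> x = \<ominus>\<^bsub>V\<^esub> x"
proof -
  interpret V: abelian_group V by fact
  interpret S: abelian_group "V\<lparr>carrier := N\<rparr>"
    by (rule abelian_group_sub[OF assms(1,2)])
  note N = submoduleD[OF assms(1,2)]
  have "\<ominus>\<^bsub>V\<^esub> x \<oplus>\<^bsub>V\<lparr>carrier := N\<rparr>\<^esub> x = \<zero>\<^bsub>V\<lparr>carrier := N\<rparr>\<^esub>"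
    using N(1) assms(3) V.l_neg by auto
  then show ?thesis
    using N(4) assms(3) by (intro S.minus_equality) auto
qed

lemma submodule_sub_iff:
  assumes "abelian_group V" and "submodule N R V"
  shows "submodule S R (V\<lparr>carrier := N\<rparr>) \<longleftrightarrow> submodule S R V \<and> S \<subseteq> N"
proof -
  have "\<ominus>\<^bsub>V\<lparr>carrier := N\<rparr>\<^esub> x = \<ominus>\<^bsub>V\<^esub> x" if "x \<in> S" "S \<subseteq> N" for x
    using that a_inv_sub[OF assms] by blast
  then show ?thesis
    using submoduleD(1)[OF assms]
    unfolding submodule_iff[OF assms(1)] submodule_iff[OF abelian_group_sub[OF assms]] by auto
qed

lemma left_module_sub:
  assumes "left_module A M" and "submodule N A M"
  shows "left_module A (M\<lparr>carrier := N\<rparr>)"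
proof -
  interpret M: left_module A M by fact
  note N = submoduleD[OF left_module_abelian_group[OF assms(1)] assms(2)]
  have "left_module_axioms A (M\<lparr>carrier := N\<rparr>)"
    by standard
      (use N M.smult_l_distr M.smult_r_distr M.smult_assoc M.smult_one in \<open>auto simp: subset_iff\<close>)
  then show ?thesis
    using abelian_group_sub[OF left_module_abelian_group[OF assms(1)] assms(2)] M.A.ring_axioms
    by (simp add: left_module_def)
qed

section \<open>Homomorphisms of left modules, kernels and isomorphisms\<close>

lemma lmod_homD:
  assumes "f \<in> lmod_hom A M N"
  shows "\<And>x. x \<in> carrier M \<Longrightarrow> f x \<in> carrier N" "f \<in> extensional (carrier M)"
    "\<And>x y. x \<in> carrier M \<Longrightarrow> y \<in> carrier M \<Longrightarrow> f (x \<oplus>\<^bsub>M\<^esub> y) = f x \<oplus>\<^bsub>N\<^esub> f y"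
    "\<And>a x. a \<in> carrier A \<Longrightarrow> x \<in> carrier M \<Longrightarrow> f (a \<odot>\<^bsub>M\<^esub> x) = a \<odot>\<^bsub>N\<^esub> f x"
  using assms by (auto simp: lmod_hom_def PiE_def)

lemma lmod_hom_lin_map:
  assumes "left_module A M" and "left_module A N" and "f \<in> lmod_hom A M N"
  shows "lin_map A M N f"
  using assms by (auto simp: lin_map_def left_module_abelian_group lmod_homD)

lemma lmod_hom_zero:
  assumes "left_module A M" and "left_module A N" and "f \<in> lmod_hom A M N"
  shows "f \<zero>\<^bsub>M\<^esub> = \<zero>\<^bsub>N\<^esub>"
  by (rule lin_map_zero[OF lmod_hom_lin_map[OF assms]])

lemma lmod_hom_restrictI:
  assumes M: "left_module A M" and "\<And>x. x \<in> carrier M \<Longrightarrow> f x \<in> carrier N"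
    and "\<And>x y. x \<in> carrier M \<Longrightarrow> y \<in> carrier M \<Longrightarrow> f (x \<oplus>\<^bsub>M\<^esub> y) = f x \<oplus>\<^bsub>N\<^esub> f y"
    and "\<And>a x. a \<in> carrier A \<Longrightarrow> x \<in> carrier M \<Longrightarrow> f (a \<odot>\<^bsub>M\<^esub> x) = a \<odot>\<^bsub>N\<^esub> f x"
  shows "restrict f (carrier M) \<in> lmod_hom A M N"
proof -
  interpret left_module A M by fact
  show ?thesis
    using assms(2-) smult_closed by (auto simp: lmod_hom_def)
qed

lemma lmod_hom_eqI:
  assumes "f \<in> lmod_hom A M N" and "g \<in> lmod_hom A M N'" and "\<And>x. x \<in> carrier M \<Longrightarrow> f x = g x"
  shows "f = g"
  using assms(3) lmod_homD(2)[OF assms(1)] lmod_homD(2)[OF assms(2)] by (intro extensionalityI)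

lemma lmod_hom_compose:
  assumes "left_module A L" and "f \<in> lmod_hom A L M" and "g \<in> lmod_hom A M N"
  shows "compose (carrier L) g f \<in> lmod_hom A L N"
  unfolding compose_def
  by (rule lmod_hom_restrictI[OF assms(1)]) (simp_all add: lmod_homD[OF assms(2)] lmod_homD[OF assms(3)])

lemma lmod_hom_id:
  assumes "left_module A M"
  shows "(\<lambda>x\<in>carrier M. x) \<in> lmod_hom A M M"
  by (rule lmod_hom_restrictI[OF assms]) auto

lemma zero_lmod_hom:
  assumes "left_module A M" and "left_module A N"
  shows "(\<lambda>x\<in>carrier M. \<zero>\<^bsub>N\<^esub>) \<in> lmod_hom A M N"
proof -
  interpret N: left_module A N by fact
  show ?thesis
    by (rule lmod_hom_restrictI[OF assms(1)]) (simp_all add: left_module_smult_zero[OF assms(2)])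
qed

lemma lmod_hom_sub_iff:
  assumes "submodule S A N" and "left_module A N"
  shows "f \<in> lmod_hom A M (N\<lparr>carrier := S\<rparr>) \<longleftrightarrow> f \<in> lmod_hom A M N \<and> f ` carrier M \<subseteq> S"
  using submoduleD(1)[OF left_module_abelian_group[OF assms(2)] assms(1)]
  by (auto simp: lmod_hom_def PiE_iff image_subset_iff)

lemma lmod_hom_restrict_sub:
  assumes "left_module A M" and "submodule S A M" and "f \<in> lmod_hom A M N"
  shows "restrict f S \<in> lmod_hom A (M\<lparr>carrier := S\<rparr>) N"
  using lmod_hom_restrictI[OF left_module_sub[OF assms(1,2)], of f N] lmod_homD[OF assms(3)]
    submoduleD(1)[OF left_module_abelian_group[OF assms(1)] assms(2)]
  by (auto simp: subset_iff)

lemma inclusion_lmod_hom: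
  assumes "left_module A M" and "submodule S A M"
  shows "(\<lambda>x\<in>S. x) \<in> lmod_hom A (M\<lparr>carrier := S\<rparr>) M"
  using lmod_hom_restrict_sub[OF assms lmod_hom_id[OF assms(1)]]
    submoduleD(1)[OF left_module_abelian_group[OF assms(1)] assms(2)]
  by (simp add: restrict_restrict Int_absorb1)

definition lmod_ker :: "('a, 'm) module \<Rightarrow> ('a, 'n) module \<Rightarrow> ('m \<Rightarrow> 'n) \<Rightarrow> 'm set" where
  "lmod_ker M N f = {x \<in> carrier M. f x = \<zero>\<^bsub>N\<^esub>}"

lemma a_kernel_eq: "a_kernel M N f = lmod_ker M N f"
  by (simp add: a_kernel_def kernel_def lmod_ker_def)

lemma submodule_ker:
  assumes "left_module A M" and "left_module A N" and "f \<in> lmod_hom A M N"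
  shows "submodule (lmod_ker M N f) A M"
  unfolding lmod_ker_def
  using submodule_vimage[OF lmod_hom_lin_map[OF assms] carrier_submodule[OF assms(1)] zero_submodule[OF assms(2)]]
  by simp

lemma submodule_hom_image:
  assumes "left_module A M" and "left_module A N" and "f \<in> lmod_hom A M N" and "submodule S A M"
  shows "submodule (f ` S) A N"
  by (rule submodule_image[OF lmod_hom_lin_map[OF assms(1-3)] assms(4)])

lemma submodule_hom_vimage:
  assumes "left_module A M" and "left_module A N" and "f \<in> lmod_hom A M N" and "submodule S A N"
  shows "submodule {x \<in> carrier M. f x \<in> S} A M"
  by (rule submodule_vimage[OF lmod_hom_lin_map[OF assms(1-3)] carrier_submodule[OF assms(1)] assms(4)])

lemma lmod_hom_inj_iff:
  assumes "left_module A M" and "left_module A N" and "f \<in> lmod_hom A M N"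
  shows "inj_on f (carrier M) \<longleftrightarrow> lmod_ker M N f = {\<zero>\<^bsub>M\<^esub>}"
proof
  interpret M: left_module A M by fact
  interpret N: left_module A N by fact
  note z = lmod_hom_zero[OF assms] and mi = lin_map_minus[OF lmod_hom_lin_map[OF assms]]
  {
    assume inj: "inj_on f (carrier M)"
    then show "lmod_ker M N f = {\<zero>\<^bsub>M\<^esub>}"
      using z by (auto simp: lmod_ker_def dest!: inj_onD[OF inj])
         (metis M.M.zero_closed inj inj_onD)
  }
  assume ker: "lmod_ker M N f = {\<zero>\<^bsub>M\<^esub>}"
  show "inj_on f (carrier M)"
  proof (rule inj_onI)
    fix x y assume xy: "x \<in> carrier M" "y \<in> carrier M" "f x = f y"
    then have "f (x \<ominus>\<^bsub>M\<^esub> y) = \<zero>\<^bsub>N\<^esub>"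
      using mi[OF xy(1,2)] lmod_homD(1)[OF assms(3) xy(2)] by (simp add: a_minus_def N.M.r_neg)
    then have "x \<ominus>\<^bsub>M\<^esub> y = \<zero>\<^bsub>M\<^esub>"
      using ker xy by (auto simp: lmod_ker_def)
    then have "x \<ominus>\<^bsub>M\<^esub> y \<oplus>\<^bsub>M\<^esub> y = y"
      using xy by simp
    then show "x = y"
      using xy by (simp add: a_minus_def M.M.a_assoc M.M.l_neg)
  qed
qed

lemma lmod_hom_inverse:
  assumes "left_module A M" and "left_module A N" and "f \<in> lmod_hom A M N"
    and "bij_betw f (carrier M) (carrier N)"
  obtains g where "g \<in> lmod_hom A N M" "\<And>x. x \<in> carrier M \<Longrightarrow> g (f x) = x"
    "\<And>y. y \<in> carrier N \<Longrightarrow> f (g y) = y"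
proof -
  interpret M: left_module A M by fact
  interpret N: left_module A N by fact
  define g where "g = restrict (inv_into (carrier M) f) (carrier N)"
  have inj: "inj_on f (carrier M)" and im: "f ` carrier M = carrier N"
    using assms(4) by (auto simp: bij_betw_def)
  have gf: "g (f x) = x" if "x \<in> carrier M" for x
    using that inj lmod_homD(1)[OF assms(3)] by (simp add: g_def)
  have fg: "f (g y) = y" and gM: "g y \<in> carrier M" if "y \<in> carrier N" for y
    using that im by (auto simp: g_def f_inv_into_f inv_into_into)
  have "restrict g (carrier N) \<in> lmod_hom A N M"
  proof (rule lmod_hom_restrictI[OF assms(2) gM])
    fix x y assume xy: "x \<in> carrier N" "y \<in> carrier N"
    then have "f (g x \<oplus>\<^bsub>M\<^esub> g y) = x \<oplus>\<^bsub>N\<^esub> y"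
      using gM fg lmod_homD(3)[OF assms(3)] by simp
    then show "g (x \<oplus>\<^bsub>N\<^esub> y) = g x \<oplus>\<^bsub>M\<^esub> g y"
      using gf xy gM by (metis M.M.a_closed)
  next
    fix a x assume ax: "a \<in> carrier A" "x \<in> carrier N"
    then have "f (a \<odot>\<^bsub>M\<^esub> g x) = a \<odot>\<^bsub>N\<^esub> x"
      using gM fg lmod_homD(4)[OF assms(3)] by simp
    then show "g (a \<odot>\<^bsub>N\<^esub> x) = a \<odot>\<^bsub>M\<^esub> g x"
      using gf ax gM by (metis M.smult_closed)
  qed
  moreover have "restrict g (carrier N) = g"
    by (simp add: g_def)
  ultimately show ?thesis
    using that gf fg by simp
qed

lemma lmod_isoI:
  "f \<in> lmod_hom A M N \<Longrightarrow> inj_on f (carrier M) \<Longrightarrow> f ` carrier M = carrier N \<Longrightarrow> lmod_iso A M N"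
  by (auto simp: lmod_iso_def bij_betw_def)

lemma lmod_iso_refl: "left_module A M \<Longrightarrow> lmod_iso A M M"
  by (rule lmod_isoI[OF lmod_hom_id]) auto

lemma lmod_iso_sym:
  assumes "left_module A M" and "left_module A N" and "lmod_iso A M N"
  shows "lmod_iso A N M"
proof -
  obtain f where f: "f \<in> lmod_hom A M N" "bij_betw f (carrier M) (carrier N)"
    using assms(3) by (auto simp: lmod_iso_def)
  obtain g where g: "g \<in> lmod_hom A N M" "\<And>x. x \<in> carrier M \<Longrightarrow> g (f x) = x"
    "\<And>y. y \<in> carrier N \<Longrightarrow> f (g y) = y"
    by (rule lmod_hom_inverse[OF assms(1,2) f]) blast
  have "bij_betw g (carrier N) (carrier M)"
    by (rule bij_betw_byWitness[where f' = f]) (use g lmod_homD(1)[OF f(1)] lmod_homD(1)[OF g(1)] in auto)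
  then show ?thesis
    using g(1) by (auto simp: lmod_iso_def)
qed

lemma lmod_iso_trans:
  assumes "left_module A L" and "lmod_iso A L M" and "lmod_iso A M N"
  shows "lmod_iso A L N"
proof -
  obtain f g where fg: "f \<in> lmod_hom A L M" "bij_betw f (carrier L) (carrier M)"
    "g \<in> lmod_hom A M N" "bij_betw g (carrier M) (carrier N)"
    using assms(2,3) by (auto simp: lmod_iso_def)
  have "bij_betw (compose (carrier L) g f) (carrier L) (carrier N)"
    using fg(2,4) by (rule bij_betw_compose)
  then show ?thesis
    using lmod_hom_compose[OF assms(1) fg(1,3)] by (auto simp: lmod_iso_def)
qed

text \<open>\<open>f\<close> is constant on the fibres of \<open>p\<close>, because two points of a
  fibre differ by an element of the kernel of \<open>p\<close>. So \<open>f\<close> may be evaluated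
  at an arbitrary section \<open>s\<close> of \<open>p\<close>; the section is no homomorphism, but
  \<open>f\<close> after \<open>s\<close> is.\<close>

lemma lmod_hom_factor:
  assumes M: "left_module A M" and Q: "left_module A Q" and X: "left_module A X"
    and p: "p \<in> lmod_hom A M Q" "p ` carrier M = carrier Q"
    and f: "f \<in> lmod_hom A M X" and ker: "lmod_ker M Q p \<subseteq> lmod_ker M X f"
  obtains g where "g \<in> lmod_hom A Q X" "compose (carrier M) g p = f"
proof -
  interpret M: left_module A M by fact
  interpret Q: left_module A Q by fact
  interpret X: left_module A X by fact
  have wd: "f x = f y" if "x \<in> carrier M" "y \<in> carrier M" "p x = p y" for x y
  proof -
    have "p (x \<ominus>\<^bsub>M\<^esub> y) = \<zero>\<^bsub>Q\<^esub>"
      using that lin_map_minus[OF lmod_hom_lin_map[OF M Q p(1)], of x y] lmod_homD(1)[OF p(1)]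
      by (simp add: a_minus_def Q.M.r_neg)
    then have "f (x \<ominus>\<^bsub>M\<^esub> y) = \<zero>\<^bsub>X\<^esub>"
      using ker that by (auto simp: lmod_ker_def)
    moreover have "f x = f ((x \<ominus>\<^bsub>M\<^esub> y) \<oplus>\<^bsub>M\<^esub> y)"
      using that by (simp add: a_minus_def M.M.a_assoc M.M.l_neg)
    ultimately show ?thesis
      using that lmod_homD[OF f] by simp
  qed
  define s where "s = inv_into (carrier M) p"
  have s: "s q \<in> carrier M" "p (s q) = q" if "q \<in> carrier Q" for q
    using that p(2) by (auto simp: s_def f_inv_into_f inv_into_into)
  have fs: "f (s (p x)) = f x" if "x \<in> carrier M" for x
    using that s lmod_homD(1)[OF p(1)] by (intro wd) auto
  have "(\<lambda>q\<in>carrier Q. f (s q)) \<in> lmod_hom A Q X"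
  proof (rule lmod_hom_restrictI[OF Q])
    fix q assume "q \<in> carrier Q"
    then show "f (s q) \<in> carrier X"
      using s lmod_homD(1)[OF f] by blast
  next
    fix q r assume qr: "q \<in> carrier Q" "r \<in> carrier Q"
    have "f (s (q \<oplus>\<^bsub>Q\<^esub> r)) = f (s q \<oplus>\<^bsub>M\<^esub> s r)"
      using qr s by (intro wd) (auto simp: lmod_homD(3)[OF p(1)])
    then show "f (s (q \<oplus>\<^bsub>Q\<^esub> r)) = f (s q) \<oplus>\<^bsub>X\<^esub> f (s r)"
      using qr s by (simp add: lmod_homD(3)[OF f])
  next
    fix a q assume aq: "a \<in> carrier A" "q \<in> carrier Q"
    have "f (s (a \<odot>\<^bsub>Q\<^esub> q)) = f (a \<odot>\<^bsub>M\<^esub> s q)"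
      using aq s by (intro wd) (auto simp: lmod_homD(4)[OF p(1)] M.smult_closed Q.smult_closed)
    then show "f (s (a \<odot>\<^bsub>Q\<^esub> q)) = a \<odot>\<^bsub>X\<^esub> f (s q)"
      using aq s by (simp add: lmod_homD(4)[OF f])
  qed
  moreover have "compose (carrier M) (\<lambda>q\<in>carrier Q. f (s q)) p = f"
    by (rule extensionalityI[OF compose_extensional lmod_homD(2)[OF f]])
      (use fs lmod_homD(1)[OF p(1)] in \<open>auto simp: compose_def\<close>)
  ultimately show ?thesis
    using that by blast
qed

subsection \<open>Quotients\<close>

definition quot_proj :: "('a, 'm) module \<Rightarrow> 'm set \<Rightarrow> 'm \<Rightarrow> 'm set" where
  "quot_proj M N = (\<lambda>x\<in>carrier M. N +>\<^bsub>M\<^esub> x)"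

lemma quot_module:
  assumes M: "left_module A M" and N: "submodule N A M"
  shows "left_module A (quot_module M N)" "quot_proj M N \<in> lmod_hom A M (quot_module M N)"
    "quot_proj M N ` carrier M = carrier (quot_module M N)"
    "lmod_ker M (quot_module M N) (quot_proj M N) = N"
proof -
  interpret M: left_module A M by fact
  note D = submoduleD[OF left_module_abelian_group[OF M] N]
  have sg: "subgroup N (add_monoid M)"
    using N by (simp add: submodule_def)
  interpret N: abelian_subgroup N M
    by (rule abelian_subgroupI3[OF additive_subgroupI[OF sg] left_module_abelian_group[OF M]])
  let ?Q = "quot_module M N"
  define p where "p = (\<lambda>x. N +>\<^bsub>M\<^esub> x)"
  have surj: "p ` carrier M = carrier ?Q"
    by (auto simp: p_def quot_module_def A_RCOSETS_def')
  have zero: "p \<zero>\<^bsub>M\<^esub> = \<zero>\<^bsub>?Q\<^esub>"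
    using D(1) by (simp add: p_def quot_module_def)
  have add: "p (x \<oplus>\<^bsub>M\<^esub> y) = p x \<oplus>\<^bsub>?Q\<^esub> p y" if "x \<in> carrier M" "y \<in> carrier M" for x y
    using that by (simp add: p_def quot_module_def N.a_rcos_sum)
  \<comment> \<open>The union defining scalar multiplication runs over all representatives. They all
    yield the same coset, since \<open>a \<odot> n\<close> stays in \<open>N\<close>, so the union
    collapses to a single coset.\<close>
  have smult: "p (a \<odot>\<^bsub>M\<^esub> x) = a \<odot>\<^bsub>?Q\<^esub> p x" if a: "a \<in> carrier A" and x: "x \<in> carrier M" for a x
  proof -
    have "N +>\<^bsub>M\<^esub> (a \<odot>\<^bsub>M\<^esub> y) = N +>\<^bsub>M\<^esub> (a \<odot>\<^bsub>M\<^esub> x)" if y: "y \<in> N +>\<^bsub>M\<^esub> x" for y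
    proof -
      obtain n where n: "n \<in> N" "y = n \<oplus>\<^bsub>M\<^esub> x"
        using y by (auto simp: a_r_coset_def')
      then have "a \<odot>\<^bsub>M\<^esub> y = a \<odot>\<^bsub>M\<^esub> n \<oplus>\<^bsub>M\<^esub> a \<odot>\<^bsub>M\<^esub> x"
        using D(1) a x M.smult_r_distr by auto
      moreover have "a \<odot>\<^bsub>M\<^esub> n \<in> N"
        using D(5) a n by blast
      ultimately have "a \<odot>\<^bsub>M\<^esub> y \<in> N +>\<^bsub>M\<^esub> (a \<odot>\<^bsub>M\<^esub> x)"
        by (auto simp: a_r_coset_def')
      then show ?thesis
        using M.M.a_repr_independence[OF _ _ sg] a x M.smult_closed by metis
    qed
    moreover have "x \<in> N +>\<^bsub>M\<^esub> x"
      using x by (rule N.a_rcos_self)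
    ultimately have "(\<Union>y\<in>N +>\<^bsub>M\<^esub> x. N +>\<^bsub>M\<^esub> (a \<odot>\<^bsub>M\<^esub> y)) = N +>\<^bsub>M\<^esub> (a \<odot>\<^bsub>M\<^esub> x)"
      by (metis (no_types, lifting) SUP_eq_const empty_iff)
    then show ?thesis
      by (simp add: p_def quot_module_def)
  qed
  show "left_module A ?Q"
    by (rule left_module_image[OF M surj zero add smult])
  have "restrict p (carrier M) \<in> lmod_hom A M ?Q"
    by (rule lmod_hom_restrictI[OF M _ add smult]) (use surj in auto)
  then show "quot_proj M N \<in> lmod_hom A M ?Q"
    by (simp add: quot_proj_def p_def)
  show "quot_proj M N ` carrier M = carrier ?Q"
    using surj by (simp add: quot_proj_def p_def)
  have "N +>\<^bsub>M\<^esub> x = N \<longleftrightarrow> x \<in> N" if "x \<in> carrier M" for x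
    using that M.M.a_coset_join1[OF _ _ sg] M.M.a_coset_join2[OF _ sg] by blast
  then show "lmod_ker M ?Q (quot_proj M N) = N"
    using D(1) by (auto simp: lmod_ker_def quot_proj_def quot_module_def)
qed

text \<open>From here on a subquotient is handled through a surjection with the right kernel, not
  through its cosets.\<close>

lemma subquot:
  assumes M: "left_module A M" and N': "submodule N' A M" and N: "submodule N A M" and "N \<subseteq> N'"
  obtains p where "left_module A (subquot M N' N)"
    "p \<in> lmod_hom A (M\<lparr>carrier := N'\<rparr>) (subquot M N' N)" "p ` N' = carrier (subquot M N' N)"
    "lmod_ker (M\<lparr>carrier := N'\<rparr>) (subquot M N' N) p = N"
proof -
  have "submodule N A (M\<lparr>carrier := N'\<rparr>)"
    using assms submodule_sub_iff[OF left_module_abelian_group[OF M] N'] by blast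
  from quot_module[OF left_module_sub[OF M N'] this] show ?thesis
    using that by (simp add: subquot_def)
qed

section \<open>Finite-dimensional vector spaces\<close>

definition lin_span :: "('k, 'x) ring_scheme \<Rightarrow> ('k, 'v, 'y) module_scheme \<Rightarrow> 'v set \<Rightarrow> 'v set" where
  "lin_span K V B = {finsum V (\<lambda>b. c b \<odot>\<^bsub>V\<^esub> b) B |c. c \<in> B \<rightarrow> carrier K}"

lemma fin_dim_iff_lin_span:
  assumes "Module.module K V"
  shows "fin_dim K V \<longleftrightarrow> (\<exists>B. finite B \<and> B \<subseteq> carrier V \<and> carrier V \<subseteq> lin_span K V B)"
  unfolding fin_dim_def lin_span_def subset_iff by (intro iff_exI conj_cong refl) blast

context Module.module
begin

lemma lin_span_empty: "lin_span R M {} = {\<zero>\<^bsub>M\<^esub>}"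
  by (auto simp: lin_span_def)

lemma lin_span_insert:
  assumes "finite B" and "b \<notin> B" and "insert b B \<subseteq> carrier M"
  shows "lin_span R M (insert b B) = {k \<odot>\<^bsub>M\<^esub> b \<oplus>\<^bsub>M\<^esub> s |k s. k \<in> carrier R \<and> s \<in> lin_span R M B}"
    (is "?L = ?R")
proof
  have sum: "finsum M (\<lambda>x. c x \<odot>\<^bsub>M\<^esub> x) (insert b B)
      = c b \<odot>\<^bsub>M\<^esub> b \<oplus>\<^bsub>M\<^esub> finsum M (\<lambda>x. c x \<odot>\<^bsub>M\<^esub> x) B" if "c \<in> insert b B \<rightarrow> carrier R" for c
    using assms that by (intro M.finsum_insert) auto
  show "?L \<subseteq> ?R"
    using sum by (fastforce simp: lin_span_def)
  show "?R \<subseteq> ?L"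
  proof
    fix x assume "x \<in> ?R"
    then obtain k c where k: "k \<in> carrier R" and c: "c \<in> B \<rightarrow> carrier R"
      and x: "x = k \<odot>\<^bsub>M\<^esub> b \<oplus>\<^bsub>M\<^esub> finsum M (\<lambda>x. c x \<odot>\<^bsub>M\<^esub> x) B"
      by (auto simp: lin_span_def)
    define c' where "c' = c(b := k)"
    have c': "c' \<in> insert b B \<rightarrow> carrier R"
      using k c by (auto simp: c'_def)
    have "finsum M (\<lambda>x. c' x \<odot>\<^bsub>M\<^esub> x) B = finsum M (\<lambda>x. c x \<odot>\<^bsub>M\<^esub> x) B"
      using assms c by (intro M.finsum_cong') (auto simp: c'_def)
    then have "x = finsum M (\<lambda>x. c' x \<odot>\<^bsub>M\<^esub> x) (insert b B)"
      using sum[OF c'] by (simp add: x c'_def)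
    then show "x \<in> ?L"
      using c' by (auto simp: lin_span_def)
  qed
qed

lemma submodule_line_sum:
  assumes S: "submodule S R M" and b: "b \<in> carrier M"
  shows "submodule {k \<odot>\<^bsub>M\<^esub> b \<oplus>\<^bsub>M\<^esub> s |k s. k \<in> carrier R \<and> s \<in> S} R M" (is "submodule ?T R M")
proof -
  note D = submoduleD[OF M.abelian_group_axioms S]
  have el: "k \<odot>\<^bsub>M\<^esub> b \<oplus>\<^bsub>M\<^esub> s \<in> ?T" if "k \<in> carrier R" "s \<in> S" for k s
    using that by blast
  have ex: "\<exists>k s. x = k \<odot>\<^bsub>M\<^esub> b \<oplus>\<^bsub>M\<^esub> s \<and> k \<in> carrier R \<and> s \<in> S" if "x \<in> ?T" for x
    using that by simp
  have S_carr: "s \<in> carrier M" if "s \<in> S" for s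
    using D(1) that by blast
  have "\<zero>\<^bsub>M\<^esub> \<in> ?T"
    using el[of \<zero> "\<zero>\<^bsub>M\<^esub>"] D(2) b by simp
  moreover have "x \<oplus>\<^bsub>M\<^esub> y \<in> ?T" if xy: "x \<in> ?T" "y \<in> ?T" for x y
  proof -
    obtain k s l t where k: "k \<in> carrier R" "s \<in> S" "x = k \<odot>\<^bsub>M\<^esub> b \<oplus>\<^bsub>M\<^esub> s"
      and l: "l \<in> carrier R" "t \<in> S" "y = l \<odot>\<^bsub>M\<^esub> b \<oplus>\<^bsub>M\<^esub> t"
      using ex[OF xy(1)] ex[OF xy(2)] by metis
    then have "x \<oplus>\<^bsub>M\<^esub> y = (k \<oplus> l) \<odot>\<^bsub>M\<^esub> b \<oplus>\<^bsub>M\<^esub> (s \<oplus>\<^bsub>M\<^esub> t)"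
      using b S_carr by (simp add: smult_l_distr M.add.m_ac)
    then show ?thesis
      using el[of "k \<oplus> l" "s \<oplus>\<^bsub>M\<^esub> t"] k l D(3) by simp
  qed
  moreover have "a \<odot>\<^bsub>M\<^esub> x \<in> ?T" if ax: "a \<in> carrier R" "x \<in> ?T" for a x
  proof -
    obtain k s where k: "k \<in> carrier R" "s \<in> S" "x = k \<odot>\<^bsub>M\<^esub> b \<oplus>\<^bsub>M\<^esub> s"
      using ex[OF ax(2)] by metis
    then have "a \<odot>\<^bsub>M\<^esub> x = (a \<otimes> k) \<odot>\<^bsub>M\<^esub> b \<oplus>\<^bsub>M\<^esub> a \<odot>\<^bsub>M\<^esub> s"
      using b S_carr ax(1) by (simp add: smult_r_distr smult_assoc1)
    then show ?thesis
      using el[of "a \<otimes> k" "a \<odot>\<^bsub>M\<^esub> s"] k ax(1) D(5) by simp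
  qed
  moreover have "\<ominus>\<^bsub>M\<^esub> x \<in> ?T" if x: "x \<in> ?T" for x
  proof -
    obtain k s where k: "k \<in> carrier R" "s \<in> S" "x = k \<odot>\<^bsub>M\<^esub> b \<oplus>\<^bsub>M\<^esub> s"
      using ex[OF x] by metis
    then have "\<ominus>\<^bsub>M\<^esub> x = (\<ominus> k) \<odot>\<^bsub>M\<^esub> b \<oplus>\<^bsub>M\<^esub> \<ominus>\<^bsub>M\<^esub> s"
      using b S_carr by (simp add: M.minus_add smult_l_minus)
    then show ?thesis
      using el[of "\<ominus> k" "\<ominus>\<^bsub>M\<^esub> s"] k D(4) by simp
  qed
  moreover have "?T \<subseteq> carrier M"
    using b S_carr by auto
  ultimately show ?thesis
    unfolding submodule_iff[OF M.abelian_group_axioms] by simp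
qed

lemma submodule_lin_span:
  assumes "finite B" and "B \<subseteq> carrier M"
  shows "submodule (lin_span R M B) R M"
  using assms
proof (induction rule: finite_induct)
  case empty
  then show ?case
    by (auto simp: lin_span_empty intro!: submodule_zero M.abelian_group_axioms)
next
  case (insert b B)
  then show ?case
    using submodule_line_sum[of "lin_span R M B" b] lin_span_insert[of B b] by auto
qed

lemma lin_span_subset:
  assumes "finite B" and "B \<subseteq> S" and S: "submodule S R M"
  shows "lin_span R M B \<subseteq> S"
  using assms(1,2)
proof (induction rule: finite_induct)
  case empty
  then show ?case
    using submoduleD(2)[OF M.abelian_group_axioms S] by (simp add: lin_span_empty)
next
  case (insert b B)
  then show ?case
    using submoduleD[OF M.abelian_group_axioms S]
    by (subst lin_span_insert) (auto simp: subset_iff)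
qed

lemma subset_lin_span_insert:
  assumes "finite B" and "insert b B \<subseteq> carrier M"
  shows "lin_span R M B \<subseteq> lin_span R M (insert b B)" and "b \<in> lin_span R M (insert b B)"
proof -
  have "lin_span R M B \<subseteq> lin_span R M (insert b B) \<and> (b \<notin> B \<longrightarrow> b \<in> lin_span R M (insert b B))"
    if "finite B" "insert b B \<subseteq> carrier M" for b B
  proof (cases "b \<in> B")
    case True
    then show ?thesis
      by (simp add: insert_absorb)
  next
    case False
    note S = submoduleD[OF M.abelian_group_axioms submodule_lin_span[OF that(1)]]
    have "B \<subseteq> carrier M"
      using that(2) by simp
    note S = S[OF this]
    have "s = \<zero> \<odot>\<^bsub>M\<^esub> b \<oplus>\<^bsub>M\<^esub> s" if "s \<in> lin_span R M B" for s
      using subsetD[OF S(1) that] \<open>insert b B \<subseteq> carrier M\<close> by simp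
    moreover have "b = \<one> \<odot>\<^bsub>M\<^esub> b \<oplus>\<^bsub>M\<^esub> \<zero>\<^bsub>M\<^esub>" "\<zero>\<^bsub>M\<^esub> \<in> lin_span R M B"
      using S(2) that(2) by auto
    moreover have "k \<odot>\<^bsub>M\<^esub> b \<oplus>\<^bsub>M\<^esub> s \<in> lin_span R M (insert b B)"
      if "k \<in> carrier R" "s \<in> lin_span R M B" for k s
      unfolding lin_span_insert[OF \<open>finite B\<close> False \<open>insert b B \<subseteq> carrier M\<close>] using that by auto
    ultimately show ?thesis
      by (metis R.one_closed R.zero_closed subsetI)
  qed
  \<comment> \<open>The second instance is for \<open>b\<close> already in \<open>B\<close>: then
    \<open>insert b (B - {b})\<close> is \<open>B\<close> itself, and \<open>b\<close> is not in the
    smaller set.\<close>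
  from this[of B b] this[of "B - {b}" b] assms
  show "lin_span R M B \<subseteq> lin_span R M (insert b B)" "b \<in> lin_span R M (insert b B)"
    by auto
qed

end

text \<open>The exchange argument in terms of chains. The quotient of \<open>K b + S\<close> by
  \<open>S\<close> has dimension at most one, so intersecting with \<open>S\<close> loses at most
  one step of a chain: the one at which it leaves \<open>S\<close>. The \<open>if\<close> records
  whether that step has been spent.\<close>

lemma sub_chain_line:
  assumes K: "field K" and V: "Module.module K V" and S: "submodule S K V" and b: "b \<in> carrier V"
    and "sub_chain K V n T" and "T \<subseteq> {k \<odot>\<^bsub>V\<^esub> b \<oplus>\<^bsub>V\<^esub> s |k s. k \<in> carrier K \<and> s \<in> S}"
  shows "\<exists>m. sub_chain K V m (T \<inter> S) \<and> n \<le> m + (if T \<subseteq> S then 0 else 1)"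
proof -
  interpret K: field K by fact
  interpret V: Module.module K V by fact
  note ab = V.M.abelian_group_axioms
  note D = submoduleD[OF ab S]
  have Int: "submodule (T \<inter> S) K V" if "submodule T K V" for T
    using submodule_Int[OF ab S, of "{T, S}"] that S by auto
  show ?thesis
    using assms(5,6)
  proof (induction rule: sub_chain.induct)
    case (base T)
    then show ?case
      using Int[of T] by (auto intro: sub_chain.base)
  next
    case (step n T T')
    then obtain m where m: "sub_chain K V m (T \<inter> S)" "n \<le> m + (if T \<subseteq> S then 0 else 1)"
      by blast
    have T': "submodule (T' \<inter> S) K V"
      using Int step by blast
    have T: "submodule T K V"
      using step sub_chain_submodule by blast
    show ?case
    proof (cases "T \<subseteq> S \<and> \<not> T' \<subseteq> S")
      case True
      then show ?thesis
        using m sub_chain_mono[OF m(1) _ T'] step(2) by (intro exI[of _ m]) auto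
    next
      case False
      have "T \<inter> S \<noteq> T' \<inter> S"
      proof
        assume eq: "T \<inter> S = T' \<inter> S"
        with False step(2) have "\<not> T \<subseteq> S"
          by blast
        then obtain t where t: "t \<in> T" "t \<notin> S"
          by blast
        obtain x where x: "x \<in> T'" "x \<notin> T"
          using step(2) by blast
        obtain k s where k: "k \<in> carrier K" "s \<in> S" "t = k \<odot>\<^bsub>V\<^esub> b \<oplus>\<^bsub>V\<^esub> s"
          using t step by blast
        obtain l r where l: "l \<in> carrier K" "r \<in> S" "x = l \<odot>\<^bsub>V\<^esub> b \<oplus>\<^bsub>V\<^esub> r"
          using x step by blast
        have sr: "s \<in> carrier V" "r \<in> carrier V"
          using D(1) k l by auto
        have "k \<noteq> \<zero>\<^bsub>K\<^esub>"
          using k t b sr by auto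
        then have inv: "inv\<^bsub>K\<^esub> k \<in> carrier K" "inv\<^bsub>K\<^esub> k \<otimes>\<^bsub>K\<^esub> k = \<one>\<^bsub>K\<^esub>"
          using k K.field_Units by auto
        \<comment> \<open>The scalar is chosen so that \<open>q t\<close> has the same
          \<open>b\<close>-component as \<open>x\<close>; then \<open>x - q t\<close> lies in
          \<open>S\<close>. The inverse of \<open>k\<close> exists because \<open>k = 0\<close>
          would put \<open>t\<close> into \<open>S\<close>.\<close>
        define q where "q = l \<otimes>\<^bsub>K\<^esub> inv\<^bsub>K\<^esub> k"
        have q: "q \<in> carrier K" "q \<otimes>\<^bsub>K\<^esub> k = l"
          using inv l k by (auto simp: q_def K.m_assoc)
        have "q \<odot>\<^bsub>V\<^esub> t = l \<odot>\<^bsub>V\<^esub> b \<oplus>\<^bsub>V\<^esub> q \<odot>\<^bsub>V\<^esub> s"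
          using q k b sr by (simp add: V.smult_r_distr V.smult_assoc1[symmetric])
        moreover have "l \<odot>\<^bsub>V\<^esub> b \<in> carrier V" "q \<odot>\<^bsub>V\<^esub> s \<in> carrier V"
          using q l b sr by auto
        ultimately have "x \<ominus>\<^bsub>V\<^esub> q \<odot>\<^bsub>V\<^esub> t = r \<ominus>\<^bsub>V\<^esub> q \<odot>\<^bsub>V\<^esub> s"
          using l sr by (simp add: a_minus_def V.M.minus_add V.M.add.m_ac V.M.r_neg2)
        moreover have "r \<ominus>\<^bsub>V\<^esub> q \<odot>\<^bsub>V\<^esub> s \<in> S"
          using submodule_minus[OF ab S] D(5) l k q by blast
        moreover have qt: "q \<odot>\<^bsub>V\<^esub> t \<in> T"
          using submoduleD(5)[OF ab T] q t by blast
        then have "x \<ominus>\<^bsub>V\<^esub> q \<odot>\<^bsub>V\<^esub> t \<in> T'"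
          using submodule_minus[OF ab step(3)] x step(2) by blast
        ultimately have "x \<ominus>\<^bsub>V\<^esub> q \<odot>\<^bsub>V\<^esub> t \<in> T"
          using eq by auto
        then have "x \<ominus>\<^bsub>V\<^esub> q \<odot>\<^bsub>V\<^esub> t \<oplus>\<^bsub>V\<^esub> q \<odot>\<^bsub>V\<^esub> t \<in> T"
          using submoduleD(3)[OF ab T] qt by blast
        moreover have "x \<in> carrier V" "q \<odot>\<^bsub>V\<^esub> t \<in> carrier V"
          using submoduleD(1)[OF ab step(3)] submoduleD(1)[OF ab T] x qt by auto
        ultimately show False
          using x(2) by (simp add: a_minus_def V.M.a_assoc V.M.l_neg)
      qed
      then have "T \<inter> S \<subset> T' \<inter> S"
        using step(2) by blast
      then have "sub_chain K V (Suc m) (T' \<inter> S)"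
        using sub_chain.step[OF m(1) _ T'] by blast
      moreover have "Suc n \<le> Suc m + (if T' \<subseteq> S then 0 else 1)"
        using m(2) False step(2) by (auto split: if_splits)
      ultimately show ?thesis
        by blast
    qed
  qed
qed

text \<open>Each new generator raises the bound on the length of chains by at most one.\<close>

lemma finite_length_lin_span:
  assumes K: "field K" and V: "Module.module K V" and "finite B" and "B \<subseteq> carrier V"
  shows "finite_length K V (lin_span K V B)"
  using assms(3,4)
proof (induction rule: finite_induct)
  case empty
  interpret V: Module.module K V by fact
  show ?case
    using len_zero(1)[OF V.M.abelian_group_axioms submodule_zero[OF V.M.abelian_group_axioms V.smult_r_null]]
    by (simp add: V.lin_span_empty)
next
  case (insert b B)
  interpret V: Module.module K V by fact
  have S: "submodule (lin_span K V B) K V" "finite_length K V (lin_span K V B)"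
    using insert by (auto intro: V.submodule_lin_span)
  obtain c where c: "\<And>m. sub_chain K V m (lin_span K V B) \<Longrightarrow> m \<le> c"
    using S(2) by (auto simp: finite_length_def)
  let ?T = "lin_span K V (insert b B)"
  have eq: "?T = {k \<odot>\<^bsub>V\<^esub> b \<oplus>\<^bsub>V\<^esub> s |k s. k \<in> carrier K \<and> s \<in> lin_span K V B}"
    using insert by (intro V.lin_span_insert) auto
  have "lin_span K V B \<subseteq> ?T"
    using insert by (intro V.subset_lin_span_insert) auto
  then have Int: "?T \<inter> lin_span K V B = lin_span K V B"
    by blast
  have "n \<le> c + 1" if "sub_chain K V n ?T" for n
  proof -
    have "\<exists>m. sub_chain K V m (?T \<inter> lin_span K V B) \<and> n \<le> m + (if ?T \<subseteq> lin_span K V B then 0 else 1)"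
      using insert(4) by (intro sub_chain_line[OF K V S(1) _ that, of b] equalityD1[OF eq]) auto
    then obtain m where "sub_chain K V m (lin_span K V B)" "n \<le> m + 1"
      unfolding Int by (auto split: if_splits)
    then show ?thesis
      using c by fastforce
  qed
  moreover have "submodule ?T K V"
    using insert by (intro V.submodule_lin_span) auto
  ultimately show ?case
    by (auto simp: finite_length_def)
qed

text \<open>This replaces finite generation by a condition that passes to submodules directly. For
  the converse, a maximal span of a finite set must be the whole space, since adjoining any further
  vector does not enlarge it.\<close>

lemma fin_dim_iff_finite_length:
  assumes K: "field K" and V: "Module.module K V"
  shows "fin_dim K V \<longleftrightarrow> finite_length K V (carrier V)"
proof
  interpret V: Module.module K V by fact
  have C: "submodule (carrier V) K V"
    by (rule submodule_carrier[OF V.M.abelian_group_axioms V.smult_closed])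
  {
    assume "fin_dim K V"
    then obtain B where B: "finite B" "B \<subseteq> carrier V" "carrier V \<subseteq> lin_span K V B"
      using fin_dim_iff_lin_span[OF V] by auto
    then have "lin_span K V B = carrier V"
      using V.lin_span_subset[OF _ _ C, of B] by auto
    then show "finite_length K V (carrier V)"
      using finite_length_lin_span[OF K V B(1,2)] by simp
  }
  assume fl: "finite_length K V (carrier V)"
  define P where "P N \<longleftrightarrow> (\<exists>B. finite B \<and> B \<subseteq> carrier V \<and> N = lin_span K V B)" for N
  have P: "submodule N K V \<and> N \<subseteq> carrier V" if "P N" for N
    using that V.submodule_lin_span submoduleD(1)[OF V.M.abelian_group_axioms] unfolding P_def by metis
  have "P (lin_span K V {})"
    unfolding P_def by blast
  then obtain N where N: "P N" "\<And>N'. P N' \<Longrightarrow> N \<subseteq> N' \<Longrightarrow> N' = N"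
    using ex_maximal_submodule[OF fl, of P] P by metis
  then obtain B where B: "finite B" "B \<subseteq> carrier V" "N = lin_span K V B"
    unfolding P_def by blast
  have "x \<in> lin_span K V B" if x: "x \<in> carrier V" for x
  proof -
    have xB: "insert x B \<subseteq> carrier V"
      using x B by blast
    have "P (lin_span K V (insert x B))"
      unfolding P_def using B(1) xB by blast
    then have "lin_span K V (insert x B) = lin_span K V B"
      using N(2) V.subset_lin_span_insert(1)[OF B(1) xB] B(3) by blast
    then show ?thesis
      using V.subset_lin_span_insert(2)[OF B(1) xB] by simp
  qed
  then show "fin_dim K V"
    using fin_dim_iff_lin_span[OF V] B by blast
qed

section \<open>Finite-dimensional modules over an algebra\<close>

lemma restrict_scalars_simps [simp]:
  "carrier (restrict_scalars A M) = carrier M" "zero (restrict_scalars A M) = zero M"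
  "add (restrict_scalars A M) = add M"
  "smult (restrict_scalars A M) c x = (c \<odot>\<^bsub>A\<^esub> \<one>\<^bsub>A\<^esub>) \<odot>\<^bsub>M\<^esub> x"
  "restrict_scalars A (M\<lparr>carrier := N\<rparr>) = (restrict_scalars A M)\<lparr>carrier := N\<rparr>"
  by (simp_all add: restrict_scalars_def)

lemma a_inv_cong:
  assumes "carrier V = carrier W" and "add V = add W" and "zero V = zero W"
  shows "a_inv V = a_inv W"
  using assms by (simp add: a_inv_def m_inv_def fun_eq_iff)

lemma abelian_group_cong:
  assumes "carrier V = carrier W" and "add V = add W" and "zero V = zero W"
  shows "abelian_group V \<longleftrightarrow> abelian_group W"
  using assms by (simp add: abelian_group_def abelian_monoid_def abelian_group_axioms_def comm_monoid_def
      comm_monoid_axioms_def monoid_def comm_group_def group_def group_axioms_def Units_def)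

lemma restrict_scalars_abelian_group:
  "abelian_group (restrict_scalars A M) \<longleftrightarrow> abelian_group M"
  by (rule abelian_group_cong) simp_all

context fin_dim_algebra
begin

text \<open>The defining property of \<open>amod\<close> freed from the type of lists: quotients and
  subquotients have sets as elements and are never literally objects of \<open>amod\<close>.\<close>

definition fdmod :: "('a, 'm) module \<Rightarrow> bool" where
  "fdmod M \<longleftrightarrow> left_module A M \<and> fin_dim K (restrict_scalars A M)"

lemma amod_iff: "M \<in> amod K A \<longleftrightarrow> fdmod M"
  by (simp add: amod_def fdmod_def)

lemma fdmod_left_module: "fdmod M \<Longrightarrow> left_module A M"
  by (simp add: fdmod_def)

lemma scalar_closed [simp]: "c \<in> carrier K \<Longrightarrow> c \<odot>\<^bsub>A\<^esub> \<one>\<^bsub>A\<^esub> \<in> carrier A"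
  by (intro smult_closed) auto

lemma scalar_central:
  assumes "c \<in> carrier K" and "a \<in> carrier A"
  shows "a \<otimes>\<^bsub>A\<^esub> (c \<odot>\<^bsub>A\<^esub> \<one>\<^bsub>A\<^esub>) = (c \<odot>\<^bsub>A\<^esub> \<one>\<^bsub>A\<^esub>) \<otimes>\<^bsub>A\<^esub> a"
  using assms by (simp add: smult_mult_left smult_mult_right)

lemma scalar_commute:
  assumes "left_module A M" and "c \<in> carrier K" and "a \<in> carrier A" and "x \<in> carrier M"
  shows "a \<odot>\<^bsub>M\<^esub> ((c \<odot>\<^bsub>A\<^esub> \<one>\<^bsub>A\<^esub>) \<odot>\<^bsub>M\<^esub> x) = (c \<odot>\<^bsub>A\<^esub> \<one>\<^bsub>A\<^esub>) \<odot>\<^bsub>M\<^esub> (a \<odot>\<^bsub>M\<^esub> x)"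
  using left_module.smult_assoc[OF assms(1), symmetric] scalar_central[OF assms(2,3)] assms by simp

lemma restrict_scalars_module:
  assumes "left_module A M"
  shows "Module.module K (restrict_scalars A M)"
proof (rule moduleI)
  interpret M: left_module A M by fact
  show "cring K" ..
  show "abelian_group (restrict_scalars A M)"
    unfolding restrict_scalars_abelian_group ..
  fix c d x assume c: "c \<in> carrier K" "d \<in> carrier K" and x: "x \<in> carrier (restrict_scalars A M)"
  then have x': "x \<in> carrier M"
    by simp
  show "c \<odot>\<^bsub>restrict_scalars A M\<^esub> x \<in> carrier (restrict_scalars A M)"
    using c x' M.smult_closed by simp
  show "(c \<oplus>\<^bsub>K\<^esub> d) \<odot>\<^bsub>restrict_scalars A M\<^esub> x
      = c \<odot>\<^bsub>restrict_scalars A M\<^esub> x \<oplus>\<^bsub>restrict_scalars A M\<^esub> d \<odot>\<^bsub>restrict_scalars A M\<^esub> x"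
    using c x' M.smult_l_distr by (simp add: smult_l_distr)
  have "(c \<otimes>\<^bsub>K\<^esub> d) \<odot>\<^bsub>A\<^esub> \<one>\<^bsub>A\<^esub> = (c \<odot>\<^bsub>A\<^esub> \<one>\<^bsub>A\<^esub>) \<otimes>\<^bsub>A\<^esub> (d \<odot>\<^bsub>A\<^esub> \<one>\<^bsub>A\<^esub>)"
    using c by (simp add: smult_mult_left smult_assoc1)
  then show "(c \<otimes>\<^bsub>K\<^esub> d) \<odot>\<^bsub>restrict_scalars A M\<^esub> x
      = c \<odot>\<^bsub>restrict_scalars A M\<^esub> (d \<odot>\<^bsub>restrict_scalars A M\<^esub> x)"
    using c x' by (simp add: M.smult_assoc)
next
  interpret M: left_module A M by fact
  fix c x y assume c: "c \<in> carrier K" "x \<in> carrier (restrict_scalars A M)" "y \<in> carrier (restrict_scalars A M)"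
  then show "c \<odot>\<^bsub>restrict_scalars A M\<^esub> (x \<oplus>\<^bsub>restrict_scalars A M\<^esub> y)
      = c \<odot>\<^bsub>restrict_scalars A M\<^esub> x \<oplus>\<^bsub>restrict_scalars A M\<^esub> c \<odot>\<^bsub>restrict_scalars A M\<^esub> y"
    by (simp add: M.smult_r_distr)
next
  interpret M: left_module A M by fact
  fix x assume "x \<in> carrier (restrict_scalars A M)"
  then show "\<one>\<^bsub>K\<^esub> \<odot>\<^bsub>restrict_scalars A M\<^esub> x = x"
    by (simp add: M.smult_one)
qed

lemma restrict_scalars_submodule:
  assumes "left_module A M" and "submodule N A M"
  shows "submodule N K (restrict_scalars A M)"
proof -
  have ab: "abelian_group M" "abelian_group (restrict_scalars A M)"
    using left_module_abelian_group[OF assms(1)] by (simp_all add: restrict_scalars_abelian_group)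
  have "a_inv (restrict_scalars A M) = a_inv M"
    by (rule a_inv_cong) simp_all
  then show ?thesis
    using submoduleD[OF ab(1) assms(2)] by (auto simp: submodule_iff[OF ab(2)])
qed

lemma restrict_scalars_lin_map:
  assumes "left_module A M" and "left_module A N" and "f \<in> lmod_hom A M N"
  shows "lin_map K (restrict_scalars A M) (restrict_scalars A N) f"
  using lmod_hom_lin_map[OF assms] by (simp add: lin_map_def restrict_scalars_abelian_group)

lemma restrict_scalars_zero_submodule:
  assumes "left_module A M"
  shows "submodule {\<zero>\<^bsub>M\<^esub>} K (restrict_scalars A M)"
  using restrict_scalars_submodule[OF assms zero_submodule[OF assms]] .

lemma fdmod_iff_finite_length:
  "fdmod M \<longleftrightarrow> left_module A M \<and> finite_length K (restrict_scalars A M) (carrier M)"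
  using fin_dim_iff_finite_length[OF K.field_axioms restrict_scalars_module, of M]
  by (auto simp: fdmod_def)

text \<open>Chains of \<open>A\<close>-submodules are in particular chains of subspaces, so the
  dimension bounds the \<open>A\<close>-length.\<close>

lemma sub_chain_restrict_scalars:
  assumes "left_module A M" and "sub_chain A M n S"
  shows "sub_chain K (restrict_scalars A M) n S"
  using assms(2) by (induction rule: sub_chain.induct)
    (auto intro: sub_chain.intros restrict_scalars_submodule[OF assms(1)])

lemma fdmod_finite_length:
  assumes "fdmod M"
  shows "finite_length A M (carrier M)"
proof -
  have M: "left_module A M" and "finite_length K (restrict_scalars A M) (carrier M)"
    using assms by (auto simp: fdmod_iff_finite_length)
  then obtain b where "\<And>n. sub_chain K (restrict_scalars A M) n (carrier M) \<Longrightarrow> n \<le> b"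
    by (auto simp: finite_length_def)
  then have "\<forall>n. sub_chain A M n (carrier M) \<longrightarrow> n \<le> b"
    using sub_chain_restrict_scalars[OF M] by blast
  then show ?thesis
    using carrier_submodule[OF M] by (auto simp: finite_length_def)
qed

lemma fdmod_inj:
  assumes N: "fdmod N" and M: "left_module A M" and f: "f \<in> lmod_hom A M N" "inj_on f (carrier M)"
  shows "fdmod M"
proof -
  have N': "left_module A N" "finite_length K (restrict_scalars A N) (carrier N)"
    using N by (auto simp: fdmod_iff_finite_length)
  have "submodule (f ` carrier M) K (restrict_scalars A N)"
    by (intro restrict_scalars_submodule[OF N'(1)] submodule_hom_image[OF M N'(1) f(1)] carrier_submodule M)
  then have "finite_length K (restrict_scalars A N) (f ` carrier M)"
    using lmod_homD(1)[OF f(1)] by (intro finite_length_mono[OF N'(2)]) auto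
  moreover have "submodule {\<zero>\<^bsub>restrict_scalars A N\<^esub>} K (restrict_scalars A N)"
    "submodule {\<zero>\<^bsub>restrict_scalars A M\<^esub>} K (restrict_scalars A M)"
    using M N' restrict_scalars_zero_submodule by auto
  ultimately show ?thesis
    using len_inj(1)[OF restrict_scalars_lin_map[OF M N'(1) f(1)] _ _ f(2)
        restrict_scalars_submodule[OF M carrier_submodule[OF M]]] M
    by (simp add: fdmod_iff_finite_length)
qed

lemma fdmod_surj:
  assumes M: "fdmod M" and N: "left_module A N" and f: "f \<in> lmod_hom A M N" "f ` carrier M = carrier N"
  shows "fdmod N"
proof -
  have M': "left_module A M" "finite_length K (restrict_scalars A M) (carrier M)"
    using M by (auto simp: fdmod_iff_finite_length)
  have "submodule {\<zero>\<^bsub>restrict_scalars A N\<^esub>} K (restrict_scalars A N)"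
    using N restrict_scalars_zero_submodule by auto
  then show ?thesis
    using len_exact(1)[OF restrict_scalars_lin_map[OF M'(1) N f(1)] _ M'(2)] f(2) N
    by (simp add: fdmod_iff_finite_length)
qed

lemma fdmod_sub:
  assumes "fdmod M" and "submodule N A M"
  shows "fdmod (M\<lparr>carrier := N\<rparr>)"
  using assms(2)
  by (intro fdmod_inj[OF assms(1) left_module_sub[OF fdmod_left_module[OF assms(1)]]
        inclusion_lmod_hom[OF fdmod_left_module[OF assms(1)]]]) (auto simp: inj_on_def)

lemma fdmod_quot:
  assumes "fdmod M" and "submodule N A M"
  shows "fdmod (quot_module M N)"
  using fdmod_surj[OF assms(1)] quot_module[OF fdmod_left_module[OF assms(1)] assms(2)] by blast

section \<open>Copies of modules on the type of lists\<close>

lemma transport_module: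
  fixes M :: "('a, 'm) module" and f :: "'m \<Rightarrow> 'n"
  assumes M: "left_module A M" and inj: "inj_on f (carrier M)"
  obtains N :: "('a, 'n) module" where "left_module A N" and "restrict f (carrier M) \<in> lmod_hom A M N"
    and "f ` carrier M = carrier N"
proof -
  interpret M: left_module A M by fact
  define g where "g = inv_into (carrier M) f"
  have g: "g (f x) = x" if "x \<in> carrier M" for x
    using that inj by (simp add: g_def)
  define N :: "('a, 'n) module" where "N = \<lparr>carrier = f ` carrier M, mult = undefined, one = undefined, zero = f \<zero>\<^bsub>M\<^esub>,
    add = (\<lambda>u v. f (g u \<oplus>\<^bsub>M\<^esub> g v)), smult = (\<lambda>a u. f (a \<odot>\<^bsub>M\<^esub> g u))\<rparr>"
  have add: "f (x \<oplus>\<^bsub>M\<^esub> y) = f x \<oplus>\<^bsub>N\<^esub> f y" if "x \<in> carrier M" "y \<in> carrier M" for x y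
    using that by (simp add: N_def g)
  have smult: "f (a \<odot>\<^bsub>M\<^esub> x) = a \<odot>\<^bsub>N\<^esub> f x" if "a \<in> carrier A" "x \<in> carrier M" for a x
    using that by (simp add: N_def g)
  have "left_module A N"
    by (rule left_module_image[OF M _ _ add smult]) (simp_all add: N_def)
  moreover have "restrict f (carrier M) \<in> lmod_hom A M N"
    by (rule lmod_hom_restrictI[OF M _ add smult]) (simp_all add: N_def)
  ultimately show ?thesis
    by (rule that) (simp add: N_def)
qed

text \<open>A finite-dimensional module on an arbitrary type is encoded into lists by choosing coordinates
  with respect to a finite spanning set.\<close>

lemma ex_amod_iso:
  fixes M :: "('a, 'm) module"
  assumes "fdmod M"
  obtains N :: "('a, 'k list) module" and f where "N \<in> amod K A" "f \<in> lmod_hom A M N"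
    "bij_betw f (carrier M) (carrier N)"
proof -
  let ?V = "restrict_scalars A M"
  have M: "left_module A M"
    using assms by (rule fdmod_left_module)
  interpret V: Module.module K ?V
    by (rule restrict_scalars_module[OF M])
  obtain B where B: "finite B" "B \<subseteq> carrier M"
    "\<And>x. x \<in> carrier M \<Longrightarrow> \<exists>c\<in>B \<rightarrow> carrier K. x = finsum ?V (\<lambda>b. c b \<odot>\<^bsub>?V\<^esub> b) B"
    using assms unfolding fdmod_def fin_dim_def restrict_scalars_simps(1) by blast
  obtain bs where bs: "set bs = B"
    using finite_list[OF B(1)] by blast
  obtain c where c: "\<And>x. x \<in> carrier M \<Longrightarrow> c x \<in> B \<rightarrow> carrier K"
      "\<And>x. x \<in> carrier M \<Longrightarrow> x = finsum ?V (\<lambda>b. c x b \<odot>\<^bsub>?V\<^esub> b) B"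
    using B(3) by metis
  \<comment> \<open>The coordinates \<open>c x\<close> are an arbitrary choice and \<open>B\<close>
    may be linearly dependent, so \<open>f\<close> need not be linear. Injectivity is enough,
    because the module structure on the image is transported along \<open>f\<close>.\<close>
  define f where "f x = map (c x) bs" for x
  have "inj_on f (carrier M)"
  proof (rule inj_onI)
    fix x y assume xy: "x \<in> carrier M" "y \<in> carrier M" "f x = f y"
    then have eq: "c x b = c y b" if "b \<in> B" for b
      using that bs by (auto simp: f_def)
    have "finsum ?V (\<lambda>b. c x b \<odot>\<^bsub>?V\<^esub> b) B = finsum ?V (\<lambda>b. c y b \<odot>\<^bsub>?V\<^esub> b) B"
    proof (rule V.M.finsum_cong')
      show "(\<lambda>b. c y b \<odot>\<^bsub>?V\<^esub> b) \<in> B \<rightarrow> carrier ?V"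
      proof
        fix b assume "b \<in> B"
        then show "c y b \<odot>\<^bsub>?V\<^esub> b \<in> carrier ?V"
          using V.smult_closed[of "c y b" b] c(1)[OF xy(2)] B(2) by auto
      qed
    qed (simp_all add: eq del: restrict_scalars_simps)
    then show "x = y"
      using c(2)[OF xy(1)] c(2)[OF xy(2)] by (simp del: restrict_scalars_simps)
  qed
  then obtain N where N: "left_module A N" "restrict f (carrier M) \<in> lmod_hom A M N"
    "f ` carrier M = carrier N"
    using transport_module[OF M] by metis
  have bij: "bij_betw (restrict f (carrier M)) (carrier M) (carrier N)"
    using \<open>inj_on f (carrier M)\<close> N(3) by (auto simp: bij_betw_def inj_on_def)
  have "fdmod N"
    by (rule fdmod_surj[OF assms N(1,2)]) (use N(3) in auto)
  then show ?thesis
    using that[of N] N(2) bij by (simp add: amod_iff)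
qed

section \<open>Spaces of homomorphisms\<close>

text \<open>Pointwise multiplication by elements of \<open>A\<close> would not preserve
  \<open>A\<close>-linearity, but the elements \<open>c \<odot> \<one>\<close> are central. So hom
  sets are spaces over \<open>K\<close> only.\<close>

definition hom_space :: "('a, 'm) module \<Rightarrow> ('a, 'n) module \<Rightarrow> ('k, 'm \<Rightarrow> 'n) module" where
  "hom_space M N =
     \<lparr>carrier = lmod_hom A M N, mult = undefined, one = undefined, zero = (\<lambda>x\<in>carrier M. \<zero>\<^bsub>N\<^esub>),
      add = (\<lambda>f g. \<lambda>x\<in>carrier M. f x \<oplus>\<^bsub>N\<^esub> g x),
      smult = (\<lambda>c f. \<lambda>x\<in>carrier M. (c \<odot>\<^bsub>A\<^esub> \<one>\<^bsub>A\<^esub>) \<odot>\<^bsub>N\<^esub> f x)\<rparr>"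

lemma hom_space_simps [simp]:
  "carrier (hom_space M N) = lmod_hom A M N" "zero (hom_space M N) = (\<lambda>x\<in>carrier M. \<zero>\<^bsub>N\<^esub>)"
  "add (hom_space M N) f g = (\<lambda>x\<in>carrier M. f x \<oplus>\<^bsub>N\<^esub> g x)"
  "smult (hom_space M N) c f = (\<lambda>x\<in>carrier M. (c \<odot>\<^bsub>A\<^esub> \<one>\<^bsub>A\<^esub>) \<odot>\<^bsub>N\<^esub> f x)"
  by (simp_all add: hom_space_def)

lemma hom_space_abelian_group:
  assumes M: "left_module A M" and N: "left_module A N"
  shows "abelian_group (hom_space M N)"
proof (rule abelian_groupI)
  interpret M: left_module A M by fact
  interpret N: left_module A N by fact
  fix f g assume "f \<in> carrier (hom_space M N)" "g \<in> carrier (hom_space M N)"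
  then have f: "f \<in> lmod_hom A M N" and g: "g \<in> lmod_hom A M N"
    by simp_all
  have "(\<lambda>x\<in>carrier M. f x \<oplus>\<^bsub>N\<^esub> g x) \<in> lmod_hom A M N"
  proof (rule lmod_hom_restrictI[OF M])
    fix x y assume "x \<in> carrier M" "y \<in> carrier M"
    then show "f (x \<oplus>\<^bsub>M\<^esub> y) \<oplus>\<^bsub>N\<^esub> g (x \<oplus>\<^bsub>M\<^esub> y) = f x \<oplus>\<^bsub>N\<^esub> g x \<oplus>\<^bsub>N\<^esub> (f y \<oplus>\<^bsub>N\<^esub> g y)"
      using lmod_homD(1,3)[OF f] lmod_homD(1,3)[OF g] by (simp add: N.M.add.m_ac)
  qed (simp_all add: lmod_homD[OF f] lmod_homD[OF g] N.smult_r_distr)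
  then show "f \<oplus>\<^bsub>hom_space M N\<^esub> g \<in> carrier (hom_space M N)"
    by simp
  show "f \<oplus>\<^bsub>hom_space M N\<^esub> g = g \<oplus>\<^bsub>hom_space M N\<^esub> f"
    using lmod_homD(1)[OF f] lmod_homD(1)[OF g] by (auto simp: fun_eq_iff restrict_def N.M.a_comm)
next
  show "\<zero>\<^bsub>hom_space M N\<^esub> \<in> carrier (hom_space M N)"
    using zero_lmod_hom[OF M N] by simp
next
  interpret M: left_module A M by fact
  interpret N: left_module A N by fact
  fix f g h assume "f \<in> carrier (hom_space M N)" "g \<in> carrier (hom_space M N)" "h \<in> carrier (hom_space M N)"
  then show "f \<oplus>\<^bsub>hom_space M N\<^esub> g \<oplus>\<^bsub>hom_space M N\<^esub> h = f \<oplus>\<^bsub>hom_space M N\<^esub> (g \<oplus>\<^bsub>hom_space M N\<^esub> h)"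
    by (auto simp: fun_eq_iff restrict_def N.M.a_assoc lmod_homD(1))
next
  interpret M: left_module A M by fact
  interpret N: left_module A N by fact
  fix f assume "f \<in> carrier (hom_space M N)"
  then have f: "f \<in> lmod_hom A M N"
    by simp
  show "\<zero>\<^bsub>hom_space M N\<^esub> \<oplus>\<^bsub>hom_space M N\<^esub> f = f"
    by (rule extensionalityI[of _ "carrier M"]) (simp_all add: lmod_homD[OF f])
  have neg: "a \<odot>\<^bsub>N\<^esub> (\<ominus>\<^bsub>N\<^esub> y) = \<ominus>\<^bsub>N\<^esub> (a \<odot>\<^bsub>N\<^esub> y)" if "a \<in> carrier A" "y \<in> carrier N" for a y
  proof -
    have "a \<odot>\<^bsub>N\<^esub> (\<ominus>\<^bsub>N\<^esub> y) \<oplus>\<^bsub>N\<^esub> a \<odot>\<^bsub>N\<^esub> y = \<zero>\<^bsub>N\<^esub>"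
      using that N.smult_r_distr[of a "\<ominus>\<^bsub>N\<^esub> y" y] left_module_smult_zero[OF N] by (simp add: N.M.l_neg)
    then show ?thesis
      using that by (metis N.M.a_inv_closed N.M.minus_equality N.smult_closed)
  qed
  have "(\<lambda>x\<in>carrier M. \<ominus>\<^bsub>N\<^esub> f x) \<in> lmod_hom A M N"
    by (rule lmod_hom_restrictI[OF M]) (simp_all add: lmod_homD[OF f] neg N.M.minus_add)
  moreover have "(\<lambda>x\<in>carrier M. \<ominus>\<^bsub>N\<^esub> f x) \<oplus>\<^bsub>hom_space M N\<^esub> f = \<zero>\<^bsub>hom_space M N\<^esub>"
    by (auto simp: fun_eq_iff restrict_def lmod_homD[OF f] N.M.l_neg)
  ultimately show "\<exists>g\<in>carrier (hom_space M N). g \<oplus>\<^bsub>hom_space M N\<^esub> f = \<zero>\<^bsub>hom_space M N\<^esub>"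
    by (simp only: hom_space_simps(1)) blast
qed

lemma hom_space_smult_closed:
  assumes M: "left_module A M" and N: "left_module A N" and c: "c \<in> carrier K"
    and f: "f \<in> lmod_hom A M N"
  shows "c \<odot>\<^bsub>hom_space M N\<^esub> f \<in> lmod_hom A M N"
  unfolding hom_space_simps
proof (rule lmod_hom_restrictI[OF M])
  interpret N: left_module A N by fact
  show "(c \<odot>\<^bsub>A\<^esub> \<one>\<^bsub>A\<^esub>) \<odot>\<^bsub>N\<^esub> f x \<in> carrier N" if "x \<in> carrier M" for x
    using that lmod_homD(1)[OF f] c by (intro N.smult_closed) auto
  show "(c \<odot>\<^bsub>A\<^esub> \<one>\<^bsub>A\<^esub>) \<odot>\<^bsub>N\<^esub> f (x \<oplus>\<^bsub>M\<^esub> y) = (c \<odot>\<^bsub>A\<^esub> \<one>\<^bsub>A\<^esub>) \<odot>\<^bsub>N\<^esub> f x \<oplus>\<^bsub>N\<^esub> (c \<odot>\<^bsub>A\<^esub> \<one>\<^bsub>A\<^esub>) \<odot>\<^bsub>N\<^esub> f y"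
    if "x \<in> carrier M" "y \<in> carrier M" for x y
    using that lmod_homD(1,3)[OF f] c by (simp add: N.smult_r_distr)
  show "(c \<odot>\<^bsub>A\<^esub> \<one>\<^bsub>A\<^esub>) \<odot>\<^bsub>N\<^esub> f (a \<odot>\<^bsub>M\<^esub> x) = a \<odot>\<^bsub>N\<^esub> ((c \<odot>\<^bsub>A\<^esub> \<one>\<^bsub>A\<^esub>) \<odot>\<^bsub>N\<^esub> f x)"
    if "a \<in> carrier A" "x \<in> carrier M" for a x
    using that lmod_homD(1,4)[OF f] scalar_commute[OF N c] by simp
qed

lemma hom_space_carrier_submodule:
  assumes "left_module A M" and "left_module A N"
  shows "submodule (lmod_hom A M N) K (hom_space M N)"
  using submodule_carrier[OF hom_space_abelian_group[OF assms], of K] hom_space_smult_closed[OF assms] by simp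

lemma hom_space_zero_submodule:
  assumes "left_module A M" and "left_module A N"
  shows "submodule {\<lambda>x\<in>carrier M. \<zero>\<^bsub>N\<^esub>} K (hom_space M N)"
proof -
  have "c \<odot>\<^bsub>hom_space M N\<^esub> \<zero>\<^bsub>hom_space M N\<^esub> = \<zero>\<^bsub>hom_space M N\<^esub>" if "c \<in> carrier K" for c
    using that left_module_smult_zero[OF assms(2)] by (auto simp: fun_eq_iff restrict_def)
  then show ?thesis
    using submodule_zero[OF hom_space_abelian_group[OF assms], of K] by simp
qed

lemma eval_lin_map:
  assumes "left_module A M" and "left_module A N" and "b \<in> carrier M"
  shows "lin_map K (hom_space M N) (restrict_scalars A N) (\<lambda>f. f b)"
  using assms hom_space_abelian_group[OF assms(1,2)] left_module_abelian_group[OF assms(2)]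
  by (auto simp: lin_map_def restrict_scalars_abelian_group lmod_homD)

text \<open>A homomorphism is determined by its values on a finite spanning set \<open>B\<close>.
  The maps vanishing on \<open>insert b B\<close> form the kernel of evaluation at \<open>b\<close>
  on those vanishing on \<open>B\<close>, and the image of this evaluation lies in \<open>N\<close>.
  Dropping the conditions one at a time leads from the zero space to the whole hom space.\<close>

lemma hom_space_finite_length:
  assumes M: "fdmod M" and N: "fdmod N"
  shows "finite_length K (hom_space M N) (lmod_hom A M N)"
proof -
  let ?H = "hom_space M N"
  have M': "left_module A M" and N': "left_module A N"
    using M N by (auto intro: fdmod_left_module)
  define V where "V B = {f \<in> lmod_hom A M N. \<forall>b\<in>B. f b = \<zero>\<^bsub>N\<^esub>}" for B
  have V_insert: "V (insert b B) = {f \<in> V B. f b = \<zero>\<^bsub>N\<^esub>}" for b B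
    by (auto simp: V_def)
  have Z: "submodule {\<zero>\<^bsub>restrict_scalars A N\<^esub>} K (restrict_scalars A N)"
    using restrict_scalars_zero_submodule[OF N'] by simp
  have sub: "submodule (V B) K ?H" if "finite B" "B \<subseteq> carrier M" for B
    using that
  proof (induction rule: finite_induct)
    case empty
    then show ?case
      using hom_space_carrier_submodule[OF M' N'] by (simp add: V_def)
  next
    case (insert b B)
    then show ?case
      using submodule_vimage[OF eval_lin_map[OF M' N', of b] _ Z, of "V B"] by (auto simp: V_insert)
  qed
  have step: "finite_length K ?H (V {})" if "finite B" "B \<subseteq> carrier M" "finite_length K ?H (V B)" for B
    using that
  proof (induction rule: finite_induct)
    case (insert b B)
    have b: "b \<in> carrier M" and S: "submodule (V B) K ?H"
      using insert sub by auto
    have "submodule ((\<lambda>f. f b) ` V B) K (restrict_scalars A N)"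
      by (rule submodule_image[OF eval_lin_map[OF M' N' b] S])
    moreover have "(\<lambda>f. f b) ` V B \<subseteq> carrier N"
      using lmod_homD(1) b by (fastforce simp: V_def)
    moreover have "finite_length K (restrict_scalars A N) (carrier N)"
      using N by (simp add: fdmod_iff_finite_length)
    ultimately have "finite_length K (restrict_scalars A N) ((\<lambda>f. f b) ` V B)"
      using finite_length_mono by blast
    then have "finite_length K ?H (V B)"
      using insert(5) by (intro finite_length_exact[OF eval_lin_map[OF M' N' b] Z S]) (auto simp: V_insert)
    then show ?case
      using insert by auto
  qed
  interpret VM: Module.module K "restrict_scalars A M"
    by (rule restrict_scalars_module[OF M'])
  obtain B where B: "finite B" "B \<subseteq> carrier M" "carrier M \<subseteq> lin_span K (restrict_scalars A M) B"
    using M fin_dim_iff_lin_span[OF restrict_scalars_module[OF M']] by (auto simp: fdmod_def)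
  have "V B = {\<lambda>x\<in>carrier M. \<zero>\<^bsub>N\<^esub>}"
  proof
    show "{\<lambda>x\<in>carrier M. \<zero>\<^bsub>N\<^esub>} \<subseteq> V B"
      using zero_lmod_hom[OF M' N'] B(2) by (auto simp: V_def)
    show "V B \<subseteq> {\<lambda>x\<in>carrier M. \<zero>\<^bsub>N\<^esub>}"
    proof
      fix f assume "f \<in> V B"
      then have f: "f \<in> lmod_hom A M N" "\<forall>b\<in>B. f b = \<zero>\<^bsub>N\<^esub>"
        by (auto simp: V_def)
      have "submodule (lmod_ker M N f) K (restrict_scalars A M)"
        by (rule restrict_scalars_submodule[OF M' submodule_ker[OF M' N' f(1)]])
      then have "lin_span K (restrict_scalars A M) B \<subseteq> lmod_ker M N f"
        using f(2) B(2) by (intro VM.lin_span_subset[OF B(1)]) (auto simp: lmod_ker_def)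
      then have "\<And>x. x \<in> carrier M \<Longrightarrow> f x = \<zero>\<^bsub>N\<^esub>"
        using B(3) by (auto simp: lmod_ker_def)
      then have "f = (\<lambda>x\<in>carrier M. \<zero>\<^bsub>N\<^esub>)"
        by (intro lmod_hom_eqI[OF f(1) zero_lmod_hom[OF M' N']]) auto
      then show "f \<in> {\<lambda>x\<in>carrier M. \<zero>\<^bsub>N\<^esub>}"
        by simp
    qed
  qed
  then have "finite_length K ?H (V B)"
    using len_zero(1)[OF hom_space_abelian_group[OF M' N'], of K] hom_space_zero_submodule[OF M' N'] by simp
  then show ?thesis
    using step[OF B(1,2)] by (simp add: V_def)
qed

section \<open>Dimensions over \<open>K\<close> of hom spaces and their additivity\<close>

definition hlen :: "('a, 'm) module \<Rightarrow> ('a, 'n) module \<Rightarrow> nat" where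
  "hlen M N = len K (hom_space M N) (lmod_hom A M N)"

lemma hlen_eq_0_iff:
  assumes "fdmod M" and "fdmod N"
  shows "hlen M N = 0 \<longleftrightarrow> lmod_hom A M N = {\<lambda>x\<in>carrier M. \<zero>\<^bsub>N\<^esub>}"
proof -
  have MN: "left_module A M" "left_module A N"
    using assms by (auto intro: fdmod_left_module)
  show ?thesis
    using len_eq_0_iff[OF hom_space_abelian_group[OF MN] _ hom_space_finite_length[OF assms]]
      hom_space_zero_submodule[OF MN] by (simp add: hlen_def)
qed

lemma hlen_pos_iff:
  assumes "fdmod M" and "fdmod N"
  shows "hlen M N > 0 \<longleftrightarrow> (\<exists>f\<in>lmod_hom A M N. \<exists>x\<in>carrier M. f x \<noteq> \<zero>\<^bsub>N\<^esub>)"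
proof -
  have MN: "left_module A M" "left_module A N"
    using assms by (auto intro: fdmod_left_module)
  have "lmod_hom A M N = {\<lambda>x\<in>carrier M. \<zero>\<^bsub>N\<^esub>}
      \<longleftrightarrow> (\<forall>f\<in>lmod_hom A M N. \<forall>x\<in>carrier M. f x = \<zero>\<^bsub>N\<^esub>)"
  proof safe
    fix f assume "\<forall>f\<in>lmod_hom A M N. \<forall>x\<in>carrier M. f x = \<zero>\<^bsub>N\<^esub>" "f \<in> lmod_hom A M N"
    then show "f = (\<lambda>x\<in>carrier M. \<zero>\<^bsub>N\<^esub>)"
      by (intro lmod_hom_eqI[OF _ zero_lmod_hom[OF MN]]) auto
  qed (use zero_lmod_hom[OF MN] in auto)
  then show ?thesis
    using hlen_eq_0_iff[OF assms] by auto
qed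

lemma compose_left_lin_map:
  assumes "left_module A P" and M: "left_module A M" and N: "left_module A N" and g: "g \<in> lmod_hom A M N"
  shows "lin_map K (hom_space P M) (hom_space P N) (compose (carrier P) g)"
proof -
  have "compose (carrier P) g f \<in> lmod_hom A P N" if "f \<in> lmod_hom A P M" for f
    by (rule lmod_hom_compose[OF assms(1) that g])
  then show ?thesis
    using hom_space_abelian_group[OF assms(1,2)] hom_space_abelian_group[OF assms(1,3)]
    by (auto simp: lin_map_def compose_def fun_eq_iff restrict_def lmod_homD lmod_homD[OF g])
qed

lemma compose_right_lin_map:
  assumes N: "left_module A N" and M: "left_module A M" and I: "left_module A I"
    and g: "g \<in> lmod_hom A N M"
  shows "lin_map K (hom_space M I) (hom_space N I) (\<lambda>f. compose (carrier N) f g)"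
proof -
  have "compose (carrier N) f g \<in> lmod_hom A N I" if "f \<in> lmod_hom A M I" for f
    by (rule lmod_hom_compose[OF N g that])
  then show ?thesis
    using hom_space_abelian_group[OF N I] hom_space_abelian_group[OF M I]
    by (auto simp: lin_map_def compose_def fun_eq_iff restrict_def lmod_homD(1)[OF g])
qed

text \<open>Composition with \<open>p\<close> has the maps through \<open>i\<close> as its kernel,
  and \<open>lift\<close> makes it surjective. The lifting property is a hypothesis for the given
  sequence, so the lemma serves projective \<open>P\<close> as well as an arbitrary \<open>P\<close>
  when \<open>p\<close> is an isomorphism.\<close>

lemma hlen_exact_left:
  assumes P: "fdmod P" and N: "fdmod N" and M: "fdmod M" and Q: "fdmod Q"
    and i: "i \<in> lmod_hom A N M" "inj_on i (carrier N)" and p: "p \<in> lmod_hom A M Q"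
    and ex: "i ` carrier N = lmod_ker M Q p"
    and lift: "\<And>f. f \<in> lmod_hom A P Q \<Longrightarrow> \<exists>h\<in>lmod_hom A P M. compose (carrier P) p h = f"
  shows "hlen P M = hlen P N + hlen P Q"
proof -
  note P' = fdmod_left_module[OF P] and N' = fdmod_left_module[OF N]
    and M' = fdmod_left_module[OF M] and Q' = fdmod_left_module[OF Q]
  note lin_p = compose_left_lin_map[OF P' M' Q' p] and lin_i = compose_left_lin_map[OF P' N' M' i(1)]
  have im: "compose (carrier P) p ` lmod_hom A P M = lmod_hom A P Q"
    using lift lin_mapD(3)[OF lin_p] by (auto simp: image_iff)
  have inj: "inj_on (compose (carrier P) i) (lmod_hom A P N)"
  proof (rule inj_onI)
    fix f g assume fg: "f \<in> lmod_hom A P N" "g \<in> lmod_hom A P N"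
      "compose (carrier P) i f = compose (carrier P) i g"
    have "f x = g x" if "x \<in> carrier P" for x
      using that fg(3) inj_onD[OF i(2), of "f x" "g x"] lmod_homD(1)[OF fg(1)] lmod_homD(1)[OF fg(2)]
      by (metis compose_eq)
    then show "f = g"
      by (rule lmod_hom_eqI[OF fg(1,2)])
  qed
  have ker: "{f \<in> lmod_hom A P M. compose (carrier P) p f = \<zero>\<^bsub>hom_space P Q\<^esub>}
      = compose (carrier P) i ` lmod_hom A P N" (is "?L = ?R")
  proof
    show "?R \<subseteq> ?L"
    proof
      fix h assume "h \<in> ?R"
      then obtain f where f: "f \<in> lmod_hom A P N" "h = compose (carrier P) i f"
        by blast
      have "p (i y) = \<zero>\<^bsub>Q\<^esub>" if "y \<in> carrier N" for y
        using ex that by (auto simp: lmod_ker_def)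
      then have "compose (carrier P) p h = \<zero>\<^bsub>hom_space P Q\<^esub>"
        using f lmod_homD(1)[OF f(1)] by (auto simp: compose_def fun_eq_iff restrict_def)
      then show "h \<in> ?L"
        using f lmod_hom_compose[OF P' f(1) i(1)] by simp
    qed
    show "?L \<subseteq> ?R"
    proof
      fix h assume "h \<in> ?L"
      then have h: "h \<in> lmod_hom A P M" and z: "compose (carrier P) p h = \<zero>\<^bsub>hom_space P Q\<^esub>"
        by auto
      have "p (h x) = \<zero>\<^bsub>Q\<^esub>" if "x \<in> carrier P" for x
        using z that compose_eq[OF that, of p h] by simp
      then have hx: "h x \<in> i ` carrier N" if "x \<in> carrier P" for x
        using ex that lmod_homD(1)[OF h] by (auto simp: lmod_ker_def)
      define j where "j = inv_into (carrier N) i"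
      have j: "j (i y) = y" if "y \<in> carrier N" for y
        using that i(2) by (simp add: j_def)
      have jx: "j (h x) \<in> carrier N" "i (j (h x)) = h x" if "x \<in> carrier P" for x
        using hx[OF that] j by auto
      interpret N: left_module A N by (rule N')
      have "(\<lambda>x\<in>carrier P. j (h x)) \<in> lmod_hom A P N"
      proof (rule lmod_hom_restrictI[OF P'])
        fix x y assume xy: "x \<in> carrier P" "y \<in> carrier P"
        have "h (x \<oplus>\<^bsub>P\<^esub> y) = i (j (h x) \<oplus>\<^bsub>N\<^esub> j (h y))"
          using xy jx by (simp add: lmod_homD(3)[OF i(1)] lmod_homD(3)[OF h])
        then show "j (h (x \<oplus>\<^bsub>P\<^esub> y)) = j (h x) \<oplus>\<^bsub>N\<^esub> j (h y)"
          using xy jx j by simp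
      next
        fix a x assume ax: "a \<in> carrier A" "x \<in> carrier P"
        have "h (a \<odot>\<^bsub>P\<^esub> x) = i (a \<odot>\<^bsub>N\<^esub> j (h x))"
          using ax jx by (simp add: lmod_homD(4)[OF i(1)] lmod_homD(4)[OF h])
        then show "j (h (a \<odot>\<^bsub>P\<^esub> x)) = a \<odot>\<^bsub>N\<^esub> j (h x)"
          using ax jx j N.smult_closed by simp
      qed (use jx in auto)
      moreover have "compose (carrier P) i (\<lambda>x\<in>carrier P. j (h x)) = h"
        by (rule extensionalityI[OF compose_extensional lmod_homD(2)[OF h]])
          (use jx in \<open>auto simp: compose_def\<close>)
      ultimately show "h \<in> ?R"
        by force
    qed
  qed
  have ZQ: "submodule {\<zero>\<^bsub>hom_space P Q\<^esub>} K (hom_space P Q)"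
    and ZM: "submodule {\<zero>\<^bsub>hom_space P M\<^esub>} K (hom_space P M)"
    and ZN: "submodule {\<zero>\<^bsub>hom_space P N\<^esub>} K (hom_space P N)"
    using hom_space_zero_submodule P' N' M' Q' by auto
  have "len K (hom_space P N) (lmod_hom A P N)
      = len K (hom_space P M) (compose (carrier P) i ` lmod_hom A P N)"
    by (rule len_inj(2)[OF lin_i ZM ZN inj hom_space_carrier_submodule[OF P' N'] hom_space_finite_length[OF P N]])
  then show ?thesis
    using len_exact(2)[OF lin_p ZQ hom_space_finite_length[OF P M]] by (simp add: hlen_def im ker del: hom_space_simps)
qed

text \<open>The contravariant counterpart: maps that vanish on the image of \<open>i\<close> factor
  through \<open>p\<close>, and \<open>ext\<close> makes restriction along \<open>i\<close>
  surjective. It is applied to an injective \<open>I\<close> and, for isomorphisms \<open>p\<close>,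
  to any \<open>I\<close>.\<close>

lemma hlen_exact_right:
  assumes I: "fdmod I" and N: "fdmod N" and M: "fdmod M" and Q: "fdmod Q"
    and i: "i \<in> lmod_hom A N M" and p: "p \<in> lmod_hom A M Q" "p ` carrier M = carrier Q"
    and ex: "i ` carrier N = lmod_ker M Q p"
    and ext: "\<And>f. f \<in> lmod_hom A N I \<Longrightarrow> \<exists>h\<in>lmod_hom A M I. compose (carrier N) h i = f"
  shows "hlen M I = hlen N I + hlen Q I"
proof -
  note I' = fdmod_left_module[OF I] and N' = fdmod_left_module[OF N]
    and M' = fdmod_left_module[OF M] and Q' = fdmod_left_module[OF Q]
  note lin_p = compose_right_lin_map[OF M' Q' I' p(1)] and lin_i = compose_right_lin_map[OF N' M' I' i]
  have im: "(\<lambda>f. compose (carrier N) f i) ` lmod_hom A M I = lmod_hom A N I"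
    using ext lin_mapD(3)[OF lin_i] by (auto simp: image_iff)
  have inj: "inj_on (\<lambda>f. compose (carrier M) f p) (lmod_hom A Q I)"
  proof (rule inj_onI)
    fix f g assume fg: "f \<in> lmod_hom A Q I" "g \<in> lmod_hom A Q I"
      "compose (carrier M) f p = compose (carrier M) g p"
    have "f (p x) = g (p x)" if "x \<in> carrier M" for x
      using that fg(3) by (metis compose_eq)
    then have "f x = g x" if "x \<in> carrier Q" for x
      using that p(2) by (metis imageE)
    then show "f = g"
      by (rule lmod_hom_eqI[OF fg(1,2)])
  qed
  have ker: "{f \<in> lmod_hom A M I. compose (carrier N) f i = \<zero>\<^bsub>hom_space N I\<^esub>}
      = (\<lambda>f. compose (carrier M) f p) ` lmod_hom A Q I" (is "?L = ?R")
  proof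
    show "?R \<subseteq> ?L"
    proof
      fix h assume "h \<in> ?R"
      then obtain f where f: "f \<in> lmod_hom A Q I" "h = compose (carrier M) f p"
        by blast
      have "i y \<in> carrier M" "p (i y) = \<zero>\<^bsub>Q\<^esub>" if "y \<in> carrier N" for y
        using ex that by (auto simp: lmod_ker_def)
      then have "compose (carrier N) h i = \<zero>\<^bsub>hom_space N I\<^esub>"
        using f lmod_hom_zero[OF Q' I' f(1)] by (auto simp: compose_def fun_eq_iff restrict_def)
      then show "h \<in> ?L"
        using f lmod_hom_compose[OF M' p(1) f(1)] by simp
    qed
    show "?L \<subseteq> ?R"
    proof
      fix h assume "h \<in> ?L"
      then have h: "h \<in> lmod_hom A M I" and z: "compose (carrier N) h i = \<zero>\<^bsub>hom_space N I\<^esub>"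
        by auto
      have "h (i y) = \<zero>\<^bsub>I\<^esub>" if "y \<in> carrier N" for y
        using z compose_eq[OF that, of h i] that by simp
      then have "lmod_ker M Q p \<subseteq> lmod_ker M I h"
        using ex[symmetric] lmod_homD(1)[OF i] by (auto simp: lmod_ker_def[of M I])
      then obtain g where "g \<in> lmod_hom A Q I" "compose (carrier M) g p = h"
        using lmod_hom_factor[OF M' Q' I' p h] by blast
      then show "h \<in> ?R"
        by blast
    qed
  qed
  have ZN: "submodule {\<zero>\<^bsub>hom_space N I\<^esub>} K (hom_space N I)"
    and ZM: "submodule {\<zero>\<^bsub>hom_space M I\<^esub>} K (hom_space M I)"
    and ZQ: "submodule {\<zero>\<^bsub>hom_space Q I\<^esub>} K (hom_space Q I)"
    using hom_space_zero_submodule I' N' M' Q' by auto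
  have "len K (hom_space Q I) (lmod_hom A Q I)
      = len K (hom_space M I) ((\<lambda>f. compose (carrier M) f p) ` lmod_hom A Q I)"
    by (rule len_inj(2)[OF lin_p ZM ZQ inj hom_space_carrier_submodule[OF Q' I'] hom_space_finite_length[OF Q I]])
  then show ?thesis
    using len_exact(2)[OF lin_i ZN hom_space_finite_length[OF M I]] by (simp add: hlen_def im ker del: hom_space_simps)
qed

end

section \<open>Simple modules and composition series\<close>

lemma simple_lmodD:
  assumes "simple_lmod A S"
  shows "left_module A S" "carrier S \<noteq> {\<zero>\<^bsub>S\<^esub>}"
    "\<And>N. submodule N A S \<Longrightarrow> N \<noteq> {\<zero>\<^bsub>S\<^esub>} \<Longrightarrow> N = carrier S"
  using assms unfolding simple_lmod_def by blast+

lemma simple_ex_nonzero: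
  assumes "simple_lmod A S"
  obtains x where "x \<in> carrier S" "x \<noteq> \<zero>\<^bsub>S\<^esub>"
proof -
  interpret left_module A S
    by (rule simple_lmodD(1)[OF assms])
  have "\<not> carrier S \<subseteq> {\<zero>\<^bsub>S\<^esub>}"
    using simple_lmodD(2)[OF assms] M.zero_closed by auto
  then obtain x where "x \<in> carrier S" "x \<noteq> \<zero>\<^bsub>S\<^esub>"
    by auto
  then show ?thesis
    by (rule that)
qed

text \<open>Schur's lemma is kept in two halves: this one and the injectivity of nonzero maps out of
  a simple module are also used separately, with only one of the two modules simple.\<close>

lemma hom_to_simple_surj:
  assumes M: "left_module A M" and S: "simple_lmod A S" and f: "f \<in> lmod_hom A M S"
    and x: "x \<in> carrier M" "f x \<noteq> \<zero>\<^bsub>S\<^esub>"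
  shows "f ` carrier M = carrier S"
  using x by (intro simple_lmodD(3)[OF S]
      submodule_hom_image[OF M simple_lmodD(1)[OF S] f carrier_submodule[OF M]]) auto

lemma hom_from_simple_inj:
  assumes S: "simple_lmod A S" and M: "left_module A M" and f: "f \<in> lmod_hom A S M"
    and x: "x \<in> carrier S" "f x \<noteq> \<zero>\<^bsub>M\<^esub>"
  shows "inj_on f (carrier S)"
proof -
  have "lmod_ker S M f = {\<zero>\<^bsub>S\<^esub>}"
  proof (rule ccontr)
    assume "\<not> ?thesis"
    then have "lmod_ker S M f = carrier S"
      by (rule simple_lmodD(3)[OF S submodule_ker[OF simple_lmodD(1)[OF S] M f]])
    then show False
      using x by (auto simp: lmod_ker_def)
  qed
  then show ?thesis
    using lmod_hom_inj_iff[OF simple_lmodD(1)[OF S] M f] by simp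
qed

lemma hom_simple_iso:
  assumes S: "simple_lmod A S" and T: "simple_lmod A T" and f: "f \<in> lmod_hom A S T"
    and x: "x \<in> carrier S" "f x \<noteq> \<zero>\<^bsub>T\<^esub>"
  shows "lmod_iso A S T"
  using hom_from_simple_inj[OF S simple_lmodD(1)[OF T] f x]
    hom_to_simple_surj[OF simple_lmodD(1)[OF S] T f x] lmod_isoI[OF f] by blast

text \<open>By the correspondence of submodules: every submodule of \<open>Q\<close> is the image of
  its preimage, which contains the kernel of \<open>p\<close>, and the kernel is a maximal proper
  submodule.\<close>

lemma simple_lmod_surj:
  assumes M: "left_module A M" and Q: "left_module A Q"
    and p: "p \<in> lmod_hom A M Q" "p ` carrier M = carrier Q" and ne: "lmod_ker M Q p \<noteq> carrier M"
    and max: "\<And>N. submodule N A M \<Longrightarrow> lmod_ker M Q p \<subseteq> N \<Longrightarrow> N = lmod_ker M Q p \<or> N = carrier M"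
  shows "simple_lmod A Q"
proof -
  have "carrier Q \<noteq> {\<zero>\<^bsub>Q\<^esub>}"
  proof
    assume "carrier Q = {\<zero>\<^bsub>Q\<^esub>}"
    then have "lmod_ker M Q p = carrier M"
      using lmod_homD(1)[OF p(1)] by (auto simp: lmod_ker_def)
    with ne show False ..
  qed
  moreover have "N = {\<zero>\<^bsub>Q\<^esub>} \<or> N = carrier Q" if N: "submodule N A Q" for N
  proof -
    note D = submoduleD[OF left_module_abelian_group[OF Q] N]
    define N' where "N' = {x \<in> carrier M. p x \<in> N}"
    have "submodule N' A M" "lmod_ker M Q p \<subseteq> N'"
      using submodule_hom_vimage[OF M Q p(1) N] D(2) by (auto simp: N'_def lmod_ker_def)
    then have cases: "N' = lmod_ker M Q p \<or> N' = carrier M"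
      by (rule max)
    have im: "N = p ` N'"
      using p(2) D(1) by (auto simp: N'_def)
    from cases show ?thesis
    proof
      assume "N' = lmod_ker M Q p"
      then have "N \<subseteq> {\<zero>\<^bsub>Q\<^esub>}"
        using im by (auto simp: lmod_ker_def)
      then show ?thesis
        using D(2) by blast
    qed (use im p(2) in auto)
  qed
  ultimately show ?thesis
    using Q by (auto simp: simple_lmod_def)
qed

lemma simple_lmod_iso:
  assumes S: "simple_lmod A S" and T: "left_module A T" and "lmod_iso A S T"
  shows "simple_lmod A T"
proof -
  obtain f where f: "f \<in> lmod_hom A S T" "inj_on f (carrier S)" "f ` carrier S = carrier T"
    using assms(3) by (auto simp: lmod_iso_def bij_betw_def)
  have ker: "lmod_ker S T f = {\<zero>\<^bsub>S\<^esub>}"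
    using lmod_hom_inj_iff[OF simple_lmodD(1)[OF S] T f(1)] f(2) by simp
  show ?thesis
    by (rule simple_lmod_surj[OF simple_lmodD(1)[OF S] T f(1,3)])
      (use simple_lmodD(2,3)[OF S] ker in auto)
qed

context fin_dim_algebra
begin

text \<open>Induction on the length of \<open>N\<close>: a maximal proper submodule
  \<open>N'\<close> has a simple quotient in \<open>N\<close>, and \<open>N\<close> is appended to a
  series ending in \<open>N'\<close>.\<close>

lemma ex_composition_series:
  assumes M: "fdmod M"
  shows "\<exists>Ns. composition_series A M Ns"
proof -
  note M' = fdmod_left_module[OF M]
  note ab = left_module_abelian_group[OF M']
  have "\<exists>Ns. Ns \<noteq> [] \<and> hd Ns = {\<zero>\<^bsub>M\<^esub>} \<and> last Ns = N \<and> (\<forall>N\<in>set Ns. submodule N A M) \<and>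
     (\<forall>i. Suc i < length Ns \<longrightarrow> Ns ! i \<subseteq> Ns ! Suc i) \<and>
     (\<forall>i. Suc i < length Ns \<longrightarrow> simple_lmod A (subquot M (Ns ! Suc i) (Ns ! i)))"
    if "submodule N A M" for N
    using that
  proof (induction "len A M N" arbitrary: N rule: less_induct)
    case less
    note DN = submoduleD[OF ab less(2)]
    show ?case
    proof (cases "N = {\<zero>\<^bsub>M\<^esub>}")
      case True
      then show ?thesis
        using less(2) by (intro exI[of _ "[N]"]) auto
    next
      case False
      have fl: "finite_length A M N"
        by (rule finite_length_mono[OF fdmod_finite_length[OF M] DN(1) less(2)])
      define P where "P N' \<longleftrightarrow> submodule N' A M \<and> N' \<subset> N" for N'
      have "P {\<zero>\<^bsub>M\<^esub>}"
        using False DN(2) zero_submodule[OF M'] unfolding P_def by blast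
      then obtain N' where N': "P N'" "\<And>X. P X \<Longrightarrow> N' \<subseteq> X \<Longrightarrow> X = N'"
        using ex_maximal_submodule[OF fl, of P] unfolding P_def by (metis psubset_imp_subset)
      then have sN': "submodule N' A M" "N' \<subset> N"
        unfolding P_def by auto
      then obtain Ns where Ns: "Ns \<noteq> []" "hd Ns = {\<zero>\<^bsub>M\<^esub>}" "last Ns = N'" "\<forall>N\<in>set Ns. submodule N A M"
        "\<forall>i. Suc i < length Ns \<longrightarrow> Ns ! i \<subseteq> Ns ! Suc i"
        "\<forall>i. Suc i < length Ns \<longrightarrow> simple_lmod A (subquot M (Ns ! Suc i) (Ns ! i))"
        using less(1)[OF len_strict_mono[OF fl sN'(2,1)]] by blast
      obtain p where p: "left_module A (subquot M N N')"
        "p \<in> lmod_hom A (M\<lparr>carrier := N\<rparr>) (subquot M N N')" "p ` N = carrier (subquot M N N')"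
        "lmod_ker (M\<lparr>carrier := N\<rparr>) (subquot M N N') p = N'"
        by (rule subquot[OF M' less(2) sN'(1)]) (use sN' in blast)+
      have simple: "simple_lmod A (subquot M N N')"
      proof (rule simple_lmod_surj[OF left_module_sub[OF M' less(2)] p(1,2)])
        fix X assume X: "submodule X A (M\<lparr>carrier := N\<rparr>)" "lmod_ker (M\<lparr>carrier := N\<rparr>) (subquot M N N') p \<subseteq> X"
        then have "submodule X A M" "X \<subseteq> N"
          using submodule_sub_iff[OF ab less(2)] by auto
        then show "X = lmod_ker (M\<lparr>carrier := N\<rparr>) (subquot M N N') p \<or> X = carrier (M\<lparr>carrier := N\<rparr>)"
          using N'(2)[of X] X(2) p(4) unfolding P_def by auto
      qed (use p sN' in auto)
      have nth: "(Ns @ [N]) ! i = (if i < length Ns then Ns ! i else N)" if "i \<le> length Ns" for i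
        using that by (auto simp: nth_append)
      have lastN: "Ns ! (length Ns - 1) = N'"
        using Ns(1,3) by (simp add: last_conv_nth)
      have cons: "(Ns @ [N]) ! i \<subseteq> (Ns @ [N]) ! Suc i
          \<and> simple_lmod A (subquot M ((Ns @ [N]) ! Suc i) ((Ns @ [N]) ! i))"
        if "Suc i < length (Ns @ [N])" for i
      proof (cases "Suc i < length Ns")
        case True
        then show ?thesis
          using Ns(5,6) by (simp add: nth_append)
      next
        case False
        then have "i = length Ns - 1" "Suc i = length Ns"
          using that by auto
        then have "(Ns @ [N]) ! i = N'" "(Ns @ [N]) ! Suc i = N"
          using lastN by (simp_all add: nth_append)
        then show ?thesis
          using simple sN'(2) by auto
      qed
      show ?thesis
        using Ns(1,2,4) less(2) cons by (intro exI[of _ "Ns @ [N]"]) simp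
    qed
  qed
  from this[OF carrier_submodule[OF M']] show ?thesis
    unfolding composition_series_def filtration_def by (elim exE) (rule exI, simp)
qed

lemma composition_series_some:
  assumes "fdmod M"
  shows "composition_series A M (SOME Ns. composition_series A M Ns)"
  using ex_composition_series[OF assms] by (rule someI_ex)

lemma filtration_sum:
  assumes Ns: "filtration A M Ns" and zero: "\<phi> {\<zero>\<^bsub>M\<^esub>} = (0 :: nat)"
    and step: "\<And>i. Suc i < length Ns \<Longrightarrow> \<phi> (Ns ! Suc i) = \<phi> (Ns ! i) + g i"
  shows "\<phi> (carrier M) = (\<Sum>i | Suc i < length Ns. g i)"
proof -
  have D: "Ns \<noteq> []" "hd Ns = {\<zero>\<^bsub>M\<^esub>}" "last Ns = carrier M"
    using Ns by (auto simp: filtration_def)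
  have "\<phi> (Ns ! j) = (\<Sum>i<j. g i)" if "j < length Ns" for j
    using that
  proof (induction j)
    case 0
    then show ?case
      using D zero by (simp add: hd_conv_nth[symmetric])
  qed (use step in simp)
  from this[of "length Ns - 1"] have "\<phi> (carrier M) = (\<Sum>i<length Ns - 1. g i)"
    using D by (simp add: last_conv_nth)
  moreover have "{i. Suc i < length Ns} = {..<length Ns - 1}"
    by auto
  ultimately show ?thesis
    by simp
qed

text \<open>This takes the place of the Jordan-Hoelder theorem. Although \<open>comp_mult\<close>
  refers to a chosen series, any \<open>\<phi>\<close> that grows by \<open>e\<close> exactly at the
  factors isomorphic to \<open>L\<close> computes it. For \<open>\<phi>\<close> the dimensions of
  Hom(P(l), N), Hom(P(l), D N) and Hom(N, D P(l)) are taken.\<close>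

lemma composition_series_count:
  assumes M: "fdmod M" and zero: "\<phi> {\<zero>\<^bsub>M\<^esub>} = (0 :: nat)"
    and step: "\<And>N N'. submodule N A M \<Longrightarrow> submodule N' A M \<Longrightarrow> N \<subseteq> N' \<Longrightarrow> simple_lmod A (subquot M N' N)
      \<Longrightarrow> \<phi> N' = \<phi> N + (if lmod_iso A (subquot M N' N) L then e else 0)"
  shows "\<phi> (carrier M) = e * comp_mult A M L"
proof -
  define Ns where "Ns = (SOME Ns. composition_series A M Ns)"
  have "composition_series A M Ns"
    using composition_series_some[OF M] by (simp add: Ns_def)
  then have Ns: "filtration A M Ns" "\<And>i. Suc i < length Ns \<Longrightarrow> simple_lmod A (subquot M (Ns ! Suc i) (Ns ! i))"
    by (auto simp: composition_series_def)
  let ?g = "\<lambda>i. if lmod_iso A (subquot M (Ns ! Suc i) (Ns ! i)) L then e else 0"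
  have "\<phi> (carrier M) = (\<Sum>i | Suc i < length Ns. ?g i)"
  proof (rule filtration_sum[OF Ns(1)])
    show "\<phi> {\<zero>\<^bsub>M\<^esub>} = 0"
      by (rule zero)
    show "\<phi> (Ns ! Suc i) = \<phi> (Ns ! i) + ?g i" if "Suc i < length Ns" for i
      using Ns that by (intro step) (auto simp: filtration_def)
  qed
  also have "\<dots> = e * card {i \<in> {i. Suc i < length Ns}. lmod_iso A (subquot M (Ns ! Suc i) (Ns ! i)) L}"
  proof -
    have fin: "finite {i. Suc i < length Ns}"
      by (rule finite_subset[of _ "{..<length Ns}"]) auto
    show ?thesis
      by (simp add: sum.If_cases[OF fin] Int_def)
  qed
  also have "\<dots> = e * comp_mult A M L"
    by (simp add: comp_mult_def factor_count_def Ns_def)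
  finally show ?thesis .
qed

section \<open>Projective modules\<close>

lemma projective_fdmod: "projective K A P \<Longrightarrow> fdmod P"
  by (simp add: projective_def amod_iff)

text \<open>Projectivity is defined by lifting problems in \<open>amod\<close>. A problem on other
  types is moved to list copies \<open>M0\<close> and \<open>N0\<close>, solved there and moved back
  along the inverse \<open>u'\<close>.\<close>

lemma projective_lift:
  fixes M :: "('a, 'm) module" and N :: "('a, 'n) module"
  assumes P: "projective K A P" and M: "fdmod M" and N: "fdmod N"
    and g: "g \<in> lmod_hom A M N" "g ` carrier M = carrier N" and f: "f \<in> lmod_hom A P N"
  obtains h where "h \<in> lmod_hom A P M" "compose (carrier P) g h = f"
proof -
  note P' = fdmod_left_module[OF projective_fdmod[OF P]] and M' = fdmod_left_module[OF M]
    and N' = fdmod_left_module[OF N]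
  obtain M0 :: "('a, 'k list) module" and u where M0: "M0 \<in> amod K A" "u \<in> lmod_hom A M M0"
    "bij_betw u (carrier M) (carrier M0)"
    by (rule ex_amod_iso[OF M]) blast
  obtain N0 :: "('a, 'k list) module" and v where N0: "N0 \<in> amod K A" "v \<in> lmod_hom A N N0"
    "bij_betw v (carrier N) (carrier N0)"
    by (rule ex_amod_iso[OF N]) blast
  have M0': "left_module A M0"
    using M0(1) by (simp add: amod_iff fdmod_left_module)
  obtain u' where u': "u' \<in> lmod_hom A M0 M" "\<And>x. x \<in> carrier M \<Longrightarrow> u' (u x) = x"
    "\<And>y. y \<in> carrier M0 \<Longrightarrow> u (u' y) = y"
    by (rule lmod_hom_inverse[OF M' M0' M0(2,3)]) blast
  define g0 where "g0 = compose (carrier M0) v (compose (carrier M0) g u')"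
  have g0: "g0 \<in> lmod_hom A M0 N0"
    unfolding g0_def by (intro lmod_hom_compose[OF M0' _ N0(2)] lmod_hom_compose[OF M0' u'(1) g(1)])
  have g0_eq: "g0 y = v (g (u' y))" if "y \<in> carrier M0" for y
    using that by (simp add: g0_def compose_eq)
  have "carrier N0 \<subseteq> g0 ` carrier M0"
  proof
    fix z assume "z \<in> carrier N0"
    then obtain y where y: "y \<in> carrier N" "z = v y"
      using N0(3) by (auto simp: bij_betw_def)
    then obtain x where x: "x \<in> carrier M" "y = g x"
      using g(2) by auto
    then have "g0 (u x) = z" "u x \<in> carrier M0"
      using y u'(2) lmod_homD(1)[OF M0(2)] by (simp_all add: g0_eq)
    then show "z \<in> g0 ` carrier M0"
      by blast
  qed
  then have surj: "g0 ` carrier M0 = carrier N0"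
    using lmod_homD(1)[OF g0] by auto
  have "compose (carrier P) v f \<in> lmod_hom A P N0"
    by (rule lmod_hom_compose[OF P' f N0(2)])
  then obtain h0 where h0: "h0 \<in> lmod_hom A P M0" "compose (carrier P) g0 h0 = compose (carrier P) v f"
    using P M0(1) N0(1) g0 surj unfolding projective_def by blast
  have h: "compose (carrier P) u' h0 \<in> lmod_hom A P M"
    by (rule lmod_hom_compose[OF P' h0(1) u'(1)])
  have "g (u' (h0 x)) = f x" if x: "x \<in> carrier P" for x
  proof -
    have "v (g (u' (h0 x))) = v (f x)"
      using h0(2) compose_eq[OF x, of g0 h0] compose_eq[OF x, of v f] g0_eq lmod_homD(1)[OF h0(1) x] by simp
    then show ?thesis
      using inj_onD[OF bij_betw_imp_inj_on[OF N0(3)]] lmod_homD(1)[OF g(1)] lmod_homD(1)[OF u'(1)]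
        lmod_homD(1)[OF h0(1) x] lmod_homD(1)[OF f x] by blast
  qed
  then have "compose (carrier P) g (compose (carrier P) u' h0) = f"
    by (intro extensionalityI[OF compose_extensional lmod_homD(2)[OF f]]) (auto simp: compose_eq)
  then show ?thesis
    using that h by blast
qed

lemma hlen_projective:
  assumes P: "projective K A P" and N: "fdmod N" and M: "fdmod M" and Q: "fdmod Q"
    and i: "i \<in> lmod_hom A N M" "inj_on i (carrier N)" and p: "p \<in> lmod_hom A M Q" "p ` carrier M = carrier Q"
    and ex: "i ` carrier N = lmod_ker M Q p"
  shows "hlen P M = hlen P N + hlen P Q"
proof (rule hlen_exact_left[OF projective_fdmod[OF P] N M Q i p(1) ex])
  fix f assume "f \<in> lmod_hom A P Q"
  then show "\<exists>h\<in>lmod_hom A P M. compose (carrier P) p h = f"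
    using projective_lift[OF P M Q p] by metis
qed

lemma hlen_trivial_right:
  assumes "fdmod P" and "fdmod N" and "carrier N = {\<zero>\<^bsub>N\<^esub>}"
  shows "hlen P N = 0"
  using hlen_pos_iff[OF assms(1,2)] lmod_homD(1)[of _ A P N] assms(3) by blast

lemma hlen_trivial_left:
  assumes "fdmod P" and "fdmod N" and "carrier N = {\<zero>\<^bsub>N\<^esub>}"
  shows "hlen N P = 0"
proof -
  have "f x = \<zero>\<^bsub>P\<^esub>" if "f \<in> lmod_hom A N P" "x \<in> carrier N" for f x
    using lmod_hom_zero[OF _ _ that(1)] that(2) assms by (simp add: fdmod_left_module)
  then show ?thesis
    using hlen_pos_iff[OF assms(2,1)] by blast
qed

lemma fdmod_zero_sub:
  assumes "fdmod M"
  shows "fdmod (M\<lparr>carrier := {\<zero>\<^bsub>M\<^esub>}\<rparr>)"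
  by (rule fdmod_sub[OF assms zero_submodule[OF fdmod_left_module[OF assms]]])

text \<open>An isomorphism is a short exact sequence with zero kernel, so invariance is a special
  case of additivity; the inverse provides the lifts.\<close>

lemma hlen_iso:
  assumes P: "fdmod P" and M: "fdmod M" and Q: "fdmod Q" and "lmod_iso A M Q"
  shows "hlen P M = hlen P Q" and "hlen M P = hlen Q P"
proof -
  note P' = fdmod_left_module[OF P] and M' = fdmod_left_module[OF M] and Q' = fdmod_left_module[OF Q]
  obtain p where p: "p \<in> lmod_hom A M Q" "bij_betw p (carrier M) (carrier Q)"
    using assms(4) by (auto simp: lmod_iso_def)
  obtain q where q: "q \<in> lmod_hom A Q M" "\<And>x. x \<in> carrier M \<Longrightarrow> q (p x) = x"
    "\<And>y. y \<in> carrier Q \<Longrightarrow> p (q y) = y"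
    by (rule lmod_hom_inverse[OF M' Q' p]) blast
  let ?Z = "M\<lparr>carrier := {\<zero>\<^bsub>M\<^esub>}\<rparr>"
  have Z: "fdmod ?Z"
    by (rule fdmod_zero_sub[OF M])
  have i: "(\<lambda>x\<in>{\<zero>\<^bsub>M\<^esub>}. x) \<in> lmod_hom A ?Z M"
    by (rule inclusion_lmod_hom[OF M' zero_submodule[OF M']])
  have ker: "lmod_ker M Q p = {\<zero>\<^bsub>M\<^esub>}"
    using lmod_hom_inj_iff[OF M' Q' p(1)] p(2) by (simp add: bij_betw_def)
  have "hlen P M = hlen P ?Z + hlen P Q"
  proof (rule hlen_exact_left[OF P Z M Q i _ p(1)])
    fix f assume f: "f \<in> lmod_hom A P Q"
    have "compose (carrier P) p (compose (carrier P) q f) = f"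
      by (rule extensionalityI[OF compose_extensional lmod_homD(2)[OF f]])
        (simp add: compose_eq q(3) lmod_homD(1)[OF f])
    then show "\<exists>h\<in>lmod_hom A P M. compose (carrier P) p h = f"
      using lmod_hom_compose[OF P' f q(1)] by blast
  qed (simp_all add: ker)
  then show "hlen P M = hlen P Q"
    using hlen_trivial_right[OF P Z] by simp
  have "hlen M P = hlen ?Z P + hlen Q P"
  proof (rule hlen_exact_right[OF P Z M Q i p(1)])
    fix f assume f: "f \<in> lmod_hom A ?Z P"
    have f0: "f \<zero>\<^bsub>M\<^esub> = \<zero>\<^bsub>P\<^esub>"
      using lmod_hom_zero[OF fdmod_left_module[OF Z] P' f] by simp
    have "compose (carrier ?Z) (\<lambda>x\<in>carrier M. \<zero>\<^bsub>P\<^esub>) (\<lambda>x\<in>{\<zero>\<^bsub>M\<^esub>}. x) = f"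
      by (rule extensionalityI[OF compose_extensional lmod_homD(2)[OF f]])
        (use f0 M' in \<open>auto simp: compose_eq abelian_group.a_inv_closed
          intro: submoduleD(2)[OF left_module_abelian_group[OF M'] carrier_submodule[OF M']]\<close>)
    then show "\<exists>h\<in>lmod_hom A M P. compose (carrier ?Z) h (\<lambda>x\<in>{\<zero>\<^bsub>M\<^esub>}. x) = f"
      using zero_lmod_hom[OF M' P'] by blast
  qed (use p(2) in \<open>simp_all add: ker bij_betw_def\<close>)
  then show "hlen M P = hlen Q P"
    using hlen_trivial_left[OF P Z] by simp
qed

lemma subquot_fdmod:
  assumes M: "fdmod M" and N': "submodule N' A M" and N: "submodule N A M" and "N \<subseteq> N'"
  obtains p where "fdmod (subquot M N' N)" "p \<in> lmod_hom A (M\<lparr>carrier := N'\<rparr>) (subquot M N' N)"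
    "p ` N' = carrier (subquot M N' N)" "lmod_ker (M\<lparr>carrier := N'\<rparr>) (subquot M N' N) p = N"
proof -
  obtain p where p: "left_module A (subquot M N' N)"
    "p \<in> lmod_hom A (M\<lparr>carrier := N'\<rparr>) (subquot M N' N)" "p ` N' = carrier (subquot M N' N)"
    "lmod_ker (M\<lparr>carrier := N'\<rparr>) (subquot M N' N) p = N"
    by (rule subquot[OF fdmod_left_module[OF M] assms(2-4)]) blast
  moreover have "fdmod (subquot M N' N)"
    by (rule fdmod_surj[OF fdmod_sub[OF M N'] p(1,2)]) (use p(3) in simp)
  ultimately show ?thesis
    using that by blast
qed

lemma sub_inclusion:
  assumes M: "left_module A M" and N': "submodule N' A M" and N: "submodule N A M" and "N \<subseteq> N'"
  shows "(\<lambda>x\<in>N. x) \<in> lmod_hom A (M\<lparr>carrier := N\<rparr>) (M\<lparr>carrier := N'\<rparr>)"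
proof -
  have "submodule N A (M\<lparr>carrier := N'\<rparr>)"
    using assms submodule_sub_iff[OF left_module_abelian_group[OF M] N'] by blast
  from inclusion_lmod_hom[OF left_module_sub[OF M N'] this] show ?thesis
    by simp
qed

lemma hlen_projective_subquot:
  assumes P: "projective K A P" and M: "fdmod M" and N': "submodule N' A M" and N: "submodule N A M"
    and "N \<subseteq> N'"
  shows "hlen P (M\<lparr>carrier := N'\<rparr>) = hlen P (M\<lparr>carrier := N\<rparr>) + hlen P (subquot M N' N)"
proof -
  obtain p where p: "fdmod (subquot M N' N)" "p \<in> lmod_hom A (M\<lparr>carrier := N'\<rparr>) (subquot M N' N)"
    "p ` N' = carrier (subquot M N' N)" "lmod_ker (M\<lparr>carrier := N'\<rparr>) (subquot M N' N) p = N"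
    by (rule subquot_fdmod[OF assms(2-5)]) blast
  show ?thesis
    by (rule hlen_projective[OF P fdmod_sub[OF M N] fdmod_sub[OF M N'] p(1)
          sub_inclusion[OF fdmod_left_module[OF M] N' N assms(5)] _ p(2)]) (use p(3,4) in \<open>auto simp: inj_on_def\<close>)
qed

subsection \<open>The regular module\<close>

definition regular_module :: "('a, 'a) module" where
  "regular_module = \<lparr>carrier = carrier A, mult = mult A, one = \<one>\<^bsub>A\<^esub>, zero = \<zero>\<^bsub>A\<^esub>,
     add = add A, smult = mult A\<rparr>"

lemma regular_module_simps [simp]:
  "carrier regular_module = carrier A" "zero regular_module = \<zero>\<^bsub>A\<^esub>" "add regular_module = add A"
  "smult regular_module = mult A"
  by (simp_all add: regular_module_def)

lemma regular_left_module: "left_module A regular_module"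
proof -
  have "abelian_group regular_module"
    using A.is_abelian_group abelian_group_cong[of regular_module A] by simp
  moreover have "left_module_axioms A regular_module"
    by standard (simp_all add: A.l_distr A.r_distr A.m_assoc)
  ultimately show ?thesis
    using A.ring_axioms by (simp add: left_module_def)
qed

lemma regular_fdmod: "fdmod regular_module"
proof -
  have mod: "Module.module K A" ..
  have fl: "finite_length K A (carrier A)"
    using finite_dimensional fin_dim_iff_finite_length[OF K.field_axioms mod] by simp
  have lin: "lin_map K A (restrict_scalars A regular_module) (\<lambda>x. x)"
    unfolding lin_map_def restrict_scalars_abelian_group
    using A.is_abelian_group left_module_abelian_group[OF regular_left_module]
    by (simp add: smult_mult_left)
  have "submodule {\<zero>\<^bsub>restrict_scalars A regular_module\<^esub>} K (restrict_scalars A regular_module)"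
    using restrict_scalars_zero_submodule[OF regular_left_module] by simp
  then show ?thesis
    using len_exact(1)[OF lin _ fl] regular_left_module by (simp add: fdmod_iff_finite_length)
qed

lemma hom_from_regular:
  assumes M: "left_module A M" and x: "x \<in> carrier M"
  shows "(\<lambda>a\<in>carrier A. a \<odot>\<^bsub>M\<^esub> x) \<in> lmod_hom A regular_module M"
proof -
  interpret M: left_module A M by fact
  show ?thesis
    using lmod_hom_restrictI[OF regular_left_module, of "\<lambda>a. a \<odot>\<^bsub>M\<^esub> x" M] x
      M.smult_closed M.smult_l_distr M.smult_assoc by simp
qed

text \<open>\<open>F\<close> is a list copy of the regular module and \<open>b\<close> corresponds
  to the unit. Every \<open>y\<close> in \<open>F\<close> is \<open>v y\<close> times
  \<open>b\<close>, so \<open>F\<close> is free on \<open>b\<close>: to lift a map, it suffices to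
  lift the value at \<open>b\<close>.\<close>

lemma ex_projective_generator:
  obtains F :: "('a, 'k list) module" and b where "projective K A F" "b \<in> carrier F"
    "\<And>(M :: ('a, 'k list) module) x. fdmod M \<Longrightarrow> x \<in> carrier M \<Longrightarrow> \<exists>f\<in>lmod_hom A F M. f b = x"
proof -
  obtain F :: "('a, 'k list) module" and u where F: "F \<in> amod K A" "u \<in> lmod_hom A regular_module F"
    "bij_betw u (carrier regular_module) (carrier F)"
    by (rule ex_amod_iso[OF regular_fdmod]) blast
  have F': "left_module A F"
    using F(1) by (simp add: amod_iff fdmod_left_module)
  obtain v where v: "v \<in> lmod_hom A F regular_module" "\<And>x. x \<in> carrier regular_module \<Longrightarrow> v (u x) = x"
    "\<And>y. y \<in> carrier F \<Longrightarrow> u (v y) = y"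
    by (rule lmod_hom_inverse[OF regular_left_module F' F(2,3)]) blast
  have vA: "v y \<in> carrier A" if "y \<in> carrier F" for y
    using lmod_homD(1)[OF v(1) that] by simp
  define b where "b = u \<one>\<^bsub>A\<^esub>"
  have b: "b \<in> carrier F" "v b = \<one>\<^bsub>A\<^esub>"
    using lmod_homD(1)[OF F(2)] v(2) by (simp_all add: b_def)
  have vb: "v y \<odot>\<^bsub>F\<^esub> b = y" if "y \<in> carrier F" for y
    using that vA v(3) lmod_homD(4)[OF F(2), of "v y" "\<one>\<^bsub>A\<^esub>"] by (simp add: b_def)
  have free: "\<exists>f\<in>lmod_hom A F M. f b = x" if M: "left_module A M" and x: "x \<in> carrier M"
    for M :: "('a, 'k list) module" and x
  proof
    show "compose (carrier F) (\<lambda>a\<in>carrier A. a \<odot>\<^bsub>M\<^esub> x) v \<in> lmod_hom A F M"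
      by (rule lmod_hom_compose[OF F' v(1) hom_from_regular[OF M x]])
    show "compose (carrier F) (\<lambda>a\<in>carrier A. a \<odot>\<^bsub>M\<^esub> x) v b = x"
      using b left_module.smult_one[OF M x] by (simp add: compose_eq)
  qed
  have proj: "projective K A F"
    unfolding projective_def
  proof (intro conjI ballI impI)
    fix M N :: "('a, 'k list) module" and g f
    assume M: "M \<in> amod K A" and N: "N \<in> amod K A" and g: "g \<in> lmod_hom A M N" and f: "f \<in> lmod_hom A F N"
      and surj: "g ` carrier M = carrier N"
    have M': "left_module A M"
      using M by (simp add: amod_iff fdmod_left_module)
    obtain m where m: "m \<in> carrier M" "g m = f b"
      using surj lmod_homD(1)[OF f b(1)] by (metis imageE)
    obtain h where h: "h \<in> lmod_hom A F M" "h b = m"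
      using free[OF M' m(1)] by blast
    have "g (h y) = f y" if y: "y \<in> carrier F" for y
    proof -
      have "g (h (v y \<odot>\<^bsub>F\<^esub> b)) = f (v y \<odot>\<^bsub>F\<^esub> b)"
        using vA[OF y] b h m by (simp add: lmod_homD(4)[OF h(1)] lmod_homD(4)[OF g] lmod_homD(4)[OF f])
      then show ?thesis
        by (simp add: vb[OF y])
    qed
    then have "compose (carrier F) g h = f"
      by (intro extensionalityI[OF compose_extensional lmod_homD(2)[OF f]]) (auto simp: compose_eq)
    then show "\<exists>h\<in>lmod_hom A F M. compose (carrier F) g h = f"
      using h(1) by blast
  qed (rule F(1))
  from proj b(1) free[OF fdmod_left_module] show ?thesis
    by (rule that)
qed

subsection \<open>Projective covers\<close>

text \<open>Additivity of length leaves length 0 for the kernel.\<close>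

lemma surj_endo_inj:
  assumes M: "fdmod M" and f: "f \<in> lmod_hom A M M" "f ` carrier M = carrier M"
  shows "inj_on f (carrier M)"
proof -
  note M' = fdmod_left_module[OF M]
  note lin = lmod_hom_lin_map[OF M' M' f(1)] and Z = zero_submodule[OF M']
  have "len A M (lmod_ker M M f) = 0"
    using len_exact(2)[OF lin Z fdmod_finite_length[OF M]] f(2) by (simp add: lmod_ker_def)
  moreover have "finite_length A M (lmod_ker M M f)"
    by (rule finite_length_mono[OF fdmod_finite_length[OF M] _ submodule_ker[OF M' M' f(1)]])
      (auto simp: lmod_ker_def)
  ultimately have "lmod_ker M M f = {\<zero>\<^bsub>M\<^esub>}"
    using len_eq_0_iff[OF left_module_abelian_group[OF M'] Z] by blast
  then show ?thesis
    using lmod_hom_inj_iff[OF M' M' f(1)] by simp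
qed

lemma image_sum_ker:
  assumes P: "left_module A P" and L: "left_module A L" and p: "p \<in> lmod_hom A P L" and N: "submodule N A P"
    and surj: "p ` carrier P = carrier L"
  shows "N <+>\<^bsub>P\<^esub> lmod_ker P L p = carrier P \<longleftrightarrow> p ` N = carrier L"
proof -
  have mem: "y \<in> N <+>\<^bsub>P\<^esub> lmod_ker P L p \<longleftrightarrow> (\<exists>n\<in>N. \<exists>k\<in>lmod_ker P L p. y = n \<oplus>\<^bsub>P\<^esub> k)" for y
    by (simp add: set_add_def')
  interpret P: left_module A P by fact
  interpret L: left_module A L by fact
  note D = submoduleD[OF left_module_abelian_group[OF P] N]
  have "p ` N = carrier L" if eq: "N <+>\<^bsub>P\<^esub> lmod_ker P L p = carrier P"
  proof
    show "p ` N \<subseteq> carrier L"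
      using D(1) lmod_homD(1)[OF p] by auto
    show "carrier L \<subseteq> p ` N"
    proof
      fix y assume "y \<in> carrier L"
      then obtain x where x: "x \<in> carrier P" "p x = y"
        using surj by (metis imageE)
      then obtain n k where nk: "n \<in> N" "k \<in> lmod_ker P L p" "x = n \<oplus>\<^bsub>P\<^esub> k"
        using eq mem by metis
      then have "n \<in> carrier P" "k \<in> carrier P" "p k = \<zero>\<^bsub>L\<^esub>"
        using D(1) by (auto simp: lmod_ker_def)
      then have "p x = p n"
        using nk(3) lmod_homD(1,3)[OF p] by simp
      then show "y \<in> p ` N"
        using x(2) nk(1) by auto
    qed
  qed
  moreover have "N <+>\<^bsub>P\<^esub> lmod_ker P L p = carrier P" if eq: "p ` N = carrier L"
  proof
    show "N <+>\<^bsub>P\<^esub> lmod_ker P L p \<subseteq> carrier P"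
      using D(1) by (auto simp: set_add_def' lmod_ker_def)
    show "carrier P \<subseteq> N <+>\<^bsub>P\<^esub> lmod_ker P L p"
    proof
      fix x assume x: "x \<in> carrier P"
      then have "p x \<in> p ` N"
        using eq lmod_homD(1)[OF p] by simp
      then obtain n where n: "n \<in> N" "p x = p n"
        by (metis imageE)
      then have nP: "n \<in> carrier P"
        using D(1) by auto
      have "p (x \<ominus>\<^bsub>P\<^esub> n) = \<zero>\<^bsub>L\<^esub>"
        using lin_map_minus[OF lmod_hom_lin_map[OF P L p] x nP] n lmod_homD(1)[OF p nP]
        by (simp add: a_minus_def L.M.r_neg)
      then have "x \<ominus>\<^bsub>P\<^esub> n \<in> lmod_ker P L p"
        using x nP by (simp add: lmod_ker_def)
      moreover have "x = n \<oplus>\<^bsub>P\<^esub> (x \<ominus>\<^bsub>P\<^esub> n)"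
        using x nP by (simp add: a_minus_def P.M.a_lcomm[of n] P.M.r_neg)
      ultimately show "x \<in> N <+>\<^bsub>P\<^esub> lmod_ker P L p"
        using n(1) mem by metis
    qed
  qed
  ultimately show ?thesis
    by metis
qed

text \<open>A submodule of a projective module that is minimal among those mapping onto the simple module is
  a direct summand, hence again projective.\<close>

lemma ex_projective_cover:
  assumes L: "L \<in> amod K A" and simple: "simple_lmod A L"
  shows "\<exists>P. projective_cover K A P L"
proof -
  have L': "fdmod L" "left_module A L"
    using L by (auto simp: amod_iff fdmod_left_module)
  obtain F b where F: "projective K A F" "b \<in> carrier F"
    and free: "\<And>(M :: ('a, 'k list) module) x. fdmod M \<Longrightarrow> x \<in> carrier M \<Longrightarrow> \<exists>f\<in>lmod_hom A F M. f b = x"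
    using ex_projective_generator by blast
  note F' = projective_fdmod[OF F(1)]
  note F'' = fdmod_left_module[OF F']
  obtain x where x: "x \<in> carrier L" "x \<noteq> \<zero>\<^bsub>L\<^esub>"
    by (rule simple_ex_nonzero[OF simple])
  obtain q where q: "q \<in> lmod_hom A F L" "q b = x"
    using free[OF L'(1) x(1)] by blast
  have qsurj: "q ` carrier F = carrier L"
    using hom_to_simple_surj[OF F'' simple q(1) F(2)] q(2) x(2) by simp
  define Q where "Q N \<longleftrightarrow> submodule N A F \<and> q ` N = carrier L" for N
  have "Q (carrier F)"
    using carrier_submodule[OF F''] qsurj by (simp add: Q_def)
  moreover have "submodule N A F \<and> N \<subseteq> carrier F" if "Q N" for N
    using that submoduleD(1)[OF left_module_abelian_group[OF F'']] by (auto simp: Q_def)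
  ultimately obtain N where N: "Q N" "\<And>N'. Q N' \<Longrightarrow> N' \<subseteq> N \<Longrightarrow> N' = N"
    using ex_minimal_submodule[OF fdmod_finite_length[OF F'], of Q] by metis
  then have sN: "submodule N A F" "q ` N = carrier L"
    by (auto simp: Q_def)
  have NF: "N \<subseteq> carrier F"
    using submoduleD(1)[OF left_module_abelian_group[OF F''] sN(1)] .
  let ?P = "F\<lparr>carrier := N\<rparr>"
  have P: "fdmod ?P"
    by (rule fdmod_sub[OF F' sN(1)])
  note P' = fdmod_left_module[OF P]
  define p where "p = restrict q N"
  have p: "p \<in> lmod_hom A ?P L" "p ` carrier ?P = carrier L"
    using lmod_hom_restrict_sub[OF F'' sN(1) q(1)] sN(2) by (simp_all add: p_def)
  \<comment> \<open>Lifting \<open>q\<close> through its restriction to \<open>N\<close> gives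
    \<open>q g = q\<close>. Hence \<open>g\<close> maps \<open>N\<close> to a submodule still
    mapping onto \<open>L\<close>, and minimality yields \<open>g N = N\<close>. So \<open>g\<close>
    restricts to an automorphism of \<open>N\<close>; its inverse \<open>s\<close> splits
    \<open>g\<close>, and a map on \<open>N\<close> is lifted by lifting its composite with
    \<open>g\<close> to \<open>F\<close> and composing with \<open>s\<close>.\<close>
  obtain g where g: "g \<in> lmod_hom A F ?P" "compose (carrier F) p g = q"
    using projective_lift[OF F(1) P L'(1) p q(1)] by metis
  have gF: "g \<in> lmod_hom A F F"
    using g(1) lmod_hom_sub_iff[OF sN(1) F''] by blast
  have gN: "g y \<in> N" if "y \<in> carrier F" for y
    using lmod_homD(1)[OF g(1) that] by simp
  have qg: "q (g y) = q y" if "y \<in> carrier F" for y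
    using g(2) compose_eq[OF that, of p g] gN[OF that] by (simp add: p_def)
  have "Q (g ` N)"
  proof -
    have "q ` (g ` N) = q ` N"
      using qg NF by (force simp: image_image)
    then show ?thesis
      using submodule_hom_image[OF F'' F'' gF sN(1)] sN(2) by (simp add: Q_def)
  qed
  then have gim: "g ` N = N"
    using N(2) gN NF by blast
  define r where "r = restrict g N"
  have r: "r \<in> lmod_hom A ?P ?P" "r ` carrier ?P = carrier ?P"
    using lmod_hom_restrict_sub[OF F'' sN(1) g(1)] gim by (simp_all add: r_def)
  have "bij_betw r (carrier ?P) (carrier ?P)"
    using surj_endo_inj[OF P r] r(2) by (simp add: bij_betw_def)
  then obtain s where s: "s \<in> lmod_hom A ?P ?P" "\<And>y. y \<in> carrier ?P \<Longrightarrow> r (s y) = y"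
    by (rule lmod_hom_inverse[OF P' P' r(1)]) blast
  have sN': "s y \<in> N" "g (s y) = y" if "y \<in> N" for y
    using that s(2)[of y] lmod_homD(1)[OF s(1), of y] by (simp_all add: r_def)
  have sF: "s \<in> lmod_hom A ?P F"
    using s(1) lmod_hom_sub_iff[OF sN(1) F''] by blast
  have "projective K A ?P"
    unfolding projective_def
  proof (intro conjI ballI impI)
    show "?P \<in> amod K A"
      using P by (simp add: amod_iff)
    fix M M' :: "('a, 'k list) module" and t f
    assume M: "M \<in> amod K A" and M': "M' \<in> amod K A" and t: "t \<in> lmod_hom A M M'"
      and f: "f \<in> lmod_hom A ?P M'" and surj: "t ` carrier M = carrier M'"
    have "compose (carrier F) f g \<in> lmod_hom A F M'"
      by (rule lmod_hom_compose[OF F'' g(1) f])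
    then obtain h where h: "h \<in> lmod_hom A F M" "compose (carrier F) t h = compose (carrier F) f g"
      using F(1) M M' t surj unfolding projective_def by blast
    have th: "t (h y) = f (g y)" if "y \<in> carrier F" for y
      using h(2) compose_eq[OF that, of t h] compose_eq[OF that, of f g] by simp
    have "compose (carrier ?P) t (compose (carrier ?P) h s) = f"
      by (rule extensionalityI[OF compose_extensional lmod_homD(2)[OF f]])
        (use sN' NF th in \<open>auto simp: compose_eq subset_iff\<close>)
    then show "\<exists>h\<in>lmod_hom A ?P M. compose (carrier ?P) t h = f"
      using lmod_hom_compose[OF P' sF h(1)] by blast
  qed
  moreover have "N' = carrier ?P" if N': "submodule N' A ?P" "N' <+>\<^bsub>?P\<^esub> a_kernel ?P L p = carrier ?P" for N'
  proof -
    have "p ` N' = carrier L"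
      using image_sum_ker[OF P' L'(2) p(1) N'(1) p(2)] N'(2) by (simp add: a_kernel_eq)
    moreover have *: "submodule N' A F" "N' \<subseteq> N"
      using N'(1) submodule_sub_iff[OF left_module_abelian_group[OF F''] sN(1)] by auto
    moreover have "p ` N' = q ` N'"
      using *(2) by (auto simp: p_def subset_iff image_iff Bex_def)
    ultimately show ?thesis
      using N(2)[of N'] by (simp add: Q_def)
  qed
  ultimately have "projective_cover K A ?P L"
    unfolding projective_cover_def using p by blast
  then show ?thesis ..
qed

lemma projective_coverD:
  assumes cov: "projective_cover K A P L" and simple: "simple_lmod A L"
  obtains p where "p \<in> lmod_hom A P L" "p ` carrier P = carrier L"
    "\<And>N. submodule N A P \<Longrightarrow> \<not> N \<subseteq> lmod_ker P L p \<Longrightarrow> N = carrier P"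
proof -
  have P: "left_module A P"
    using cov by (simp add: projective_cover_def projective_fdmod fdmod_left_module)
  note L = simple_lmodD(1)[OF simple]
  obtain p where p: "p \<in> lmod_hom A P L" "p ` carrier P = carrier L"
    and cov': "\<forall>N. submodule N A P \<and> N <+>\<^bsub>P\<^esub> lmod_ker P L p = carrier P \<longrightarrow> N = carrier P"
    using cov unfolding projective_cover_def a_kernel_eq by metis
  have "N = carrier P" if N: "submodule N A P" "\<not> N \<subseteq> lmod_ker P L p" for N
  proof -
    have "p ` N \<noteq> {\<zero>\<^bsub>L\<^esub>}"
      using N(2) submoduleD(1)[OF left_module_abelian_group[OF P] N(1)] by (auto simp: lmod_ker_def)
    then have "p ` N = carrier L"
      by (rule simple_lmodD(3)[OF simple submodule_hom_image[OF P L p(1) N(1)]])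
    then show ?thesis
      using cov' N(1) image_sum_ker[OF P L p(1) N(1) p(2)] by simp
  qed
  with p show ?thesis
    by (rule that)
qed

text \<open>The kernel of \<open>f\<close> is proper, so it lies in the kernel of the covering map.
  The latter therefore factors through \<open>f\<close>, and the factor is a nonzero map from
  \<open>S\<close> to \<open>L\<close>.\<close>

lemma projective_cover_hom_simple:
  assumes cov: "projective_cover K A P L" and L: "simple_lmod A L" and S: "simple_lmod A S"
    and f: "f \<in> lmod_hom A P S" and x: "x \<in> carrier P" "f x \<noteq> \<zero>\<^bsub>S\<^esub>"
  shows "lmod_iso A S L"
proof -
  have P: "left_module A P"
    using cov by (simp add: projective_cover_def projective_fdmod fdmod_left_module)
  obtain p where p: "p \<in> lmod_hom A P L" "p ` carrier P = carrier L"
    "\<And>N. submodule N A P \<Longrightarrow> \<not> N \<subseteq> lmod_ker P L p \<Longrightarrow> N = carrier P"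
    by (rule projective_coverD[OF cov L]) blast
  have "lmod_ker P S f \<noteq> carrier P"
    using x by (auto simp: lmod_ker_def)
  then have ker: "lmod_ker P S f \<subseteq> lmod_ker P L p"
    using p(3)[OF submodule_ker[OF P simple_lmodD(1)[OF S] f]] by blast
  obtain g where g: "g \<in> lmod_hom A S L" "compose (carrier P) g f = p"
    by (rule lmod_hom_factor[OF P simple_lmodD(1)[OF S] simple_lmodD(1)[OF L] f
          hom_to_simple_surj[OF P S f x] p(1) ker]) blast
  obtain y where y: "y \<in> carrier L" "y \<noteq> \<zero>\<^bsub>L\<^esub>"
    by (rule simple_ex_nonzero[OF L])
  then obtain z where z: "z \<in> carrier P" "p z = y"
    using p(2) by (metis imageE)
  have "g (f z) = y"
    using g(2) z compose_eq[OF z(1), of g f] by simp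
  then show ?thesis
    using hom_simple_iso[OF S L g(1), of "f z"] lmod_homD(1)[OF f z(1)] y(2) by simp
qed

subsection \<open>Isomorphism classes of simple modules\<close>

lemma Irr_simple_of:
  assumes "l \<in> Irr K A"
  shows "simple_of l \<in> l" "simple_of l \<in> amod K A" "simple_lmod A (simple_of l)" "fdmod (simple_of l)"
    "\<And>L. L \<in> l \<longleftrightarrow> L \<in> amod K A \<and> simple_lmod A L \<and> lmod_iso A (simple_of l) L"
proof -
  obtain L where L: "L \<in> amod K A" "simple_lmod A L"
    and "l = {(L, L'). L \<in> amod K A \<and> simple_lmod A L \<and> L' \<in> amod K A \<and> simple_lmod A L' \<and>
      lmod_iso A L L'} `` {L}"
    using assms unfolding Irr_def by (elim quotientE) (metis (no_types, lifting) mem_Collect_eq)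
  then have l: "l = {L'. L' \<in> amod K A \<and> simple_lmod A L' \<and> lmod_iso A L L'}"
    by auto
  have "L \<in> l"
    using L lmod_iso_refl simple_lmodD(1) by (auto simp: l)
  then show mem: "simple_of l \<in> l"
    unfolding simple_of_def by (rule someI)
  then show S: "simple_of l \<in> amod K A" "simple_lmod A (simple_of l)" "fdmod (simple_of l)"
    by (simp_all add: l amod_iff)
  have iso: "lmod_iso A L (simple_of l)"
    using mem by (simp add: l)
  have LS: "left_module A L" "left_module A (simple_of l)"
    using L S simple_lmodD(1) by auto
  show "L' \<in> l \<longleftrightarrow> L' \<in> amod K A \<and> simple_lmod A L' \<and> lmod_iso A (simple_of l) L'" for L'
    using lmod_iso_trans[OF LS(1) iso] lmod_iso_trans[OF LS(2) lmod_iso_sym[OF LS iso]] by (auto simp: l)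
qed

lemma Irr_eqI:
  assumes "l \<in> Irr K A" and "m \<in> Irr K A" and "lmod_iso A (simple_of l) (simple_of m)"
  shows "l = m"
proof -
  have S: "left_module A (simple_of l)" "left_module A (simple_of m)"
    using assms Irr_simple_of(3) simple_lmodD(1) by blast+
  show ?thesis
    using Irr_simple_of(5)[OF assms(1)] Irr_simple_of(5)[OF assms(2)]
      lmod_iso_trans[OF S(1) assms(3)] lmod_iso_trans[OF S(2) lmod_iso_sym[OF S assms(3)]] by blast
qed

lemma ex_Irr_iso:
  assumes "fdmod S" and "simple_lmod A S"
  obtains l where "l \<in> Irr K A" "lmod_iso A S (simple_of l)"
proof -
  note S = fdmod_left_module[OF assms(1)]
  obtain T :: "('a, 'k list) module" and f where T: "T \<in> amod K A" "f \<in> lmod_hom A S T"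
    "bij_betw f (carrier S) (carrier T)"
    by (rule ex_amod_iso[OF assms(1)]) blast
  have ST: "lmod_iso A S T"
    using T by (auto simp: lmod_iso_def)
  have T': "left_module A T" "simple_lmod A T"
    using T(1) simple_lmod_iso[OF assms(2) _ ST] by (auto simp: amod_iff fdmod_left_module)
  define l where "l = {L'. L' \<in> amod K A \<and> simple_lmod A L' \<and> lmod_iso A T L'}"
  have l: "l \<in> Irr K A"
    using T(1) T'(2) unfolding Irr_def quotient_def l_def by auto
  moreover have "lmod_iso A T (simple_of l)"
    using Irr_simple_of(1)[OF l] by (simp add: l_def)
  ultimately show ?thesis
    using that lmod_iso_trans[OF S ST] by blast
qed

lemma proj_of_cover:
  assumes "l \<in> Irr K A"
  shows "projective_cover K A (proj_of K A l) (simple_of l)"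
  unfolding proj_of_def
  using ex_projective_cover[OF Irr_simple_of(2,3)[OF assms]] by (rule someI_ex)

lemma proj_of_projective:
  assumes "l \<in> Irr K A"
  shows "projective K A (proj_of K A l)" "fdmod (proj_of K A l)" "left_module A (proj_of K A l)"
    "proj_of K A l \<in> amod K A"
proof -
  show P: "projective K A (proj_of K A l)"
    using proj_of_cover[OF assms] by (simp add: projective_cover_def)
  show "fdmod (proj_of K A l)"
    by (rule projective_fdmod[OF P])
  then show "left_module A (proj_of K A l)" "proj_of K A l \<in> amod K A"
    by (simp_all add: fdmod_left_module amod_iff)
qed

text \<open>This is the dimension of the division algebra \<open>End(L(l))\<close>, which need not be 1 since \<open>K\<close> is not
  assumed to be a splitting field.\<close>

definition hom_dim :: "('a, 'k list) module set \<Rightarrow> nat" where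
  "hom_dim l = hlen (proj_of K A l) (simple_of l)"

lemma hom_dim_pos:
  assumes "l \<in> Irr K A"
  shows "hom_dim l > 0"
proof -
  obtain p where p: "p \<in> lmod_hom A (proj_of K A l) (simple_of l)"
    "p ` carrier (proj_of K A l) = carrier (simple_of l)"
    by (rule projective_coverD[OF proj_of_cover[OF assms] Irr_simple_of(3)[OF assms]]) blast
  obtain y where y: "y \<in> carrier (simple_of l)" "y \<noteq> \<zero>\<^bsub>simple_of l\<^esub>"
    by (rule simple_ex_nonzero[OF Irr_simple_of(3)[OF assms]])
  then obtain z where "z \<in> carrier (proj_of K A l)" "p z = y"
    using p(2) by (metis imageE)
  then show ?thesis
    unfolding hom_dim_def hlen_pos_iff[OF proj_of_projective(2)[OF assms] Irr_simple_of(4)[OF assms]]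
    using p(1) y(2) by blast
qed

lemma hlen_proj_simple:
  assumes l: "l \<in> Irr K A" and S: "fdmod S" "simple_lmod A S"
  shows "hlen (proj_of K A l) S = (if lmod_iso A S (simple_of l) then hom_dim l else 0)"
proof (cases "lmod_iso A S (simple_of l)")
  case True
  then show ?thesis
    using hlen_iso(1)[OF proj_of_projective(2)[OF l] S(1) Irr_simple_of(4)[OF l]] by (simp add: hom_dim_def)
next
  case False
  then have "\<not> hlen (proj_of K A l) S > 0"
    unfolding hlen_pos_iff[OF proj_of_projective(2)[OF l] S(1)]
    using projective_cover_hom_simple[OF proj_of_cover[OF l] Irr_simple_of(3)[OF l] S(2)] by blast
  then show ?thesis
    using False by simp
qed

text \<open>Hom(P(l), -) is exact and kills all simple modules except L(l), so it counts composition
  factors. As the left side involves no series, the multiplicity is independent of the chosen one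
  and invariant under isomorphism.\<close>

lemma hlen_proj_eq:
  assumes l: "l \<in> Irr K A" and M: "fdmod M"
  shows "hlen (proj_of K A l) M = hom_dim l * comp_mult A M (simple_of l)"
proof -
  let ?P = "proj_of K A l"
  have "hlen ?P (M\<lparr>carrier := carrier M\<rparr>) = hom_dim l * comp_mult A M (simple_of l)"
  proof (rule composition_series_count[OF M])
    show "hlen ?P (M\<lparr>carrier := {\<zero>\<^bsub>M\<^esub>}\<rparr>) = 0"
      by (rule hlen_trivial_right[OF proj_of_projective(2)[OF l] fdmod_zero_sub[OF M]]) simp
    fix N N' assume N: "submodule N A M" "submodule N' A M" "N \<subseteq> N'" and simple: "simple_lmod A (subquot M N' N)"
    obtain p where "fdmod (subquot M N' N)"
      by (rule subquot_fdmod[OF M N(2,1,3)]) blast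
    then show "hlen ?P (M\<lparr>carrier := N'\<rparr>) = hlen ?P (M\<lparr>carrier := N\<rparr>)
        + (if lmod_iso A (subquot M N' N) (simple_of l) then hom_dim l else 0)"
      using hlen_projective_subquot[OF proj_of_projective(1)[OF l] M N(2,1,3)] hlen_proj_simple[OF l _ simple]
      by simp
  qed
  then show ?thesis
    by simp
qed

lemma comp_mult_neq_0_iff:
  assumes l: "l \<in> Irr K A" and M: "fdmod M"
  shows "comp_mult A M (simple_of l) \<noteq> 0
    \<longleftrightarrow> (\<exists>f\<in>lmod_hom A (proj_of K A l) M. \<exists>x\<in>carrier (proj_of K A l). f x \<noteq> \<zero>\<^bsub>M\<^esub>)"
  using hlen_pos_iff[OF proj_of_projective(2)[OF l] M] hlen_proj_eq[OF l M] hom_dim_pos[OF l] by simp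

lemma comp_mult_iso:
  assumes l: "l \<in> Irr K A" and M: "fdmod M" and N: "fdmod N" and "lmod_iso A M N"
  shows "comp_mult A M (simple_of l) = comp_mult A N (simple_of l)"
  using hlen_iso(1)[OF proj_of_projective(2)[OF l] M N assms(4)] hlen_proj_eq[OF l M] hlen_proj_eq[OF l N]
    hom_dim_pos[OF l] by simp

text \<open>Positivity permits cancellation in the symmetry of the Cartan matrix and shows that P(l)
  is nonzero.\<close>

lemma comp_mult_proj_pos:
  assumes l: "l \<in> Irr K A"
  shows "comp_mult A (proj_of K A l) (simple_of l) > 0"
proof -
  note P = proj_of_projective[OF l]
  have "hlen (proj_of K A l) (simple_of l) > 0"
    using hom_dim_pos[OF l] by (simp add: hom_dim_def)
  then obtain f x where f: "f \<in> lmod_hom A (proj_of K A l) (simple_of l)" "x \<in> carrier (proj_of K A l)"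
    "f x \<noteq> \<zero>\<^bsub>simple_of l\<^esub>"
    using hlen_pos_iff[OF P(2) Irr_simple_of(4)[OF l]] by blast
  then have "x \<noteq> \<zero>\<^bsub>proj_of K A l\<^esub>"
    using lmod_hom_zero[OF P(3) simple_lmodD(1)[OF Irr_simple_of(3)[OF l]] f(1)] by auto
  then have "\<exists>f\<in>lmod_hom A (proj_of K A l) (proj_of K A l). \<exists>x\<in>carrier (proj_of K A l). f x \<noteq> \<zero>\<^bsub>proj_of K A l\<^esub>"
    using lmod_hom_id[OF P(3)] f(2) by (intro bexI[of _ "\<lambda>x\<in>carrier (proj_of K A l). x"] bexI[of _ x]) auto
  then show ?thesis
    using comp_mult_neq_0_iff[OF l P(2)] by simp
qed

text \<open>Every L(l) is a quotient of the generator \<open>F\<close>. Lifting a nonzero map from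
  P(l) along the projection shows that L(l) occurs in \<open>F\<close>; sending \<open>l\<close> to
  the position of such a factor in one fixed composition series is injective.\<close>

lemma finite_Irr: "finite (Irr K A)"
proof -
  obtain F b where F: "projective K A F" "b \<in> carrier F"
    and free: "\<And>(M :: ('a, 'k list) module) x. fdmod M \<Longrightarrow> x \<in> carrier M \<Longrightarrow> \<exists>f\<in>lmod_hom A F M. f b = x"
    using ex_projective_generator by blast
  note F' = projective_fdmod[OF F(1)]
  note F'' = fdmod_left_module[OF F']
  define Ns where "Ns = (SOME Ns. composition_series A F Ns)"
  have "\<exists>i<length Ns. lmod_iso A (subquot F (Ns ! Suc i) (Ns ! i)) (simple_of l) \<and> left_module A (subquot F (Ns ! Suc i) (Ns ! i))"
    if l: "l \<in> Irr K A" for l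
  proof -
    have "composition_series A F Ns"
      unfolding Ns_def by (rule composition_series_some[OF F'])
    then have lm: "left_module A (subquot F (Ns ! Suc i) (Ns ! i))" if "Suc i < length Ns" for i
      using that simple_lmodD(1) by (auto simp: composition_series_def)
    note L = Irr_simple_of[OF l]
    obtain x where x: "x \<in> carrier (simple_of l)" "x \<noteq> \<zero>\<^bsub>simple_of l\<^esub>"
      by (rule simple_ex_nonzero[OF L(3)])
    obtain q where q: "q \<in> lmod_hom A F (simple_of l)" "q b = x"
      using free[OF L(4) x(1)] by blast
    have surj: "q ` carrier F = carrier (simple_of l)"
      using hom_to_simple_surj[OF F'' L(3) q(1) F(2)] q(2) x(2) by simp
    have "hom_dim l > 0"
      by (rule hom_dim_pos[OF l])
    then obtain f y where f: "f \<in> lmod_hom A (proj_of K A l) (simple_of l)" "y \<in> carrier (proj_of K A l)"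
      "f y \<noteq> \<zero>\<^bsub>simple_of l\<^esub>"
      unfolding hom_dim_def hlen_pos_iff[OF proj_of_projective(2)[OF l] L(4)] by blast
    obtain h where h: "h \<in> lmod_hom A (proj_of K A l) F" "compose (carrier (proj_of K A l)) q h = f"
      by (rule projective_lift[OF proj_of_projective(1)[OF l] F' L(4) q(1) surj f(1)]) blast
    have "q (h y) \<noteq> \<zero>\<^bsub>simple_of l\<^esub>"
      using h(2) f(3) compose_eq[OF f(2), of q h] by simp
    then have "h y \<noteq> \<zero>\<^bsub>F\<^esub>"
      using lmod_hom_zero[OF F'' simple_lmodD(1)[OF L(3)] q(1)] by auto
    then have "comp_mult A F (simple_of l) \<noteq> 0"
      using comp_mult_neq_0_iff[OF l F'] h(1) f(2) by blast
    then have "{i. Suc i < length Ns \<and> lmod_iso A (subquot F (Ns ! Suc i) (Ns ! i)) (simple_of l)} \<noteq> {}"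
      unfolding comp_mult_def factor_count_def Ns_def by (metis card.empty)
    then show ?thesis
      using lm by fastforce
  qed
  then obtain i where i: "\<And>l. l \<in> Irr K A \<Longrightarrow> i l < length Ns"
    "\<And>l. l \<in> Irr K A \<Longrightarrow> lmod_iso A (subquot F (Ns ! Suc (i l)) (Ns ! i l)) (simple_of l)"
    "\<And>l. l \<in> Irr K A \<Longrightarrow> left_module A (subquot F (Ns ! Suc (i l)) (Ns ! i l))"
    by metis
  have "inj_on i (Irr K A)"
  proof (rule inj_onI)
    fix l m assume lm: "l \<in> Irr K A" "m \<in> Irr K A" "i l = i m"
    let ?S = "subquot F (Ns ! Suc (i l)) (Ns ! i l)"
    have "left_module A (simple_of l)"
      using simple_lmodD(1)[OF Irr_simple_of(3)[OF lm(1)]] .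
    then have "lmod_iso A (simple_of l) ?S"
      using lmod_iso_sym[OF i(3)[OF lm(1)] _ i(2)[OF lm(1)]] by simp
    then have "lmod_iso A (simple_of l) (simple_of m)"
      using lmod_iso_trans[OF \<open>left_module A (simple_of l)\<close>] i(2)[OF lm(2)] lm(3) by simp
    then show "l = m"
      by (rule Irr_eqI[OF lm(1,2)])
  qed
  moreover have "i ` Irr K A \<subseteq> {..<length Ns}"
    using i(1) by auto
  ultimately show ?thesis
    using finite_imageD finite_subset by blast
qed

end

section \<open>Standard modules\<close>

context fin_dim_algebra
begin

text \<open>The submodule contains the traces in P(l) of all P(m) with \<open>m\<close> not below
  \<open>l\<close>. Unlike a condition on multiplicities in quotients, this form is visibly stable
  under intersections.\<close>

definition trace_in :: "('a, 'k list) module set rel \<Rightarrow> ('a, 'k list) module set \<Rightarrow> 'k list set \<Rightarrow> bool" where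
  "trace_in r l N \<longleftrightarrow> (\<forall>m\<in>Irr K A. (m, l) \<notin> r \<longrightarrow>
     (\<forall>f\<in>lmod_hom A (proj_of K A m) (proj_of K A l). f ` carrier (proj_of K A m) \<subseteq> N))"

text \<open>L(m) occurs in the quotient exactly if there is a nonzero map to it from P(m), and such
  maps lift to P(l) by projectivity of P(m).\<close>

lemma trace_in_iff:
  assumes l: "l \<in> Irr K A" and N: "submodule N A (proj_of K A l)"
  shows "trace_in r l N \<longleftrightarrow>
    (\<forall>m\<in>Irr K A. comp_mult A (quot_module (proj_of K A l) N) (simple_of m) \<noteq> 0 \<longrightarrow> (m, l) \<in> r)"
proof -
  let ?P = "proj_of K A l"
  note P = proj_of_projective[OF l]
  let ?Q = "quot_module ?P N"
  note q = quot_module[OF P(3) N]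
  have Q: "fdmod ?Q"
    by (rule fdmod_quot[OF P(2) N])
  have mem: "quot_proj ?P N x \<noteq> \<zero>\<^bsub>?Q\<^esub> \<longleftrightarrow> x \<notin> N" if "x \<in> carrier ?P" for x
    using that q(4) unfolding lmod_ker_def by blast
  have "comp_mult A ?Q (simple_of m) \<noteq> 0 \<longleftrightarrow>
      \<not> (\<forall>f\<in>lmod_hom A (proj_of K A m) ?P. f ` carrier (proj_of K A m) \<subseteq> N)" if m: "m \<in> Irr K A" for m
  proof -
    let ?R = "proj_of K A m"
    note R = proj_of_projective[OF m]
    show ?thesis
      unfolding comp_mult_neq_0_iff[OF m Q]
    proof
      assume "\<exists>f\<in>lmod_hom A ?R ?Q. \<exists>x\<in>carrier ?R. f x \<noteq> \<zero>\<^bsub>?Q\<^esub>"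
      then obtain f x where f: "f \<in> lmod_hom A ?R ?Q" "x \<in> carrier ?R" "f x \<noteq> \<zero>\<^bsub>?Q\<^esub>"
        by metis
      obtain h where h: "h \<in> lmod_hom A ?R ?P" "compose (carrier ?R) (quot_proj ?P N) h = f"
        by (rule projective_lift[OF R(1) P(2) Q q(2,3) f(1)])
      have "quot_proj ?P N (h x) \<noteq> \<zero>\<^bsub>?Q\<^esub>"
        using h(2) f(3) compose_eq[OF f(2), of "quot_proj ?P N" h] by simp
      then have "h x \<notin> N"
        using mem[OF lmod_homD(1)[OF h(1) f(2)]] by simp
      then show "\<not> (\<forall>f\<in>lmod_hom A ?R ?P. f ` carrier ?R \<subseteq> N)"
        using h(1) f(2) by (metis image_subset_iff)
    next
      assume "\<not> (\<forall>f\<in>lmod_hom A ?R ?P. f ` carrier ?R \<subseteq> N)"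
      then obtain h x where h: "h \<in> lmod_hom A ?R ?P" "x \<in> carrier ?R" "h x \<notin> N"
        by (metis image_subset_iff)
      then have "compose (carrier ?R) (quot_proj ?P N) h x \<noteq> \<zero>\<^bsub>?Q\<^esub>"
        using mem[OF lmod_homD(1)[OF h(1,2)]] by (simp add: compose_eq)
      moreover have "compose (carrier ?R) (quot_proj ?P N) h \<in> lmod_hom A ?R ?Q"
        by (rule lmod_hom_compose[OF R(3) h(1) q(2)])
      ultimately show "\<exists>f\<in>lmod_hom A ?R ?Q. \<exists>x\<in>carrier ?R. f x \<noteq> \<zero>\<^bsub>?Q\<^esub>"
        using h(2) by metis
    qed
  qed
  then show ?thesis
    unfolding trace_in_def by metis
qed

definition std_kernel :: "('a, 'k list) module set rel \<Rightarrow> ('a, 'k list) module set \<Rightarrow> 'k list set" where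
  "std_kernel r l = \<Inter>{N. submodule N A (proj_of K A l) \<and> trace_in r l N}"

text \<open>The \<open>LEAST\<close> in \<open>standard_module\<close> has a known value only once a
  least submodule is exhibited. It is the intersection of all candidates, a family that contains the
  whole of P(l).\<close>

lemma std_kernel:
  assumes l: "l \<in> Irr K A"
  shows "submodule (std_kernel r l) A (proj_of K A l)" "trace_in r l (std_kernel r l)"
    "\<And>N. submodule N A (proj_of K A l) \<Longrightarrow> trace_in r l N \<Longrightarrow> std_kernel r l \<subseteq> N"
    "standard_module K A r l = quot_module (proj_of K A l) (std_kernel r l)"
proof -
  let ?P = "proj_of K A l"
  note P = proj_of_projective[OF l]
  let ?T = "{N. submodule N A ?P \<and> trace_in r l N}"
  have carr: "submodule (carrier ?P) A ?P"
    by (rule carrier_submodule[OF P(3)])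
  have "f ` carrier (proj_of K A m) \<subseteq> carrier ?P" if "f \<in> lmod_hom A (proj_of K A m) ?P" for f m
    using lmod_homD(1)[OF that] by (simp add: image_subset_iff)
  then have "carrier ?P \<in> ?T"
    using carr by (simp add: trace_in_def)
  then show sub: "submodule (std_kernel r l) A ?P"
    unfolding std_kernel_def by (intro submodule_Int[OF left_module_abelian_group[OF P(3)] carr]) auto
  show tr: "trace_in r l (std_kernel r l)"
    unfolding std_kernel_def trace_in_def by (simp add: le_Inf_iff)
  show least: "std_kernel r l \<subseteq> N" if "submodule N A ?P" "trace_in r l N" for N
    using that unfolding std_kernel_def by (intro Inter_lower) simp
  have "(LEAST N. submodule N A ?P \<and>
          (\<forall>m\<in>Irr K A. comp_mult A (quot_module ?P N) (simple_of m) \<noteq> 0 \<longrightarrow> (m, l) \<in> r)) = std_kernel r l"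
  proof (rule Least_equality)
    show "submodule (std_kernel r l) A ?P \<and>
        (\<forall>m\<in>Irr K A. comp_mult A (quot_module ?P (std_kernel r l)) (simple_of m) \<noteq> 0 \<longrightarrow> (m, l) \<in> r)"
      using sub tr trace_in_iff[OF l sub] by simp
    fix N assume "submodule N A ?P \<and>
        (\<forall>m\<in>Irr K A. comp_mult A (quot_module ?P N) (simple_of m) \<noteq> 0 \<longrightarrow> (m, l) \<in> r)"
    then show "std_kernel r l \<subseteq> N"
      using least trace_in_iff[OF l, of N r] by simp
  qed
  then show "standard_module K A r l = quot_module ?P (std_kernel r l)"
    by (simp add: standard_module_def)
qed

lemma standard_fdmod:
  assumes "l \<in> Irr K A"
  shows "fdmod (standard_module K A r l)"
  unfolding std_kernel(4)[OF assms]
  by (rule fdmod_quot[OF proj_of_projective(2)[OF assms] std_kernel(1)[OF assms]])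

lemma standard_mult_le:
  assumes l: "l \<in> Irr K A" and m: "m \<in> Irr K A"
    and "comp_mult A (standard_module K A r l) (simple_of m) \<noteq> 0"
  shows "(m, l) \<in> r"
  using assms trace_in_iff[OF l std_kernel(1)[OF l]] std_kernel(2,4)[OF l] by metis

text \<open>If the multiplicities agree, each of the two defining submodules satisfies the condition
  of the other, so they contain each other. The conclusion is an equality and not just an
  isomorphism, as both are quotients of the same P(l).\<close>

lemma standard_module_eqI:
  assumes l: "l \<in> Irr K A"
    and eq: "\<And>m. m \<in> Irr K A \<Longrightarrow> comp_mult A (standard_module K A r l) (simple_of m)
        = comp_mult A (standard_module K A s l) (simple_of m)"
  shows "standard_module K A r l = standard_module K A s l"
proof -
  have "trace_in s l (std_kernel r l)"
    using trace_in_iff[OF l std_kernel(1)[OF l]] std_kernel(4)[OF l] eq standard_mult_le[OF l] by metis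
  moreover have "trace_in r l (std_kernel s l)"
    using trace_in_iff[OF l std_kernel(1)[OF l]] std_kernel(4)[OF l] eq standard_mult_le[OF l] by metis
  ultimately have "std_kernel r l = std_kernel s l"
    using std_kernel(1,3)[OF l] by (metis subset_antisym)
  then show ?thesis
    by (simp add: std_kernel(4)[OF l])
qed

text \<open>The constituent of each label in its own standard module makes the two labels comparable
  both ways. It is needed because factors of a filtration are counted up to isomorphism.\<close>

lemma standard_iso_eqI:
  assumes anti: "antisym r" and l: "l \<in> Irr K A" and m: "m \<in> Irr K A"
    and one: "\<And>l. l \<in> Irr K A \<Longrightarrow> comp_mult A (standard_module K A r l) (simple_of l) = 1"
    and iso: "lmod_iso A (standard_module K A r l) (standard_module K A r m)"
  shows "l = m"
proof -
  have "comp_mult A (standard_module K A r l) (simple_of n) = comp_mult A (standard_module K A r m) (simple_of n)"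
    if "n \<in> Irr K A" for n
    by (rule comp_mult_iso[OF that standard_fdmod[OF l] standard_fdmod[OF m] iso])
  then have "(m, l) \<in> r" "(l, m) \<in> r"
    using standard_mult_le[OF l m] standard_mult_le[OF m l] one l m by force+
  then show ?thesis
    using anti by (simp add: antisym_def)
qed

text \<open>This is the factorization \<open>c = p d\<close>. The dimension of Hom(P(n), -) is added
  up along the filtration; the \<open>i\<close>-th factor has a unique label \<open>\<mu> i\<close>,
  and the sum is regrouped by labels.\<close>

lemma standard_filtration_mult:
  assumes anti: "antisym r" and l: "l \<in> Irr K A" and n: "n \<in> Irr K A"
    and one: "\<And>l. l \<in> Irr K A \<Longrightarrow> comp_mult A (standard_module K A r l) (simple_of l) = 1"
    and Ns: "standard_filtration K A r l Ns"
  shows "comp_mult A (proj_of K A l) (simple_of n) =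
    (\<Sum>m\<in>Irr K A. factor_count A (proj_of K A l) Ns (standard_module K A r m)
       * comp_mult A (standard_module K A r m) (simple_of n))"
proof -
  let ?P = "proj_of K A l" and ?R = "proj_of K A n"
  note P = proj_of_projective[OF l] and R = proj_of_projective[OF n]
  let ?S = "\<lambda>i. subquot ?P (Ns ! Suc i) (Ns ! i)" and ?I = "{i. Suc i < length Ns}"
  let ?D = "\<lambda>m. standard_module K A r m"
  have fil: "filtration A ?P Ns" and ex: "\<forall>i. Suc i < length Ns \<longrightarrow> (\<exists>m\<in>Irr K A. lmod_iso A (?S i) (?D m))"
    using Ns unfolding standard_filtration_def by metis+
  have sub: "submodule (Ns ! i) A ?P" if "i < length Ns" for i
    using fil that by (simp add: filtration_def)
  have inc: "Ns ! i \<subseteq> Ns ! Suc i" if "Suc i < length Ns" for i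
    using fil that by (simp add: filtration_def)
  have S: "fdmod (?S i)" if i: "Suc i < length Ns" for i
    by (rule subquot_fdmod[OF P(2) sub sub inc[OF i]]) (use i in auto)
  obtain \<mu> where \<mu>: "\<And>i. Suc i < length Ns \<Longrightarrow> \<mu> i \<in> Irr K A"
    "\<And>i. Suc i < length Ns \<Longrightarrow> lmod_iso A (?S i) (?D (\<mu> i))"
    using ex by metis
  have \<mu>_iff: "\<mu> i = m \<longleftrightarrow> lmod_iso A (?S i) (?D m)" if i: "Suc i < length Ns" and m: "m \<in> Irr K A" for i m
  proof
    assume iso: "lmod_iso A (?S i) (?D m)"
    note lm = fdmod_left_module[OF S[OF i]] fdmod_left_module[OF standard_fdmod[OF \<mu>(1)[OF i], of r]]
    have *: "lmod_iso A (?D (\<mu> i)) (?D m)"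
      by (rule lmod_iso_trans[OF lm(2) lmod_iso_sym[OF lm \<mu>(2)[OF i]] iso])
    show "\<mu> i = m"
      by (rule standard_iso_eqI[OF anti \<mu>(1)[OF i] m _ *]) (rule one)
  qed (use \<mu>(2)[OF i] in simp)
  have fin: "finite ?I"
    by (rule finite_subset[of _ "{..<length Ns}"]) auto
  have count: "factor_count A ?P Ns (?D m) = card {i \<in> ?I. \<mu> i = m}" if "m \<in> Irr K A" for m
    using \<mu>_iff[OF _ that] unfolding factor_count_def by (intro arg_cong[of _ _ card]) auto
  have "hlen ?R (?P\<lparr>carrier := carrier ?P\<rparr>) = (\<Sum>i | Suc i < length Ns. hlen ?R (?S i))"
  proof (rule filtration_sum[OF fil])
    show "hlen ?R (?P\<lparr>carrier := {\<zero>\<^bsub>?P\<^esub>}\<rparr>) = 0"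
      by (rule hlen_trivial_right[OF R(2) fdmod_zero_sub[OF P(2)]]) simp
    show "hlen ?R (?P\<lparr>carrier := Ns ! Suc i\<rparr>) = hlen ?R (?P\<lparr>carrier := Ns ! i\<rparr>) + hlen ?R (?S i)"
      if "Suc i < length Ns" for i
      by (rule hlen_projective_subquot[OF R(1) P(2) sub sub inc[OF that]]) (use that in auto)
  qed
  also have "\<dots> = (\<Sum>i | Suc i < length Ns. hom_dim n * comp_mult A (?D (\<mu> i)) (simple_of n))"
  proof (rule sum.cong)
    fix i assume "i \<in> ?I"
    then have i: "Suc i < length Ns"
      by simp
    show "hlen ?R (?S i) = hom_dim n * comp_mult A (?D (\<mu> i)) (simple_of n)"
      using hlen_iso(1)[OF R(2) S[OF i] standard_fdmod[OF \<mu>(1)[OF i]] \<mu>(2)[OF i]]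
        hlen_proj_eq[OF n standard_fdmod[OF \<mu>(1)[OF i]]] by simp
  qed simp
  also have "\<dots> = hom_dim n * (\<Sum>i\<in>?I. comp_mult A (?D (\<mu> i)) (simple_of n))"
    by (simp add: sum_distrib_left)
  also have "(\<Sum>i\<in>?I. comp_mult A (?D (\<mu> i)) (simple_of n))
      = (\<Sum>m\<in>Irr K A. \<Sum>i | i \<in> ?I \<and> \<mu> i = m. comp_mult A (?D (\<mu> i)) (simple_of n))"
    by (rule sum.group[OF fin finite_Irr, symmetric]) (use \<mu>(1) in auto)
  also have "\<dots> = (\<Sum>m\<in>Irr K A. factor_count A ?P Ns (?D m) * comp_mult A (?D m) (simple_of n))"
    by (rule sum.cong) (simp_all add: count)
  finally show ?thesis
    using hlen_proj_eq[OF n P(2)] hom_dim_pos[OF n] by simp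
qed

text \<open>A counted factor has two labels: \<open>m\<close>, and the \<open>m'\<close> above
  \<open>l\<close> that the filtration supplies. They agree because standard modules with different
  labels are not isomorphic.\<close>

lemma standard_filtration_le:
  assumes anti: "antisym r" and l: "l \<in> Irr K A" and m: "m \<in> Irr K A"
    and one: "\<And>l. l \<in> Irr K A \<Longrightarrow> comp_mult A (standard_module K A r l) (simple_of l) = 1"
    and Ns: "standard_filtration K A r l Ns"
    and "factor_count A (proj_of K A l) Ns (standard_module K A r m) \<noteq> 0"
  shows "(l, m) \<in> r"
proof -
  let ?P = "proj_of K A l"
  note P = proj_of_projective[OF l]
  let ?S = "\<lambda>i. subquot ?P (Ns ! Suc i) (Ns ! i)"
  have "{i. Suc i < length Ns \<and> lmod_iso A (?S i) (standard_module K A r m)} \<noteq> {}"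
    using assms(6) unfolding factor_count_def by (metis card.empty)
  then obtain i where i: "Suc i < length Ns" "lmod_iso A (?S i) (standard_module K A r m)"
    by auto
  obtain m' where m': "m' \<in> Irr K A" "(l, m') \<in> r" "lmod_iso A (?S i) (standard_module K A r m')"
    using Ns i(1) unfolding standard_filtration_def by metis
  have fil: "filtration A ?P Ns"
    using Ns by (simp add: standard_filtration_def)
  have S: "fdmod (?S i)"
    by (rule subquot_fdmod[OF P(2), of "Ns ! Suc i" "Ns ! i"]) (use fil i(1) in \<open>auto simp: filtration_def\<close>)
  note lm = fdmod_left_module[OF S] fdmod_left_module[OF standard_fdmod[OF m'(1), of r]]
  have *: "lmod_iso A (standard_module K A r m') (standard_module K A r m)"
    by (rule lmod_iso_trans[OF lm(2) lmod_iso_sym[OF lm m'(3)] i(2)])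
  have "m' = m"
    by (rule standard_iso_eqI[OF anti m'(1) m _ *]) (rule one)
  then show ?thesis
    using m'(2) by simp
qed

text \<open>The top factor of a standard filtration of \<open>P(l)\<close> has top \<open>L(l)\<close>, hence is \<open>\<Delta>(l)\<close>.\<close>

lemma standard_filtration_top:
  assumes l: "l \<in> Irr K A"
    and one: "\<And>l. l \<in> Irr K A \<Longrightarrow> comp_mult A (standard_module K A r l) (simple_of l) = 1"
    and Ns: "standard_filtration K A r l Ns"
  shows "factor_count A (proj_of K A l) Ns (standard_module K A r l) \<noteq> 0"
proof -
  let ?P = "proj_of K A l"
  note P = proj_of_projective[OF l]
  have fil: "filtration A ?P Ns"
    using Ns by (simp add: standard_filtration_def)
  have ne: "carrier ?P \<noteq> {\<zero>\<^bsub>?P\<^esub>}"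
  proof
    assume "carrier ?P = {\<zero>\<^bsub>?P\<^esub>}"
    then have "hlen ?P ?P = 0"
      by (rule hlen_trivial_left[OF P(2,2)])
    then show False
      using hlen_proj_eq[OF l P(2)] hom_dim_pos[OF l] comp_mult_proj_pos[OF l] by simp
  qed
  have D: "Ns \<noteq> []" "hd Ns = {\<zero>\<^bsub>?P\<^esub>}" "last Ns = carrier ?P"
    using fil by (auto simp: filtration_def)
  have "length Ns \<noteq> 1"
  proof
    assume "length Ns = 1"
    then have "hd Ns = last Ns"
      by (cases Ns) auto
    then show False
      using D ne by simp
  qed
  then have "length Ns \<ge> 2"
    using D(1) by (cases Ns; cases "tl Ns") auto
  \<comment> \<open>The index of the last factor, P(l) modulo the last but one member. It exists
    because P(l) is nonzero, so the filtration has at least two members.\<close>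
  define i where "i = length Ns - 2"
  have i: "Suc i < length Ns" "Ns ! Suc i = carrier ?P"
    using \<open>length Ns \<ge> 2\<close> D(1,3) by (auto simp: i_def last_conv_nth numeral_2_eq_2 Suc_diff_Suc)
  let ?S = "subquot ?P (Ns ! Suc i) (Ns ! i)"
  obtain m where m: "m \<in> Irr K A" "lmod_iso A ?S (standard_module K A r m)"
    using Ns i(1) unfolding standard_filtration_def by metis
  let ?Q = "standard_module K A r m" and ?R = "proj_of K A m"
  note R = proj_of_projective[OF m(1)]
  have Q: "fdmod ?Q"
    by (rule standard_fdmod[OF m(1)])
  have sN: "submodule (Ns ! i) A ?P" "submodule (Ns ! Suc i) A ?P" "Ns ! i \<subseteq> Ns ! Suc i"
    using fil i(1) by (auto simp: filtration_def)
  obtain q where q: "fdmod ?S" "q \<in> lmod_hom A (?P\<lparr>carrier := Ns ! Suc i\<rparr>) ?S" "q ` (Ns ! Suc i) = carrier ?S"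
    by (rule subquot_fdmod[OF P(2) sN(2,1,3)])
  have q': "q \<in> lmod_hom A ?P ?S" "q ` carrier ?P = carrier ?S"
    using q(2,3) unfolding i(2) by simp_all
  obtain t where t: "t \<in> lmod_hom A ?S ?Q" "t ` carrier ?S = carrier ?Q"
    using m(2) unfolding lmod_iso_def bij_betw_def by metis
  obtain p where p: "p \<in> lmod_hom A ?R (simple_of m)" "p ` carrier ?R = carrier (simple_of m)"
    "\<And>N. submodule N A ?R \<Longrightarrow> \<not> N \<subseteq> lmod_ker ?R (simple_of m) p \<Longrightarrow> N = carrier ?R"
    by (rule projective_coverD[OF proj_of_cover[OF m(1)] Irr_simple_of(3)[OF m(1)]]) blast
  note k = std_kernel[OF m(1), where r = r]
  note qm = quot_module[OF R(3) k(1)]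
  have L: "left_module A (simple_of m)"
    by (rule simple_lmodD(1)[OF Irr_simple_of(3)[OF m(1)]])
  \<comment> \<open>Otherwise \<open>\<Delta>(m)\<close> would be zero, against
    \<open>[\<Delta>(m) : L(m)] = 1\<close>. Being proper, the kernel lies in that of the cover of
    L(m), so \<open>\<Delta>(m)\<close> maps onto L(m).\<close>
  have "std_kernel r m \<noteq> carrier ?R"
  proof
    assume eq: "std_kernel r m = carrier ?R"
    have "carrier ?Q \<subseteq> {\<zero>\<^bsub>?Q\<^esub>}"
    proof
      fix y assume "y \<in> carrier ?Q"
      then obtain x where x: "x \<in> carrier ?R" "quot_proj ?R (std_kernel r m) x = y"
        using qm(3) unfolding k(4) by (metis imageE)
      then show "y \<in> {\<zero>\<^bsub>?Q\<^esub>}"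
        using qm(4) eq unfolding k(4) lmod_ker_def by auto
    qed
    then have triv: "carrier ?Q = {\<zero>\<^bsub>?Q\<^esub>}"
      using submoduleD(2)[OF left_module_abelian_group carrier_submodule, of A ?Q] fdmod_left_module[OF Q] by auto
    have "hlen ?R ?Q = 0"
      by (rule hlen_trivial_right[OF R(2) Q triv])
    then show False
      using hlen_proj_eq[OF m(1) Q] one[OF m(1)] hom_dim_pos[OF m(1)] by simp
  qed
  then have "std_kernel r m \<subseteq> lmod_ker ?R (simple_of m) p"
    using p(3)[OF k(1)] by metis
  then have "lmod_ker ?R (quot_module ?R (std_kernel r m)) (quot_proj ?R (std_kernel r m))
      \<subseteq> lmod_ker ?R (simple_of m) p"
    using qm(4) by simp
  then obtain w where w: "w \<in> lmod_hom A ?Q (simple_of m)" "compose (carrier ?R) w (quot_proj ?R (std_kernel r m)) = p"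
    using lmod_hom_factor[OF R(3) qm(1) L qm(2,3) p(1)] unfolding k(4) by metis
  \<comment> \<open>The composite of P(l) onto the top factor, its isomorphism with
    \<open>\<Delta>(m)\<close>, and the map onto L(m). It is nonzero, which forces
    \<open>m = l\<close>.\<close>
  define f where "f = compose (carrier ?P) w (compose (carrier ?P) t q)"
  have f: "f \<in> lmod_hom A ?P (simple_of m)"
    unfolding f_def by (intro lmod_hom_compose[OF P(3) _ w(1)] lmod_hom_compose[OF P(3) q'(1) t(1)])
  obtain y where y: "y \<in> carrier (simple_of m)" "y \<noteq> \<zero>\<^bsub>simple_of m\<^esub>"
    by (rule simple_ex_nonzero[OF Irr_simple_of(3)[OF m(1)]])
  obtain z where z: "z \<in> carrier ?R" "p z = y"
    using y(1) p(2) by (metis imageE)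
  have wz: "w (quot_proj ?R (std_kernel r m) z) = y"
    using w(2) z compose_eq[OF z(1), of w] by metis
  have "quot_proj ?R (std_kernel r m) z \<in> t ` carrier ?S"
    using lmod_homD(1)[OF qm(2) z(1)] k(4) t(2) by simp
  then obtain s where s: "quot_proj ?R (std_kernel r m) z = t s" "s \<in> carrier ?S"
    by (rule imageE)
  have "s \<in> q ` carrier ?P"
    using s(2) q'(2) by simp
  then obtain x where x: "s = q x" "x \<in> carrier ?P"
    by (rule imageE)
  have "f x \<noteq> \<zero>\<^bsub>simple_of m\<^esub>"
    using x(2) wz y(2) unfolding s(1) x(1) by (simp add: f_def compose_eq)
  then have "lmod_iso A (simple_of m) (simple_of l)"
    by (rule projective_cover_hom_simple[OF proj_of_cover[OF l] Irr_simple_of(3)[OF l]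
          Irr_simple_of(3)[OF m(1)] f x(2)])
  then have "m = l"
    by (rule Irr_eqI[OF m(1) l])
  then have "i \<in> {i. Suc i < length Ns \<and> lmod_iso A (subquot ?P (Ns ! Suc i) (Ns ! i)) (standard_module K A r l)}"
    using i(1) m(2) by simp
  moreover have "finite {i. Suc i < length Ns \<and> lmod_iso A (subquot ?P (Ns ! Suc i) (Ns ! i)) (standard_module K A r l)}"
    by (rule finite_subset[of _ "{..<length Ns}"]) auto
  ultimately have "card {i. Suc i < length Ns \<and> lmod_iso A (subquot ?P (Ns ! Suc i) (Ns ! i)) (standard_module K A r l)} \<noteq> 0"
    using card_0_eq by blast
  then show ?thesis
    by (simp add: factor_count_def)
qed

end

lemma image_eqE:
  assumes "f ` S = T" and "y \<in> T"
  obtains x where "x \<in> S" "f x = y"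
  using assms by blast

section \<open>Simple-preserving dualities\<close>

locale simple_preserving_duality = fin_dim_algebra K A
  for K :: "'k ring" and A :: "('k, 'a) module" +
  fixes D :: "('a, 'k list) module \<Rightarrow> ('a, 'k list) module"
    and Dm :: "('a, 'k list) module \<Rightarrow> ('a, 'k list) module \<Rightarrow> ('k list \<Rightarrow> 'k list) \<Rightarrow> ('k list \<Rightarrow> 'k list)"
  assumes autoequivalence: "contravariant_autoequivalence K A D Dm"
    and involutive: "involutive_functor K A D Dm"
    and preserves_simple: "l \<in> Irr K A \<Longrightarrow> lmod_iso A (D (simple_of l)) (simple_of l)"
begin

lemma contravariant: "contravariant_functor K A D Dm"
  using autoequivalence by (simp add: contravariant_autoequivalence_def)

lemma D_amod: "M \<in> amod K A \<Longrightarrow> D M \<in> amod K A"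
  using contravariant by (simp add: contravariant_functor_def)

lemma D_fdmod: "M \<in> amod K A \<Longrightarrow> fdmod (D M)"
  using D_amod by (simp add: amod_iff)

lemma amod_left_module: "M \<in> amod K A \<Longrightarrow> left_module A M"
  by (simp add: amod_iff fdmod_left_module)

lemma D_left_module: "M \<in> amod K A \<Longrightarrow> left_module A (D M)"
  using D_amod amod_left_module by simp

lemma Dm_hom:
  assumes "M \<in> amod K A" and "N \<in> amod K A" and "f \<in> lmod_hom A M N"
  shows "Dm M N f \<in> lmod_hom A (D N) (D M)"
  using contravariant assms by (simp add: contravariant_functor_def)

lemma Dm_compose:
  assumes "L \<in> amod K A" and "M \<in> amod K A" and "N \<in> amod K A"
    and "f \<in> lmod_hom A L M" and "g \<in> lmod_hom A M N"
  shows "Dm L N (compose (carrier L) g f) = compose (carrier (D N)) (Dm L M f) (Dm M N g)"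
  using contravariant assms by (simp add: contravariant_functor_def)

lemma Dm_bij:
  assumes "M \<in> amod K A" and "N \<in> amod K A"
  shows "bij_betw (Dm M N) (lmod_hom A M N) (lmod_hom A (D N) (D M))"
  using autoequivalence assms by (simp add: contravariant_autoequivalence_def)

lemma Dm_inj:
  assumes "M \<in> amod K A" and "N \<in> amod K A" and "f \<in> lmod_hom A M N" and "g \<in> lmod_hom A M N"
    and "Dm M N f = Dm M N g"
  shows "f = g"
  using bij_betw_imp_inj_on[OF Dm_bij[OF assms(1,2)]] assms(3-5) by (simp add: inj_on_def)

lemma Dm_surj:
  assumes "M \<in> amod K A" and "N \<in> amod K A" and "g \<in> lmod_hom A (D N) (D M)"
  obtains f where "f \<in> lmod_hom A M N" "Dm M N f = g"
  using bij_betw_imp_surj_on[OF Dm_bij[OF assms(1,2)]] assms(3) by (metis imageE)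

lemma ex_D_iso:
  assumes X: "X \<in> amod K A"
  obtains R s t where "R \<in> amod K A" "s \<in> lmod_hom A (D R) X" "t \<in> lmod_hom A X (D R)"
    "\<And>x. x \<in> carrier X \<Longrightarrow> s (t x) = x" "\<And>y. y \<in> carrier (D R) \<Longrightarrow> t (s y) = y"
proof -
  obtain R where R: "R \<in> amod K A" "lmod_iso A (D R) X"
    using autoequivalence X unfolding contravariant_autoequivalence_def by metis
  obtain s where s: "s \<in> lmod_hom A (D R) X" "bij_betw s (carrier (D R)) (carrier X)"
    using R(2) unfolding lmod_iso_def by metis
  obtain t where "t \<in> lmod_hom A X (D R)" "\<And>y. y \<in> carrier (D R) \<Longrightarrow> t (s y) = y"
    "\<And>x. x \<in> carrier X \<Longrightarrow> s (t x) = x"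
    by (rule lmod_hom_inverse[OF D_left_module[OF R(1)] amod_left_module[OF X] s]) blast
  then show ?thesis
    using that R(1) s(1) by metis
qed

lemma D_trivial:
  assumes Z: "Z \<in> amod K A" and triv: "carrier Z = {\<zero>\<^bsub>Z\<^esub>}"
  shows "carrier (D Z) = {\<zero>\<^bsub>D Z\<^esub>}"
proof -
  note Z' = amod_left_module[OF Z] and DZ = D_left_module[OF Z]
  have uniq: "f = g" if "f \<in> lmod_hom A Z Z" "g \<in> lmod_hom A Z Z" for f g
  proof (rule lmod_hom_eqI[OF that])
    fix x assume "x \<in> carrier Z"
    then have "f x \<in> carrier Z" "g x \<in> carrier Z"
      using lmod_homD(1)[OF that(1)] lmod_homD(1)[OF that(2)] by auto
    then show "f x = g x"
      using triv by simp
  qed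
  obtain f where f: "f \<in> lmod_hom A Z Z" "Dm Z Z f = (\<lambda>x\<in>carrier (D Z). x)"
    by (rule Dm_surj[OF Z Z lmod_hom_id[OF DZ]])
  obtain g where g: "g \<in> lmod_hom A Z Z" "Dm Z Z g = (\<lambda>x\<in>carrier (D Z). \<zero>\<^bsub>D Z\<^esub>)"
    by (rule Dm_surj[OF Z Z zero_lmod_hom[OF DZ DZ]])
  have "(\<lambda>x\<in>carrier (D Z). x) = (\<lambda>x\<in>carrier (D Z). \<zero>\<^bsub>D Z\<^esub>)"
    using uniq[OF f(1) g(1)] f(2) g(2) by simp
  then have eq: "x = \<zero>\<^bsub>D Z\<^esub>" if "x \<in> carrier (D Z)" for x
    using that by (metis restrict_apply')
  have "\<zero>\<^bsub>D Z\<^esub> \<in> carrier (D Z)"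
    by (rule submoduleD(2)[OF left_module_abelian_group[OF DZ] carrier_submodule[OF DZ]])
  then show ?thesis
    by (intro equalityI subsetI singletonI) (simp_all only: singleton_iff eq)
qed

text \<open>A zero map factors through a zero module, and \<open>D\<close> preserves zero
  modules.\<close>

lemma Dm_zero:
  assumes M: "M \<in> amod K A" and N: "N \<in> amod K A"
  shows "Dm M N (\<lambda>x\<in>carrier M. \<zero>\<^bsub>N\<^esub>) = (\<lambda>x\<in>carrier (D N). \<zero>\<^bsub>D M\<^esub>)"
proof -
  note M' = amod_left_module[OF M] and N' = amod_left_module[OF N]
  define Z where "Z = M\<lparr>carrier := {\<zero>\<^bsub>M\<^esub>}\<rparr>"
  have Z: "Z \<in> amod K A"
    using fdmod_zero_sub[of M] M by (simp add: Z_def amod_iff)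
  note Z' = amod_left_module[OF Z]
  have triv: "carrier Z = {\<zero>\<^bsub>Z\<^esub>}"
    by (simp add: Z_def)
  note zMZ = zero_lmod_hom[OF M' Z'] and zZN = zero_lmod_hom[OF Z' N']
  have "compose (carrier M) (\<lambda>x\<in>carrier Z. \<zero>\<^bsub>N\<^esub>) (\<lambda>x\<in>carrier M. \<zero>\<^bsub>Z\<^esub>) = (\<lambda>x\<in>carrier M. \<zero>\<^bsub>N\<^esub>)"
    using triv by (auto simp: compose_def fun_eq_iff restrict_def)
  then have eq: "Dm M N (\<lambda>x\<in>carrier M. \<zero>\<^bsub>N\<^esub>)
      = compose (carrier (D N)) (Dm M Z (\<lambda>x\<in>carrier M. \<zero>\<^bsub>Z\<^esub>)) (Dm Z N (\<lambda>x\<in>carrier Z. \<zero>\<^bsub>N\<^esub>))"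
    using Dm_compose[OF M Z N zMZ zZN] by simp
  note h1 = Dm_hom[OF M Z zMZ] and h2 = Dm_hom[OF Z N zZN]
  show ?thesis
  proof (rule lmod_hom_eqI[OF Dm_hom[OF M N zero_lmod_hom[OF M' N']]
        zero_lmod_hom[OF D_left_module[OF N] D_left_module[OF M]]])
    fix x assume x: "x \<in> carrier (D N)"
    have "Dm Z N (\<lambda>x\<in>carrier Z. \<zero>\<^bsub>N\<^esub>) x = \<zero>\<^bsub>D Z\<^esub>"
      using lmod_homD(1)[OF h2 x] D_trivial[OF Z triv] by auto
    then show "Dm M N (\<lambda>x\<in>carrier M. \<zero>\<^bsub>N\<^esub>) x = (\<lambda>x\<in>carrier (D N). \<zero>\<^bsub>D M\<^esub>) x"
      using x lmod_hom_zero[OF D_left_module[OF Z] D_left_module[OF M] h1] by (simp add: eq compose_eq)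
  qed
qed

lemma zero_hom_iff:
  assumes "left_module A M" and "left_module A N" and "f \<in> lmod_hom A M N"
  shows "f = (\<lambda>x\<in>carrier M. \<zero>\<^bsub>N\<^esub>) \<longleftrightarrow> (\<forall>x\<in>carrier M. f x = \<zero>\<^bsub>N\<^esub>)"
proof
  assume "\<forall>x\<in>carrier M. f x = \<zero>\<^bsub>N\<^esub>"
  then show "f = (\<lambda>x\<in>carrier M. \<zero>\<^bsub>N\<^esub>)"
    by (intro lmod_hom_eqI[OF assms(3) zero_lmod_hom[OF assms(1,2)]]) simp
qed simp

lemma Dm_eq_zero_iff:
  assumes M: "M \<in> amod K A" and N: "N \<in> amod K A" and f: "f \<in> lmod_hom A M N"
  shows "(\<forall>x\<in>carrier (D N). Dm M N f x = \<zero>\<^bsub>D M\<^esub>) \<longleftrightarrow> (\<forall>x\<in>carrier M. f x = \<zero>\<^bsub>N\<^esub>)"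
proof -
  note M' = amod_left_module[OF M] and N' = amod_left_module[OF N]
  have "Dm M N f = (\<lambda>x\<in>carrier (D N). \<zero>\<^bsub>D M\<^esub>) \<longleftrightarrow> f = (\<lambda>x\<in>carrier M. \<zero>\<^bsub>N\<^esub>)"
    using Dm_zero[OF M N] Dm_inj[OF M N f zero_lmod_hom[OF M' N']] by metis
  then show ?thesis
    using zero_hom_iff[OF M' N' f] zero_hom_iff[OF D_left_module[OF N] D_left_module[OF M] Dm_hom[OF M N f]]
    by simp
qed

text \<open>The inclusion of the kernel of a dual homomorphism is, up to an isomorphism, itself a dual. This is how
  exactness of \<open>D\<close> is derived below from its being full, faithful and essentially surjective.\<close>

lemma hom_into_D:
  assumes X: "X \<in> amod K A" and M: "M \<in> amod K A" and j: "j \<in> lmod_hom A X (D M)"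
  obtains R t u where "R \<in> amod K A" "t \<in> lmod_hom A X (D R)" "u \<in> lmod_hom A M R"
    "t ` carrier X = carrier (D R)" "\<And>x. x \<in> carrier X \<Longrightarrow> j x = Dm M R u (t x)"
proof -
  obtain R s t where R: "R \<in> amod K A" "s \<in> lmod_hom A (D R) X" "t \<in> lmod_hom A X (D R)"
    "\<And>x. x \<in> carrier X \<Longrightarrow> s (t x) = x" "\<And>y. y \<in> carrier (D R) \<Longrightarrow> t (s y) = y"
    by (rule ex_D_iso[OF X]) blast
  obtain u where u: "u \<in> lmod_hom A M R" "Dm M R u = compose (carrier (D R)) j s"
    by (rule Dm_surj[OF M R(1) lmod_hom_compose[OF D_left_module[OF R(1)] R(2) j]])
  have "j x = Dm M R u (t x)" if "x \<in> carrier X" for x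
    using u(2) R(4)[OF that] compose_eq[OF lmod_homD(1)[OF R(3) that], of j s] by simp
  moreover have "t ` carrier X = carrier (D R)"
    using R(5) lmod_homD(1)[OF R(2)] lmod_homD(1)[OF R(3)] by (force simp: image_iff)
  ultimately show ?thesis
    using that R(1,3) u(1) by metis
qed

text \<open>The inclusion of the kernel of \<open>D f\<close> is the dual of some \<open>u\<close>
  up to isomorphism. Then \<open>D (u f) = D f D u = 0\<close> gives \<open>u f = 0\<close>,
  surjectivity of \<open>f\<close> gives \<open>u = 0\<close>, and the kernel vanishes.\<close>

lemma Dm_of_surj:
  assumes M: "M \<in> amod K A" and N: "N \<in> amod K A" and f: "f \<in> lmod_hom A M N"
    and surj: "f ` carrier M = carrier N"
  shows "inj_on (Dm M N f) (carrier (D N))"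
proof -
  note M' = amod_left_module[OF M] and N' = amod_left_module[OF N]
  note DM = D_left_module[OF M] and DN = D_left_module[OF N]
  note Df = Dm_hom[OF M N f]
  define X where "X = (D N)\<lparr>carrier := lmod_ker (D N) (D M) (Dm M N f)\<rparr>"
  have sub: "submodule (lmod_ker (D N) (D M) (Dm M N f)) A (D N)"
    by (rule submodule_ker[OF DN DM Df])
  have X: "X \<in> amod K A"
    using fdmod_sub[OF D_fdmod[OF N] sub] by (simp add: X_def amod_iff)
  obtain R t u where R: "R \<in> amod K A" "t \<in> lmod_hom A X (D R)" "u \<in> lmod_hom A N R"
    "t ` carrier X = carrier (D R)"
    "\<And>x. x \<in> carrier X \<Longrightarrow> (\<lambda>x\<in>lmod_ker (D N) (D M) (Dm M N f). x) x = Dm N R u (t x)"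
    by (rule hom_into_D[OF X N, of "\<lambda>x\<in>lmod_ker (D N) (D M) (Dm M N f). x"])
      (use inclusion_lmod_hom[OF DN sub] in \<open>auto simp: X_def\<close>)
  have jx: "x = Dm N R u (t x)" if "x \<in> carrier X" for x
    using R(5)[OF that] that by (simp add: X_def)
  have "Dm M R (compose (carrier M) u f) y = \<zero>\<^bsub>D M\<^esub>" if y: "y \<in> carrier (D R)" for y
  proof -
    obtain x where x: "x \<in> carrier X" "t x = y"
      by (rule image_eqE[OF R(4) y])
    then have "Dm N R u y = x"
      using jx by metis
    then have "Dm M N f (Dm N R u y) = \<zero>\<^bsub>D M\<^esub>"
      using x(1) by (simp add: X_def lmod_ker_def)
    then show ?thesis
      using Dm_compose[OF M N R(1) f R(3)] y by (simp add: compose_eq)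
  qed
  then have "compose (carrier M) u f x = \<zero>\<^bsub>R\<^esub>" if "x \<in> carrier M" for x
    using Dm_eq_zero_iff[OF M R(1) lmod_hom_compose[OF M' f R(3)]] that by blast
  then have "u (f x) = \<zero>\<^bsub>R\<^esub>" if "x \<in> carrier M" for x
    using that compose_eq[OF that, of u f] by simp
  then have "u y = \<zero>\<^bsub>R\<^esub>" if y: "y \<in> carrier N" for y
    using image_eqE[OF surj y] by metis
  then have "Dm N R u y = \<zero>\<^bsub>D N\<^esub>" if "y \<in> carrier (D R)" for y
    using Dm_eq_zero_iff[OF N R(1) R(3)] that by blast
  then have eq: "x = \<zero>\<^bsub>D N\<^esub>" if "x \<in> carrier X" for x
    using jx[OF that] lmod_homD(1)[OF R(2) that] by metis
  have "\<zero>\<^bsub>D N\<^esub> \<in> carrier X"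
    using submoduleD(2)[OF left_module_abelian_group[OF DN] sub] by (simp add: X_def)
  then have "carrier X = {\<zero>\<^bsub>D N\<^esub>}"
    by (intro equalityI subsetI singletonI) (simp_all only: singleton_iff eq)
  then have "lmod_ker (D N) (D M) (Dm M N f) = {\<zero>\<^bsub>D N\<^esub>}"
    by (simp add: X_def)
  then show ?thesis
    using lmod_hom_inj_iff[OF DN DM Df] by simp
qed

text \<open>Dual argument with the cokernel of \<open>D f\<close>: the projection onto it is, up to
  isomorphism, the dual of some \<open>u\<close> from \<open>R\<close> to \<open>M\<close>. From
  \<open>f u = 0\<close> and injectivity follows \<open>u = 0\<close>, so the cokernel is
  zero.\<close>

lemma Dm_of_inj:
  assumes M: "M \<in> amod K A" and N: "N \<in> amod K A" and f: "f \<in> lmod_hom A M N"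
    and inj: "inj_on f (carrier M)"
  shows "Dm M N f ` carrier (D N) = carrier (D M)"
proof -
  note M' = amod_left_module[OF M] and N' = amod_left_module[OF N]
  note DM = D_left_module[OF M] and DN = D_left_module[OF N]
  note Df = Dm_hom[OF M N f]
  define U where "U = Dm M N f ` carrier (D N)"
  have U: "submodule U A (D M)"
    unfolding U_def by (rule submodule_hom_image[OF DN DM Df carrier_submodule[OF DN]])
  have Q: "fdmod (quot_module (D M) U)"
    by (rule fdmod_quot[OF D_fdmod[OF M] U])
  note q = quot_module[OF DM U]
  obtain X :: "('a, 'k list) module" and v where X: "X \<in> amod K A" "v \<in> lmod_hom A (quot_module (D M) U) X"
    "bij_betw v (carrier (quot_module (D M) U)) (carrier X)"
    by (rule ex_amod_iso[OF Q]) blast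
  obtain R s t where R: "R \<in> amod K A" "s \<in> lmod_hom A (D R) X" "t \<in> lmod_hom A X (D R)"
    "\<And>x. x \<in> carrier X \<Longrightarrow> s (t x) = x" "\<And>y. y \<in> carrier (D R) \<Longrightarrow> t (s y) = y"
    by (rule ex_D_iso[OF X(1)]) blast
  define p where "p = compose (carrier (D M)) t (compose (carrier (D M)) v (quot_proj (D M) U))"
  have p: "p \<in> lmod_hom A (D M) (D R)"
    unfolding p_def by (intro lmod_hom_compose[OF DM _ R(3)] lmod_hom_compose[OF DM q(2) X(2)])
  obtain u where u: "u \<in> lmod_hom A R M" "Dm R M u = p"
    by (rule Dm_surj[OF R(1) M p])
  note R' = amod_left_module[OF R(1)] and DR = D_left_module[OF R(1)] and X' = amod_left_module[OF X(1)]
  have qU: "quot_proj (D M) U x = \<zero>\<^bsub>quot_module (D M) U\<^esub> \<longleftrightarrow> x \<in> U" if "x \<in> carrier (D M)" for x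
    using q(4) that unfolding lmod_ker_def by auto
  have v0: "v \<zero>\<^bsub>quot_module (D M) U\<^esub> = \<zero>\<^bsub>X\<^esub>" and t0: "t \<zero>\<^bsub>X\<^esub> = \<zero>\<^bsub>D R\<^esub>" and s0: "s \<zero>\<^bsub>D R\<^esub> = \<zero>\<^bsub>X\<^esub>"
    using lmod_hom_zero[OF q(1) X' X(2)] lmod_hom_zero[OF X' DR R(3)] lmod_hom_zero[OF DR X' R(2)] by auto
  have "Dm R N (compose (carrier R) f u) x = \<zero>\<^bsub>D R\<^esub>" if x: "x \<in> carrier (D N)" for x
  proof -
    have "Dm M N f x \<in> U" "Dm M N f x \<in> carrier (D M)"
      using x lmod_homD(1)[OF Df x] by (auto simp: U_def)
    then have "p (Dm M N f x) = \<zero>\<^bsub>D R\<^esub>"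
      using qU[THEN iffD2] v0 t0 by (simp add: p_def compose_eq)
    then show ?thesis
      using Dm_compose[OF R(1) M N u(1) f] x u(2) by (simp add: compose_eq)
  qed
  then have fu: "compose (carrier R) f u x = \<zero>\<^bsub>N\<^esub>" if "x \<in> carrier R" for x
    using Dm_eq_zero_iff[OF R(1) N lmod_hom_compose[OF R' u(1) f]] that by blast
  have ker: "lmod_ker M N f = {\<zero>\<^bsub>M\<^esub>}"
    using lmod_hom_inj_iff[OF M' N' f] inj by simp
  have "u x = \<zero>\<^bsub>M\<^esub>" if "x \<in> carrier R" for x
    using fu[OF that] lmod_homD(1)[OF u(1) that] ker compose_eq[OF that, of f u] by (auto simp: lmod_ker_def)
  then have p0: "p x = \<zero>\<^bsub>D R\<^esub>" if "x \<in> carrier (D M)" for x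
    using Dm_eq_zero_iff[OF R(1) M u(1)] that u(2) by blast
  have "x \<in> U" if x: "x \<in> carrier (D M)" for x
  proof -
    let ?y = "quot_proj (D M) U x"
    have y: "?y \<in> carrier (quot_module (D M) U)"
      by (rule lmod_homD(1)[OF q(2) x])
    have "t (v ?y) = \<zero>\<^bsub>D R\<^esub>"
      using p0[OF x] x by (simp add: p_def compose_eq)
    then have "v ?y = \<zero>\<^bsub>X\<^esub>"
      using R(4)[OF lmod_homD(1)[OF X(2) y]] s0 by simp
    moreover have "\<zero>\<^bsub>quot_module (D M) U\<^esub> \<in> carrier (quot_module (D M) U)"
      by (rule submoduleD(2)[OF left_module_abelian_group[OF q(1)] carrier_submodule[OF q(1)]])
    ultimately have "?y = \<zero>\<^bsub>quot_module (D M) U\<^esub>"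
      using v0 inj_onD[OF bij_betw_imp_inj_on[OF X(3)] _ y] by simp
    then show ?thesis
      using qU[OF x] by simp
  qed
  then show ?thesis
    using submoduleD(1)[OF left_module_abelian_group[OF DM] U] unfolding U_def by auto
qed

text \<open>The nontrivial inclusion: the kernel of \<open>D i\<close> is included by the dual of
  some \<open>u\<close> up to isomorphism, and \<open>u i = 0\<close>. So \<open>u\<close> factors
  as \<open>w p\<close>, and elements of the kernel come from \<open>D p\<close> after
  \<open>D w\<close>.\<close>

lemma Dm_exact:
  assumes N: "N \<in> amod K A" and M: "M \<in> amod K A" and Q: "Q \<in> amod K A"
    and i: "i \<in> lmod_hom A N M" and p: "p \<in> lmod_hom A M Q" "p ` carrier M = carrier Q"
    and ex: "i ` carrier N = lmod_ker M Q p"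
  shows "Dm M Q p ` carrier (D Q) = lmod_ker (D M) (D N) (Dm N M i)"
proof -
  note N' = amod_left_module[OF N] and M' = amod_left_module[OF M] and Q' = amod_left_module[OF Q]
  note DM = D_left_module[OF M] and DN = D_left_module[OF N] and DQ = D_left_module[OF Q]
  note Di = Dm_hom[OF N M i] and Dp = Dm_hom[OF M Q p(1)]
  show ?thesis
  proof
    have "compose (carrier N) p i x = \<zero>\<^bsub>Q\<^esub>" if "x \<in> carrier N" for x
      using ex that by (auto simp: compose_eq lmod_ker_def)
    then have "Dm N Q (compose (carrier N) p i) y = \<zero>\<^bsub>D N\<^esub>" if "y \<in> carrier (D Q)" for y
      using Dm_eq_zero_iff[OF N Q lmod_hom_compose[OF N' i p(1)]] that by blast
    then have "Dm N M i (Dm M Q p y) = \<zero>\<^bsub>D N\<^esub>" if "y \<in> carrier (D Q)" for y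
      using that by (simp add: Dm_compose[OF N M Q i p(1)] compose_eq)
    then show "Dm M Q p ` carrier (D Q) \<subseteq> lmod_ker (D M) (D N) (Dm N M i)"
      using lmod_homD(1)[OF Dp] by (auto simp: lmod_ker_def)
    define Y where "Y = lmod_ker (D M) (D N) (Dm N M i)"
    define X where "X = (D M)\<lparr>carrier := Y\<rparr>"
    have sub: "submodule Y A (D M)"
      unfolding Y_def by (rule submodule_ker[OF DM DN Di])
    have X: "X \<in> amod K A"
      using fdmod_sub[OF D_fdmod[OF M] sub] by (simp add: X_def amod_iff)
    obtain R t u where R: "R \<in> amod K A" "t \<in> lmod_hom A X (D R)" "u \<in> lmod_hom A M R"
      "t ` carrier X = carrier (D R)"
      "\<And>x. x \<in> carrier X \<Longrightarrow> (\<lambda>x\<in>Y. x) x = Dm M R u (t x)"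
      by (rule hom_into_D[OF X M, of "\<lambda>x\<in>Y. x"])
        (use inclusion_lmod_hom[OF DM sub] in \<open>auto simp: X_def\<close>)
    have jx: "x = Dm M R u (t x)" if "x \<in> Y" for x
      using R(5)[of x] that by (simp add: X_def)
    have "Dm N R (compose (carrier N) u i) y = \<zero>\<^bsub>D N\<^esub>" if y: "y \<in> carrier (D R)" for y
    proof -
      obtain x where x: "x \<in> Y" "t x = y"
        by (rule image_eqE[OF R(4) y]) (simp add: X_def)
      then have "Dm M R u y = x"
        using jx by metis
      then have "Dm N M i (Dm M R u y) = \<zero>\<^bsub>D N\<^esub>"
        using x(1) by (simp add: Y_def lmod_ker_def)
      then show ?thesis
        using Dm_compose[OF N M R(1) i R(3)] y by (simp add: compose_eq)
    qed
    then have ui: "compose (carrier N) u i x = \<zero>\<^bsub>R\<^esub>" if "x \<in> carrier N" for x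
      using Dm_eq_zero_iff[OF N R(1) lmod_hom_compose[OF N' i R(3)]] that by blast
    have "lmod_ker M Q p \<subseteq> lmod_ker M R u"
    proof
      fix x assume x: "x \<in> lmod_ker M Q p"
      then obtain n where "n \<in> carrier N" "i n = x"
        by (rule image_eqE[OF ex])
      then show "x \<in> lmod_ker M R u"
        using ui x by (auto simp: lmod_ker_def compose_eq)
    qed
    then obtain w where w: "w \<in> lmod_hom A Q R" "compose (carrier M) w p = u"
      using lmod_hom_factor[OF M' Q' amod_left_module[OF R(1)] p R(3)] by metis
    have "x \<in> Dm M Q p ` carrier (D Q)" if x: "x \<in> Y" for x
    proof -
      have tx: "t x \<in> carrier (D R)"
        using lmod_homD(1)[OF R(2), of x] x by (simp add: X_def)
      have "x = Dm M Q p (Dm Q R w (t x))"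
        using jx[OF x] Dm_compose[OF M Q R(1) p(1) w(1)] w(2) tx by (simp add: compose_eq)
      then show ?thesis
        using lmod_homD(1)[OF Dm_hom[OF Q R(1) w(1)] tx] by (rule image_eqI)
    qed
    then show "lmod_ker (D M) (D N) (Dm N M i) \<subseteq> Dm M Q p ` carrier (D Q)"
      by (auto simp: Y_def)
  qed
qed

lemma D_iso:
  assumes M: "M \<in> amod K A" and N: "N \<in> amod K A" and "lmod_iso A M N"
  shows "lmod_iso A (D N) (D M)"
proof -
  obtain f where f: "f \<in> lmod_hom A M N" "bij_betw f (carrier M) (carrier N)"
    using assms(3) unfolding lmod_iso_def by metis
  show ?thesis
    using Dm_of_surj[OF M N f(1)] Dm_of_inj[OF M N f(1)] f(2) lmod_isoI[OF Dm_hom[OF M N f(1)]]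
    by (simp add: bij_betw_def)
qed

section \<open>Multiplicities under the duality and symmetry of the Cartan matrix\<close>

lemma subquot_amod:
  assumes M: "fdmod M" and N': "submodule N' A M" and N: "submodule N A M" and "N \<subseteq> N'"
  obtains Q :: "('a, 'k list) module" and p where "Q \<in> amod K A" "lmod_iso A (subquot M N' N) Q"
    "p \<in> lmod_hom A (M\<lparr>carrier := N'\<rparr>) Q" "p ` N' = carrier Q" "lmod_ker (M\<lparr>carrier := N'\<rparr>) Q p = N"
proof -
  obtain q where q: "fdmod (subquot M N' N)" "q \<in> lmod_hom A (M\<lparr>carrier := N'\<rparr>) (subquot M N' N)"
    "q ` N' = carrier (subquot M N' N)" "lmod_ker (M\<lparr>carrier := N'\<rparr>) (subquot M N' N) q = N"
    by (rule subquot_fdmod[OF M N' N assms(4)]) blast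
  obtain Q :: "('a, 'k list) module" and v where Q: "Q \<in> amod K A" "v \<in> lmod_hom A (subquot M N' N) Q"
    "bij_betw v (carrier (subquot M N' N)) (carrier Q)"
    by (rule ex_amod_iso[OF q(1)]) blast
  let ?p = "compose N' v q"
  note lm = left_module_sub[OF fdmod_left_module[OF M] N'] fdmod_left_module[OF q(1)] amod_left_module[OF Q(1)]
  have qx: "q x \<in> carrier (subquot M N' N)" if "x \<in> N'" for x
    using lmod_homD(1)[OF q(2), of x] that by simp
  have "?p \<in> lmod_hom A (M\<lparr>carrier := N'\<rparr>) Q"
    using lmod_hom_compose[OF lm(1) q(2) Q(2)] by simp
  moreover have "?p ` N' = carrier Q"
  proof -
    have "?p ` N' = v ` (q ` N')"
      by (simp add: image_image compose_eq)
    then show ?thesis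
      using q(3) bij_betw_imp_surj_on[OF Q(3)] by simp
  qed
  moreover have "lmod_ker (M\<lparr>carrier := N'\<rparr>) Q ?p = N"
  proof -
    have "v y = \<zero>\<^bsub>Q\<^esub> \<longleftrightarrow> y = \<zero>\<^bsub>subquot M N' N\<^esub>" if "y \<in> carrier (subquot M N' N)" for y
      using lmod_hom_inj_iff[OF lm(2,3) Q(2)] bij_betw_imp_inj_on[OF Q(3)] that lmod_hom_zero[OF lm(2,3) Q(2)]
      unfolding lmod_ker_def by auto
    then have "lmod_ker (M\<lparr>carrier := N'\<rparr>) Q ?p = lmod_ker (M\<lparr>carrier := N'\<rparr>) (subquot M N' N) q"
      using qx lmod_hom_zero[OF lm(2,3) Q(2)] by (auto simp: lmod_ker_def compose_eq)
    then show ?thesis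
      using q(4) by simp
  qed
  moreover have "lmod_iso A (subquot M N' N) Q"
    using Q(2,3) unfolding lmod_iso_def by metis
  ultimately show ?thesis
    using that Q(1) by metis
qed

text \<open>\<open>D M\<close> has the same composition factors as \<open>M\<close>. The dimension
  of Hom(P(l), D N) is followed along a series of \<open>M\<close>: each inclusion with simple
  quotient \<open>Q\<close> dualizes to an exact sequence with kernel \<open>D Q\<close>, which is
  isomorphic to \<open>Q\<close>. No series of \<open>D M\<close> has to be built.\<close>

lemma hlen_proj_D:
  assumes l: "l \<in> Irr K A" and M: "M \<in> amod K A"
  shows "hlen (proj_of K A l) (D M) = hom_dim l * comp_mult A M (simple_of l)"
proof -
  let ?P = "proj_of K A l"
  note P = proj_of_projective[OF l]
  have M': "fdmod M"
    using M by (simp add: amod_iff)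
  note M'' = fdmod_left_module[OF M']
  have sub_amod: "M\<lparr>carrier := N\<rparr> \<in> amod K A" if "submodule N A M" for N
    using fdmod_sub[OF M' that] by (simp add: amod_iff)
  have "hlen ?P (D (M\<lparr>carrier := carrier M\<rparr>)) = hom_dim l * comp_mult A M (simple_of l)"
  proof (rule composition_series_count[OF M'])
    have Z: "M\<lparr>carrier := {\<zero>\<^bsub>M\<^esub>}\<rparr> \<in> amod K A"
      by (rule sub_amod[OF zero_submodule[OF M'']])
    show "hlen ?P (D (M\<lparr>carrier := {\<zero>\<^bsub>M\<^esub>}\<rparr>)) = 0"
      by (rule hlen_trivial_right[OF P(2) D_fdmod[OF Z] D_trivial[OF Z]]) simp
    fix N N' assume N: "submodule N A M" "submodule N' A M" "N \<subseteq> N'" and simple: "simple_lmod A (subquot M N' N)"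
    let ?S = "subquot M N' N"
    obtain Q :: "('a, 'k list) module" and p where Q: "Q \<in> amod K A" "lmod_iso A ?S Q"
      "p \<in> lmod_hom A (M\<lparr>carrier := N'\<rparr>) Q" "p ` N' = carrier Q" "lmod_ker (M\<lparr>carrier := N'\<rparr>) Q p = N"
      by (rule subquot_amod[OF M' N(2,1,3)]) blast
    have S: "left_module A ?S"
      by (rule simple_lmodD(1)[OF simple])
    note A1 = sub_amod[OF N(1)] and A2 = sub_amod[OF N(2)]
    let ?i = "\<lambda>x\<in>N. x"
    have i: "?i \<in> lmod_hom A (M\<lparr>carrier := N\<rparr>) (M\<lparr>carrier := N'\<rparr>)"
      by (rule sub_inclusion[OF M'' N(2,1,3)])
    have surj: "p ` carrier (M\<lparr>carrier := N'\<rparr>) = carrier Q"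
      using Q(4) by simp
    have inj: "inj_on ?i (carrier (M\<lparr>carrier := N\<rparr>))"
      by (simp add: inj_on_def)
    have ex: "?i ` carrier (M\<lparr>carrier := N\<rparr>) = lmod_ker (M\<lparr>carrier := N'\<rparr>) Q p"
      using Q(5) by simp
    have "hlen ?P (D (M\<lparr>carrier := N'\<rparr>)) = hlen ?P (D Q) + hlen ?P (D (M\<lparr>carrier := N\<rparr>))"
      by (rule hlen_projective[OF P(1) D_fdmod[OF Q(1)] D_fdmod[OF A2] D_fdmod[OF A1] Dm_hom[OF A2 Q(1,3)]
            Dm_of_surj[OF A2 Q(1,3) surj] Dm_hom[OF A1 A2 i] Dm_of_inj[OF A1 A2 i inj]
            Dm_exact[OF A1 A2 Q(1) i Q(3) surj ex]])
    moreover have "hlen ?P (D Q) = (if lmod_iso A ?S (simple_of l) then hom_dim l else 0)"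
    proof -
      have Q': "simple_lmod A Q" "fdmod Q" "left_module A Q"
        using simple_lmod_iso[OF simple _ Q(2)] Q(1) amod_left_module by (simp_all add: amod_iff)
      obtain m where m: "m \<in> Irr K A" "lmod_iso A Q (simple_of m)"
        by (rule ex_Irr_iso[OF Q'(2,1)])
      note Lm = Irr_simple_of[OF m(1)]
      have "lmod_iso A (simple_of m) (D (simple_of m))"
        by (rule lmod_iso_sym[OF D_left_module[OF Lm(2)] amod_left_module[OF Lm(2)] preserves_simple[OF m(1)]])
      moreover have "lmod_iso A (D (simple_of m)) (D Q)"
        by (rule D_iso[OF Q(1) Lm(2) m(2)])
      ultimately have "lmod_iso A (simple_of m) (D Q)"
        by (rule lmod_iso_trans[OF amod_left_module[OF Lm(2)]])
      then have QD: "lmod_iso A Q (D Q)"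
        by (rule lmod_iso_trans[OF Q'(3) m(2)])
      have "hlen ?P (D Q) = hlen ?P Q"
        using hlen_iso(1)[OF P(2) Q'(2) D_fdmod[OF Q(1)] QD] by simp
      also have "\<dots> = (if lmod_iso A Q (simple_of l) then hom_dim l else 0)"
        by (rule hlen_proj_simple[OF l Q'(2,1)])
      also have "lmod_iso A Q (simple_of l) \<longleftrightarrow> lmod_iso A ?S (simple_of l)"
        using lmod_iso_trans[OF S Q(2)] lmod_iso_trans[OF Q'(3) lmod_iso_sym[OF S Q'(3) Q(2)]] by metis
      finally show ?thesis .
    qed
    ultimately show "hlen ?P (D (M\<lparr>carrier := N'\<rparr>)) = hlen ?P (D (M\<lparr>carrier := N\<rparr>))
        + (if lmod_iso A ?S (simple_of l) then hom_dim l else 0)"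
      by simp
  qed
  then show ?thesis
    by simp
qed

lemma ex_double_dual:
  assumes M: "M \<in> amod K A"
  obtains h h' where "h \<in> lmod_hom A M (D (D M))" "h' \<in> lmod_hom A (D (D M)) M"
    "\<And>x. x \<in> carrier M \<Longrightarrow> h' (h x) = x" "\<And>y. y \<in> carrier (D (D M)) \<Longrightarrow> h (h' y) = y"
proof -
  obtain h where h: "h M \<in> lmod_hom A M (D (D M))" "bij_betw (h M) (carrier M) (carrier (D (D M)))"
    using involutive M unfolding involutive_functor_def by metis
  obtain h' where "h' \<in> lmod_hom A (D (D M)) M" "\<And>x. x \<in> carrier M \<Longrightarrow> h' (h M x) = x"
    "\<And>y. y \<in> carrier (D (D M)) \<Longrightarrow> h M (h' y) = y"
    by (rule lmod_hom_inverse[OF amod_left_module[OF M] D_left_module[OF D_amod[OF M]] h]) blast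
  then show ?thesis
    using that h(1) by metis
qed

text \<open>This is injectivity of \<open>D P\<close>. Dualizing turns the extension problem along
  \<open>i\<close> into a lifting problem for \<open>D (D P)\<close>, a copy of \<open>P\<close>,
  along the surjection \<open>D i\<close>; fullness and faithfulness carry the solution
  back.\<close>

lemma D_projective_extend:
  assumes P: "projective K A P" and N: "N \<in> amod K A" and M: "M \<in> amod K A"
    and i: "i \<in> lmod_hom A N M" "inj_on i (carrier N)" and f: "f \<in> lmod_hom A N (D P)"
  shows "\<exists>h\<in>lmod_hom A M (D P). compose (carrier N) h i = f"
proof -
  have PA: "P \<in> amod K A"
    using P by (simp add: projective_def)
  note DP = D_amod[OF PA]
  obtain h h' where h: "h \<in> lmod_hom A P (D (D P))" "h' \<in> lmod_hom A (D (D P)) P"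
    "\<And>x. x \<in> carrier P \<Longrightarrow> h' (h x) = x" "\<And>y. y \<in> carrier (D (D P)) \<Longrightarrow> h (h' y) = y"
    by (rule ex_double_dual[OF PA]) blast
  note Df = Dm_hom[OF N DP f] and Di = Dm_hom[OF N M i(1)]
  obtain k where k: "k \<in> lmod_hom A P (D M)"
    "compose (carrier P) (Dm N M i) k = compose (carrier P) (Dm N (D P) f) h"
    by (rule projective_lift[OF P D_fdmod[OF M] D_fdmod[OF N] Di Dm_of_inj[OF N M i]
          lmod_hom_compose[OF amod_left_module[OF PA] h(1) Df]])
  have "compose (carrier (D (D P))) k h' \<in> lmod_hom A (D (D P)) (D M)"
    by (rule lmod_hom_compose[OF D_left_module[OF DP] h(2) k(1)])
  then obtain g where g: "g \<in> lmod_hom A M (D P)" "Dm M (D P) g = compose (carrier (D (D P))) k h'"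
    by (rule Dm_surj[OF M DP])
  have "Dm N (D P) (compose (carrier N) g i) = Dm N (D P) f"
  proof (rule lmod_hom_eqI[OF Dm_hom[OF N DP lmod_hom_compose[OF amod_left_module[OF N] i(1) g(1)]] Df])
    fix y assume y: "y \<in> carrier (D (D P))"
    have hy: "h' y \<in> carrier P"
      by (rule lmod_homD(1)[OF h(2) y])
    have "Dm N (D P) (compose (carrier N) g i) y = Dm N M i (k (h' y))"
      using y by (simp add: Dm_compose[OF N M DP i(1) g(1)] g(2) compose_eq)
    also have "\<dots> = Dm N (D P) f (h (h' y))"
      using k(2) compose_eq[OF hy, of "Dm N M i" k] compose_eq[OF hy, of "Dm N (D P) f" h] by simp
    finally show "Dm N (D P) (compose (carrier N) g i) y = Dm N (D P) f y"
      using h(4)[OF y] by simp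
  qed
  then have "compose (carrier N) g i = f"
    by (rule Dm_inj[OF N DP lmod_hom_compose[OF amod_left_module[OF N] i(1) g(1)] f])
  then show ?thesis
    using g(1) by metis
qed

text \<open>A nonzero map from L(m) to \<open>D P(l)\<close> dualizes to a nonzero map from P(l),
  through its double dual, to a copy of L(m). Only L(l) receives such maps.\<close>

lemma hlen_simple_D_proj:
  assumes m: "m \<in> Irr K A" and l: "l \<in> Irr K A" and "m \<noteq> l"
  shows "hlen (simple_of m) (D (proj_of K A l)) = 0"
proof (rule ccontr)
  let ?P = "proj_of K A l" and ?L = "simple_of m"
  note P = proj_of_projective[OF l] and L = Irr_simple_of[OF m]
  assume "hlen ?L (D ?P) \<noteq> 0"
  then obtain f x where f: "f \<in> lmod_hom A ?L (D ?P)" "x \<in> carrier ?L" "f x \<noteq> \<zero>\<^bsub>D ?P\<^esub>"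
    using hlen_pos_iff[OF L(4) D_fdmod[OF P(4)]] by auto
  note Df = Dm_hom[OF L(2) D_amod[OF P(4)] f(1)]
  obtain y where y: "y \<in> carrier (D (D ?P))" "Dm ?L (D ?P) f y \<noteq> \<zero>\<^bsub>D ?L\<^esub>"
    using Dm_eq_zero_iff[OF L(2) D_amod[OF P(4)] f(1)] f(2,3) by metis
  obtain h h' where h: "h \<in> lmod_hom A ?P (D (D ?P))" "h' \<in> lmod_hom A (D (D ?P)) ?P"
    "\<And>x. x \<in> carrier ?P \<Longrightarrow> h' (h x) = x" "\<And>y. y \<in> carrier (D (D ?P)) \<Longrightarrow> h (h' y) = y"
    by (rule ex_double_dual[OF P(4)]) blast
  let ?g = "compose (carrier ?P) (Dm ?L (D ?P) f) h"
  have g: "?g \<in> lmod_hom A ?P (D ?L)"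
    by (rule lmod_hom_compose[OF P(3) h(1) Df])
  have hy: "h' y \<in> carrier ?P"
    by (rule lmod_homD(1)[OF h(2) y(1)])
  have "?g (h' y) \<noteq> \<zero>\<^bsub>D ?L\<^esub>"
    using y hy h(4) by (simp add: compose_eq)
  moreover have iso: "lmod_iso A ?L (D ?L)"
    by (rule lmod_iso_sym[OF D_left_module[OF L(2)] amod_left_module[OF L(2)] preserves_simple[OF m]])
  then have "simple_lmod A (D ?L)"
    by (rule simple_lmod_iso[OF L(3) D_left_module[OF L(2)]])
  ultimately have "lmod_iso A (D ?L) (simple_of l)"
    using projective_cover_hom_simple[OF proj_of_cover[OF l] Irr_simple_of(3)[OF l] _ g hy] by simp
  then have "lmod_iso A ?L (simple_of l)"
    by (rule lmod_iso_trans[OF amod_left_module[OF L(2)] iso])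
  then show False
    using Irr_eqI[OF m l] assms(3) by simp
qed

text \<open>Counting by maps into the injective module \<open>D P(l)\<close>. The dimension for L(l)
  is left as an unevaluated constant, since the bijection with Hom(P(l), L(l)) given by
  \<open>D\<close> need not preserve dimensions.\<close>

lemma hlen_D_proj:
  assumes l: "l \<in> Irr K A" and M: "M \<in> amod K A"
  shows "hlen M (D (proj_of K A l)) = hlen (simple_of l) (D (proj_of K A l)) * comp_mult A M (simple_of l)"
proof -
  let ?P = "proj_of K A l"
  note P = proj_of_projective[OF l]
  have I: "fdmod (D ?P)"
    by (rule D_fdmod[OF P(4)])
  have M': "fdmod M"
    using M by (simp add: amod_iff)
  note M'' = fdmod_left_module[OF M']
  have sub_amod: "M\<lparr>carrier := N\<rparr> \<in> amod K A" if "submodule N A M" for N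
    using fdmod_sub[OF M' that] by (simp add: amod_iff)
  have "hlen (M\<lparr>carrier := carrier M\<rparr>) (D ?P)
      = hlen (simple_of l) (D ?P) * comp_mult A M (simple_of l)"
  proof (rule composition_series_count[OF M'])
    show "hlen (M\<lparr>carrier := {\<zero>\<^bsub>M\<^esub>}\<rparr>) (D ?P) = 0"
      by (rule hlen_trivial_left[OF I fdmod_zero_sub[OF M']]) simp
    fix N N' assume N: "submodule N A M" "submodule N' A M" "N \<subseteq> N'" and simple: "simple_lmod A (subquot M N' N)"
    let ?S = "subquot M N' N"
    obtain p where p: "fdmod ?S" "p \<in> lmod_hom A (M\<lparr>carrier := N'\<rparr>) ?S"
      "p ` N' = carrier ?S" "lmod_ker (M\<lparr>carrier := N'\<rparr>) ?S p = N"
      by (rule subquot_fdmod[OF M' N(2,1,3)]) blast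
    note A1 = sub_amod[OF N(1)] and A2 = sub_amod[OF N(2)]
    note F1 = fdmod_sub[OF M' N(1)] and F2 = fdmod_sub[OF M' N(2)]
    let ?i = "\<lambda>x\<in>N. x"
    have i: "?i \<in> lmod_hom A (M\<lparr>carrier := N\<rparr>) (M\<lparr>carrier := N'\<rparr>)"
      by (rule sub_inclusion[OF M'' N(2,1,3)])
    have inj: "inj_on ?i (carrier (M\<lparr>carrier := N\<rparr>))"
      by (simp add: inj_on_def)
    have "hlen (M\<lparr>carrier := N'\<rparr>) (D ?P) = hlen (M\<lparr>carrier := N\<rparr>) (D ?P) + hlen ?S (D ?P)"
      by (rule hlen_exact_right[OF I F1 F2 p(1) i p(2) _ _ D_projective_extend[OF P(1) A1 A2 i inj]])
        (use p(3,4) in simp_all)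
    moreover have "hlen ?S (D ?P) = (if lmod_iso A ?S (simple_of l) then hlen (simple_of l) (D ?P) else 0)"
    proof (cases "lmod_iso A ?S (simple_of l)")
      case True
      then show ?thesis
        using hlen_iso(2)[OF I p(1) Irr_simple_of(4)[OF l]] by simp
    next
      case False
      obtain m where m: "m \<in> Irr K A" "lmod_iso A ?S (simple_of m)"
        by (rule ex_Irr_iso[OF p(1) simple])
      have "m \<noteq> l"
        using False m(2) by auto
      then show ?thesis
        using hlen_iso(2)[OF I p(1) Irr_simple_of(4)[OF m(1)] m(2)] hlen_simple_D_proj[OF m(1) l] False by simp
    qed
    ultimately show "hlen (M\<lparr>carrier := N'\<rparr>) (D ?P) = hlen (M\<lparr>carrier := N\<rparr>) (D ?P)
        + (if lmod_iso A ?S (simple_of l) then hlen (simple_of l) (D ?P) else 0)"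
      by simp
  qed
  then show ?thesis
    by simp
qed

lemma Cartan_symmetric:
  assumes l: "l \<in> Irr K A" and m: "m \<in> Irr K A"
  shows "hom_dim l * comp_mult A (proj_of K A m) (simple_of l) = hom_dim m * comp_mult A (proj_of K A l) (simple_of m)"
proof -
  have eq: "hom_dim l * comp_mult A (proj_of K A m) (simple_of l)
      = hlen (simple_of m) (D (proj_of K A m)) * comp_mult A (proj_of K A l) (simple_of m)"
    if "l \<in> Irr K A" "m \<in> Irr K A" for l m
    using hlen_proj_D[OF that(1) proj_of_projective(4)[OF that(2)]]
      hlen_D_proj[OF that(2) proj_of_projective(4)[OF that(1)]] by simp
  \<comment> \<open>Both counts of the same hom space are compared for \<open>l = m\<close>;
    cancelling the positive \<open>[P(m) : L(m)]\<close> evaluates the unknown constant.\<close>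
  have "hlen (simple_of m) (D (proj_of K A m)) = hom_dim m"
    using eq[OF m m] comp_mult_proj_pos[OF m] by simp
  then show ?thesis
    using eq[OF l m] by simp
qed

end

section \<open>Uniqueness of unitriangular factorizations\<close>

definition mat_mult :: "'i set \<Rightarrow> ('i \<Rightarrow> 'i \<Rightarrow> real) \<Rightarrow> ('i \<Rightarrow> 'i \<Rightarrow> real) \<Rightarrow> 'i \<Rightarrow> 'i \<Rightarrow> real" where
  "mat_mult I f g i j = (\<Sum>k\<in>I. f i k * g k j)"

definition mat_id :: "'i \<Rightarrow> 'i \<Rightarrow> real" where
  "mat_id i j = (if i = j then 1 else 0)"

lemma mat_mult_assoc: "mat_mult I (mat_mult I f g) h i j = mat_mult I f (mat_mult I g h) i j"
proof -
  have "mat_mult I (mat_mult I f g) h i j = (\<Sum>k\<in>I. \<Sum>l\<in>I. f i l * g l k * h k j)"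
    by (simp add: mat_mult_def sum_distrib_right)
  also have "\<dots> = (\<Sum>l\<in>I. \<Sum>k\<in>I. f i l * g l k * h k j)"
    by (rule sum.swap)
  also have "\<dots> = mat_mult I f (mat_mult I g h) i j"
    by (simp add: mat_mult_def sum_distrib_left mult.assoc)
  finally show ?thesis .
qed

lemma mat_mult_cong:
  assumes "\<And>k. k \<in> I \<Longrightarrow> f i k = f' i k" and "\<And>k. k \<in> I \<Longrightarrow> g k j = g' k j"
  shows "mat_mult I f g i j = mat_mult I f' g' i j"
  using assms by (simp add: mat_mult_def)

lemma mat_mult_id:
  assumes "finite I"
  shows "i \<in> I \<Longrightarrow> mat_mult I mat_id f i j = f i j" and "j \<in> I \<Longrightarrow> mat_mult I f mat_id i j = f i j"
  using assms by (simp_all add: mat_mult_def mat_id_def if_distrib if_distribR sum.delta cong: if_cong)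

lemma mat_mult_Ints:
  assumes "\<And>k. k \<in> I \<Longrightarrow> f i k \<in> \<int>" and "\<And>k. k \<in> I \<Longrightarrow> g k j \<in> \<int>"
  shows "mat_mult I f g i j \<in> \<int>"
  unfolding mat_mult_def using assms by (intro Ints_sum Ints_mult) auto

text \<open>Integrality is part of the notion, as the inverse has to be integral too; unit diagonal
  entries make that possible.\<close>

definition unitriangular :: "'i set \<Rightarrow> 'i rel \<Rightarrow> ('i \<Rightarrow> 'i \<Rightarrow> real) \<Rightarrow> bool" where
  "unitriangular I r d \<longleftrightarrow> (\<forall>i\<in>I. \<forall>j\<in>I. d i j \<in> \<int>) \<and> (\<forall>i\<in>I. \<forall>j\<in>I. d i j \<noteq> 0 \<longrightarrow> (j, i) \<in> r) \<and>
     (\<forall>i\<in>I. d i i = 1)"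

text \<open>Forward substitution along the order, by induction on the number of elements below
  \<open>i\<close>.\<close>

lemma unitriangular_left_inverse:
  assumes fin: "finite I" and anti: "antisym r" and trans: "trans r" and refl: "refl_on I r"
    and d: "unitriangular I r d"
  obtains g where "unitriangular I r g" "\<And>i j. i \<in> I \<Longrightarrow> j \<in> I \<Longrightarrow> mat_mult I g d i j = mat_id i j"
proof -
  have "\<exists>v. (\<forall>j\<in>I. v j \<in> \<int>) \<and> (\<forall>j\<in>I. v j \<noteq> 0 \<longrightarrow> (j, i) \<in> r) \<and> v i = 1 \<and>
      (\<forall>j\<in>I. (\<Sum>k\<in>I. v k * d k j) = mat_id i j)" if "i \<in> I" for i
    using that
  proof (induction "card {j \<in> I. (j, i) \<in> r}" arbitrary: i rule: less_induct)
    case less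
    define J where "J = {k \<in> I. (k, i) \<in> r \<and> k \<noteq> i}"
    have "card {j \<in> I. (j, k) \<in> r} < card {j \<in> I. (j, i) \<in> r}" if k: "k \<in> J" for k
    proof (rule psubset_card_mono)
      have "(i, k) \<notin> r"
        using k anti by (auto simp: J_def antisym_def)
      then show "{j \<in> I. (j, k) \<in> r} \<subset> {j \<in> I. (j, i) \<in> r}"
        using k trans less(2) refl_onD[OF refl] by (auto simp: J_def trans_def)
    qed (use fin in simp)
    then have ex: "\<forall>k\<in>J. \<exists>v. (\<forall>j\<in>I. v j \<in> \<int>) \<and> (\<forall>j\<in>I. v j \<noteq> 0 \<longrightarrow> (j, k) \<in> r) \<and> v k = 1 \<and>
        (\<forall>j\<in>I. (\<Sum>l\<in>I. v l * d l j) = mat_id k j)"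
      using less(1) by (simp add: J_def)
    obtain w where w: "\<And>k j. k \<in> J \<Longrightarrow> j \<in> I \<Longrightarrow> w k j \<in> \<int>"
      "\<And>k j. k \<in> J \<Longrightarrow> j \<in> I \<Longrightarrow> w k j \<noteq> 0 \<Longrightarrow> (j, k) \<in> r"
      "\<And>k j. k \<in> J \<Longrightarrow> j \<in> I \<Longrightarrow> (\<Sum>l\<in>I. w k l * d l j) = mat_id k j"
      using bchoice[OF ex] by blast
    have J: "J \<subseteq> I" "finite J"
      using fin by (auto simp: J_def)
    \<comment> \<open>Row \<open>i\<close> of \<open>d\<close> is the unit row plus multiples of
      unit rows with smaller index \<open>k\<close>. Subtracting the same multiples of the rows
      \<open>w k\<close> already constructed leaves the unit row after multiplication by
      \<open>d\<close>.\<close>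
    define v where "v j = mat_id i j - (\<Sum>k\<in>J. d i k * w k j)" for j
    have "v j \<in> \<int>" if "j \<in> I" for j
      unfolding v_def using d w(1) J(1) that less(2)
      by (intro Ints_diff Ints_sum Ints_mult) (auto simp: unitriangular_def mat_id_def)
    moreover have "(j, i) \<in> r" if j: "j \<in> I" "v j \<noteq> 0" for j
    proof (cases "j = i")
      case False
      then have "(\<Sum>k\<in>J. d i k * w k j) \<noteq> 0"
        using j(2) by (simp add: v_def mat_id_def)
      then obtain k where "k \<in> J" "d i k * w k j \<noteq> 0"
        by (rule sum.not_neutral_contains_not_neutral)
      then have k: "k \<in> J" "w k j \<noteq> 0"
        by auto
      then have "(j, k) \<in> r" "(k, i) \<in> r"
        using w(2)[OF k(1) j(1) k(2)] by (auto simp: J_def)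
      then show ?thesis
        using trans by (meson transD)
    qed (use refl_onD[OF refl less(2)] in simp)
    moreover have "v i = 1"
    proof -
      have "w k i = 0" if "k \<in> J" for k
        using w(2)[OF that less(2)] that anti by (auto simp: J_def antisym_def)
      then show ?thesis
        by (simp add: v_def mat_id_def)
    qed
    moreover have "(\<Sum>k\<in>I. v k * d k j) = mat_id i j" if j: "j \<in> I" for j
    proof -
      have "(\<Sum>k\<in>I. v k * d k j) = (\<Sum>k\<in>I. mat_id i k * d k j) - (\<Sum>k\<in>I. \<Sum>l\<in>J. d i l * w l k * d k j)"
        by (simp add: v_def left_diff_distrib sum_subtractf sum_distrib_right)
      also have "(\<Sum>k\<in>I. mat_id i k * d k j) = d i j"
        using mat_mult_id(1)[OF fin less(2), of d j] by (simp add: mat_mult_def)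
      also have "(\<Sum>k\<in>I. \<Sum>l\<in>J. d i l * w l k * d k j) = (\<Sum>l\<in>J. \<Sum>k\<in>I. d i l * w l k * d k j)"
        by (rule sum.swap)
      also have "\<dots> = (\<Sum>l\<in>J. d i l * mat_id l j)"
        using w(3)[OF _ j] by (intro sum.cong) (simp_all add: mult.assoc sum_distrib_left[symmetric])
      also have "\<dots> = (if j \<in> J then d i j else 0)"
        using J(2) by (simp add: mat_id_def if_distrib sum.delta' cong: if_cong)
      also have "d i j - (if j \<in> J then d i j else 0) = mat_id i j"
        using d less(2) j by (auto simp: J_def mat_id_def unitriangular_def)
      finally show ?thesis .
    qed
    ultimately show ?case
      by blast
  qed
  then have "\<exists>g. \<forall>i\<in>I. (\<forall>j\<in>I. g i j \<in> \<int>) \<and> (\<forall>j\<in>I. g i j \<noteq> 0 \<longrightarrow> (j, i) \<in> r) \<and> g i i = 1 \<and>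
      (\<forall>j\<in>I. (\<Sum>k\<in>I. g i k * d k j) = mat_id i j)"
    by (intro bchoice ballI)
  then obtain g where "\<forall>i\<in>I. (\<forall>j\<in>I. g i j \<in> \<int>) \<and> (\<forall>j\<in>I. g i j \<noteq> 0 \<longrightarrow> (j, i) \<in> r) \<and> g i i = 1 \<and>
      (\<forall>j\<in>I. (\<Sum>k\<in>I. g i k * d k j) = mat_id i j)"
    by blast
  then show ?thesis
    using that[of g] by (simp add: unitriangular_def mat_mult_def)
qed

lemma unitriangular_inverse:
  assumes fin: "finite I" and anti: "antisym r" and trans: "trans r" and refl: "refl_on I r"
    and d: "unitriangular I r d"
  obtains g where "unitriangular I r g" "\<And>i j. i \<in> I \<Longrightarrow> j \<in> I \<Longrightarrow> mat_mult I g d i j = mat_id i j"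
    "\<And>i j. i \<in> I \<Longrightarrow> j \<in> I \<Longrightarrow> mat_mult I d g i j = mat_id i j"
proof -
  obtain g where g: "unitriangular I r g" "\<And>i j. i \<in> I \<Longrightarrow> j \<in> I \<Longrightarrow> mat_mult I g d i j = mat_id i j"
    by (rule unitriangular_left_inverse[OF assms]) (rule that)
  obtain h where h: "unitriangular I r h" "\<And>i j. i \<in> I \<Longrightarrow> j \<in> I \<Longrightarrow> mat_mult I h g i j = mat_id i j"
    by (rule unitriangular_left_inverse[OF assms(1-4) g(1)]) (rule that)
  have "d i j = h i j" if ij: "i \<in> I" "j \<in> I" for i j
  proof -
    have "d i j = mat_mult I mat_id d i j"
      using mat_mult_id(1)[OF fin ij(1)] by simp
    also have "\<dots> = mat_mult I (mat_mult I h g) d i j"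
      using h(2) ij by (intro mat_mult_cong) auto
    also have "\<dots> = mat_mult I h (mat_mult I g d) i j"
      by (rule mat_mult_assoc)
    also have "\<dots> = mat_mult I h mat_id i j"
      using g(2) ij by (intro mat_mult_cong) auto
    finally show ?thesis
      using mat_mult_id(2)[OF fin ij(2)] by simp
  qed
  then have "mat_mult I d g i j = mat_id i j" if "i \<in> I" "j \<in> I" for i j
    using h(2)[OF that] mat_mult_cong[of I d i h g j g] that by simp
  then show ?thesis
    using that g by blast
qed

text \<open>Writing \<open>C = P d\<close> with \<open>P\<close> and \<open>d\<close> triangular in opposite directions, the matrix
  \<open>g\<^sup>T C g = g\<^sup>T P\<close> for \<open>g = d\<^sup>-\<^sup>1\<close> is both symmetric and triangular, hence diagonal.\<close>

lemma symmetric_triangular_factorization: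
  assumes fin: "finite I" and anti: "antisym r" and trans: "trans r"
    and d: "unitriangular I r d" and g: "unitriangular I r g"
    and gd: "\<And>i j. i \<in> I \<Longrightarrow> j \<in> I \<Longrightarrow> mat_mult I g d i j = mat_id i j"
    and dg: "\<And>i j. i \<in> I \<Longrightarrow> j \<in> I \<Longrightarrow> mat_mult I d g i j = mat_id i j"
    and sym: "\<And>i j. i \<in> I \<Longrightarrow> j \<in> I \<Longrightarrow> C i j = C j i"
    and C: "\<And>i j. i \<in> I \<Longrightarrow> j \<in> I \<Longrightarrow> C i j = mat_mult I P d i j"
    and P: "\<And>i j. i \<in> I \<Longrightarrow> j \<in> I \<Longrightarrow> P i j \<noteq> 0 \<Longrightarrow> (i, j) \<in> r"
    and ij: "i \<in> I" "j \<in> I"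
  shows "C i j = (\<Sum>l\<in>I. P l l * d l i * d l j)"
proof -
  let ?m = "mat_mult I"
  define gt where "gt i j = g j i" for i j
  define dt where "dt i j = d j i" for i j
  define X where "X = ?m gt P"
  have Cg: "?m C g i j = P i j" if "i \<in> I" "j \<in> I" for i j
  proof -
    have "?m C g i j = ?m (?m P d) g i j"
      using C that by (intro mat_mult_cong) auto
    also have "\<dots> = ?m P (?m d g) i j"
      by (rule mat_mult_assoc)
    also have "\<dots> = ?m P mat_id i j"
      using dg that by (intro mat_mult_cong) auto
    finally show ?thesis
      using mat_mult_id(2)[OF fin that(2)] by simp
  qed
  have X: "X i j = (\<Sum>a\<in>I. \<Sum>b\<in>I. g a i * C a b * g b j)" if "i \<in> I" "j \<in> I" for i j
  proof -
    have "X i j = (\<Sum>a\<in>I. g a i * ?m C g a j)"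
      using Cg that by (simp add: X_def mat_mult_def[of I gt] gt_def)
    then show ?thesis
      by (simp add: mat_mult_def sum_distrib_left mult.assoc)
  qed
  have X_sym: "X i j = X j i" if ij: "i \<in> I" "j \<in> I" for i j
  proof -
    have "X i j = (\<Sum>b\<in>I. \<Sum>a\<in>I. g a i * C a b * g b j)"
      unfolding X[OF ij] by (rule sum.swap)
    also have "\<dots> = (\<Sum>b\<in>I. \<Sum>a\<in>I. g b j * C b a * g a i)"
      using sym by (intro sum.cong refl) (simp add: mult.commute mult.left_commute)
    finally show ?thesis
      using X[OF ij(2,1)] by simp
  qed
  have X_tri: "(i, j) \<in> r" if ij: "i \<in> I" "j \<in> I" "X i j \<noteq> 0" for i j
  proof -
    have "(\<Sum>a\<in>I. g a i * P a j) \<noteq> 0"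
      using ij(3) by (simp add: X_def mat_mult_def gt_def)
    then obtain a where a: "a \<in> I" "g a i * P a j \<noteq> 0"
      by (rule sum.not_neutral_contains_not_neutral)
    then have "(i, a) \<in> r" "(a, j) \<in> r"
      using g P ij by (auto simp: unitriangular_def)
    then show ?thesis
      using trans by (meson transD)
  qed
  \<comment> \<open>A nonzero summand needs \<open>i\<close> below \<open>a\<close> and
    \<open>a\<close> below \<open>i\<close>, so only \<open>a = i\<close> contributes.\<close>
  have X_diag: "X i i = P i i" if i: "i \<in> I" for i
  proof -
    have "g a i * P a i = (if a = i then P i i else 0)" if a: "a \<in> I" for a
    proof (cases "a = i")
      case False
      then have "\<not> ((i, a) \<in> r \<and> (a, i) \<in> r)"
        using anti by (auto simp: antisym_def)
      then have "g a i = 0 \<or> P a i = 0"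
        using g P a i by (auto simp: unitriangular_def)
      then show ?thesis
        using False by auto
    qed (use g i in \<open>simp add: unitriangular_def\<close>)
    then show ?thesis
      using fin i by (simp add: X_def mat_mult_def gt_def)
  qed
  have X_eq: "X i j = (if i = j then P i i else 0)" if ij: "i \<in> I" "j \<in> I" for i j
    using X_tri[OF ij] X_tri[OF ij(2,1)] X_sym[OF ij] X_diag[OF ij(1)] anti by (auto simp: antisym_def)
  have dtX: "?m dt X i j = P i j" if ij: "i \<in> I" "j \<in> I" for i j
  proof -
    have "?m dt X i j = ?m (?m dt gt) P i j"
      by (simp add: X_def mat_mult_assoc)
    also have "\<dots> = ?m mat_id P i j"
    proof (rule mat_mult_cong)
      fix k assume k: "k \<in> I"
      have "?m dt gt i k = ?m g d k i"
        by (simp add: mat_mult_def dt_def gt_def mult.commute)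
      then show "?m dt gt i k = mat_id i k"
        using gd[OF k ij(1)] by (auto simp: mat_id_def)
    qed simp
    finally show ?thesis
      using mat_mult_id(1)[OF fin ij(1)] by simp
  qed
  \<comment> \<open>From \<open>P = d\<^sup>T X\<close> with \<open>X\<close> diagonal. This is BGG
    reciprocity up to the rescaling and the diagonal factor.\<close>
  have "P i l = P l l * d l i" if l: "l \<in> I" for l
  proof -
    have "P i l = (\<Sum>k\<in>I. d k i * (if k = l then P k k else 0))"
      using dtX[OF ij(1) l] X_eq[OF _ l] by (simp add: mat_mult_def dt_def)
    also have "\<dots> = P l l * d l i"
      using fin l by (simp add: if_distrib sum.delta' mult.commute cong: if_cong)
    finally show ?thesis .
  qed
  then show ?thesis
    using C[OF ij] by (simp add: mat_mult_def)
qed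

section \<open>Rigidity of integral isometries between positive diagonal forms\<close>

lemma increasing_permutation_id:
  assumes fin: "finite I" and anti: "antisym r" and trans: "trans r" and refl: "refl_on I r"
    and pi: "\<And>i. i \<in> I \<Longrightarrow> \<pi> i \<in> I" "\<And>i. i \<in> I \<Longrightarrow> (i, \<pi> i) \<in> r" and inj: "inj_on \<pi> I"
    and "i \<in> I"
  shows "\<pi> i = i"
  using assms(8)
proof (induction "card {k \<in> I. (i, k) \<in> r}" arbitrary: i rule: less_induct)
  case less
  show ?case
  proof (rule ccontr)
    assume ne: "\<pi> i \<noteq> i"
    then have "(\<pi> i, i) \<notin> r"
      using pi(2)[OF less(2)] anti by (auto simp: antisym_def)
    then have "i \<in> {k \<in> I. (i, k) \<in> r} - {k \<in> I. (\<pi> i, k) \<in> r}"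
      using refl_onD[OF refl less(2)] less(2) by simp
    moreover have "{k \<in> I. (\<pi> i, k) \<in> r} \<subseteq> {k \<in> I. (i, k) \<in> r}"
      using transD[OF trans pi(2)[OF less(2)]] by blast
    ultimately have "{k \<in> I. (\<pi> i, k) \<in> r} \<subset> {k \<in> I. (i, k) \<in> r}"
      by blast
    \<comment> \<open>Fewer elements lie above \<open>\<pi> i\<close> than above \<open>i\<close>,
      so induction fixes \<open>\<pi> i\<close>; then \<open>i\<close> and \<open>\<pi> i\<close>
      have the same image.\<close>
    then have "\<pi> (\<pi> i) = \<pi> i"
      using fin less(1)[OF psubset_card_mono pi(1)[OF less(2)]] by simp
    then show False
      using inj_onD[OF inj _ pi(1)[OF less(2)] less(2)] ne by simp
  qed
qed

lemma Ints_sum_eq_1: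
  assumes fin: "finite I" and "\<And>i. i \<in> I \<Longrightarrow> x i \<in> \<int>" and "\<And>i. i \<in> I \<Longrightarrow> x i \<ge> (0 :: real)"
    and "(\<Sum>i\<in>I. x i) = 1"
  shows "\<exists>i\<in>I. x i = 1 \<and> (\<forall>j\<in>I. j \<noteq> i \<longrightarrow> x j = 0)"
proof -
  have "(\<Sum>i\<in>I. x i) \<noteq> 0"
    using assms(4) by simp
  then obtain i where i: "i \<in> I" "x i \<noteq> 0"
    by (rule sum.not_neutral_contains_not_neutral)
  then have "x i \<ge> 1"
    using assms(2,3)[OF i(1)] by (auto elim!: Ints_cases)
  moreover have rest: "x i + (\<Sum>j\<in>I - {i}. x j) = 1"
    using sum.remove[OF fin i(1), of x] assms(4) by simp
  moreover have ge: "(\<Sum>j\<in>I - {i}. x j) \<ge> 0"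
    using assms(3) by (intro sum_nonneg) auto
  ultimately have "x i = 1" "(\<Sum>j\<in>I - {i}. x j) = 0"
    by linarith+
  then have "\<forall>j\<in>I - {i}. x j = 0"
    using sum_nonneg_eq_0_iff[of "I - {i}" x] fin assms(3) by auto
  then show ?thesis
    using i(1) \<open>x i = 1\<close> by blast
qed

text \<open>The base change \<open>T = d2 d1\<^sup>-\<^sup>1\<close> is integral and isometric for the two diagonal forms, so
  \<open>T i j\<close> and \<open>T\<^sup>-\<^sup>1 j i\<close> have the same sign. As \<open>T T\<^sup>-\<^sup>1 = 1\<close>, every row of \<open>T\<close> has a single nonzero entry,
  and triangularity makes the resulting permutation trivial.\<close>

lemma unitriangular_isometry_unique:
  assumes fin: "finite I" and p1: "partial_order_on I r1" and p2: "partial_order_on I r2"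
    and d1: "unitriangular I r1 d1" and d2: "unitriangular I r2 d2"
    and nonneg: "\<And>i j. i \<in> I \<Longrightarrow> j \<in> I \<Longrightarrow> d1 i j \<ge> 0"
    and f1: "\<And>i. i \<in> I \<Longrightarrow> f1 i > 0" and f2: "\<And>i. i \<in> I \<Longrightarrow> f2 i > 0"
    and eq: "\<And>a b. a \<in> I \<Longrightarrow> b \<in> I \<Longrightarrow>
      (\<Sum>l\<in>I. f1 l * d1 l a * d1 l b) = (\<Sum>l\<in>I. f2 l * d2 l a * d2 l b)"
    and ij: "i \<in> I" "j \<in> I"
  shows "d1 i j = d2 i j"
proof -
  let ?m = "mat_mult I"
  have r1: "antisym r1" "trans r1" "refl_on I r1" and r2: "antisym r2" "trans r2" "refl_on I r2"
    using p1 p2 by (auto simp: partial_order_on_def preorder_on_def)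
  obtain g1 where g1: "unitriangular I r1 g1" "\<And>i j. i \<in> I \<Longrightarrow> j \<in> I \<Longrightarrow> ?m g1 d1 i j = mat_id i j"
    "\<And>i j. i \<in> I \<Longrightarrow> j \<in> I \<Longrightarrow> ?m d1 g1 i j = mat_id i j"
    by (rule unitriangular_inverse[OF fin r1 d1]) (rule that)
  obtain g2 where g2: "unitriangular I r2 g2" "\<And>i j. i \<in> I \<Longrightarrow> j \<in> I \<Longrightarrow> ?m g2 d2 i j = mat_id i j"
    "\<And>i j. i \<in> I \<Longrightarrow> j \<in> I \<Longrightarrow> ?m d2 g2 i j = mat_id i j"
    by (rule unitriangular_inverse[OF fin r2 d2]) (rule that)
  define T where "T = ?m d2 g1"
  define T' where "T' = ?m d1 g2"
  have T_Ints: "T i j \<in> \<int>" "T' i j \<in> \<int>" if "i \<in> I" "j \<in> I" for i j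
    using that d1 d2 g1(1) g2(1) unfolding T_def T'_def
    by (auto intro!: mat_mult_Ints simp: unitriangular_def)
  have mid: "?m (?m a b) (?m c e) i j = ?m a e i j"
    if bc: "\<And>i j. i \<in> I \<Longrightarrow> j \<in> I \<Longrightarrow> ?m b c i j = mat_id i j" and ij: "i \<in> I" "j \<in> I" for a b c e i j
  proof -
    have "?m (?m a b) (?m c e) i j = ?m a (?m b (?m c e)) i j"
      by (rule mat_mult_assoc)
    also have "\<dots> = ?m a e i j"
    proof (rule mat_mult_cong)
      fix k assume k: "k \<in> I"
      have "?m b (?m c e) k j = ?m (?m b c) e k j"
        by (simp add: mat_mult_assoc)
      also have "\<dots> = ?m mat_id e k j"
        using bc k by (intro mat_mult_cong) auto
      finally show "?m b (?m c e) k j = e k j"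
        using mat_mult_id(1)[OF fin k] by simp
    qed simp
    finally show ?thesis .
  qed
  have TT': "?m T T' i j = mat_id i j" "?m T' T i j = mat_id i j" if "i \<in> I" "j \<in> I" for i j
    using mid[OF g1(2) that] mid[OF g2(2) that] g1(3) g2(3) that by (simp_all add: T_def T'_def)
  have Td1: "?m T d1 i j = d2 i j" if "i \<in> I" "j \<in> I" for i j
  proof -
    have "?m T d1 i j = ?m d2 (?m g1 d1) i j"
      by (simp add: T_def mat_mult_assoc)
    also have "\<dots> = ?m d2 mat_id i j"
      using g1(2) that by (intro mat_mult_cong) auto
    finally show ?thesis
      using mat_mult_id(2)[OF fin that(2)] by simp
  qed
  \<comment> \<open>In matrix form:
    \<open>u\<^sup>T (h\<^sup>T F h) v = (h u)\<^sup>T F (h v)\<close>.\<close>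
  have conj: "(\<Sum>a\<in>I. \<Sum>b\<in>I. u a * (\<Sum>k\<in>I. f k * h k a * h k b) * v b)
      = (\<Sum>k\<in>I. f k * (\<Sum>a\<in>I. h k a * u a) * (\<Sum>b\<in>I. h k b * v b))" for u v f :: "'a \<Rightarrow> real" and h
  proof -
    have "(\<Sum>a\<in>I. \<Sum>b\<in>I. u a * (\<Sum>k\<in>I. f k * h k a * h k b) * v b)
        = (\<Sum>a\<in>I. \<Sum>b\<in>I. \<Sum>k\<in>I. f k * ((h k a * u a) * (h k b * v b)))"
      by (simp add: sum_distrib_left sum_distrib_right mult_ac)
    also have "\<dots> = (\<Sum>a\<in>I. \<Sum>k\<in>I. \<Sum>b\<in>I. f k * ((h k a * u a) * (h k b * v b)))"
      by (intro sum.cong refl sum.swap)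
    also have "\<dots> = (\<Sum>k\<in>I. \<Sum>a\<in>I. \<Sum>b\<in>I. f k * ((h k a * u a) * (h k b * v b)))"
      by (rule sum.swap)
    also have "\<dots> = (\<Sum>k\<in>I. f k * (\<Sum>a\<in>I. h k a * u a) * (\<Sum>b\<in>I. h k b * v b))"
    proof (rule sum.cong)
      fix k assume "k \<in> I"
      have "f k * (\<Sum>a\<in>I. h k a * u a) * (\<Sum>b\<in>I. h k b * v b)
          = f k * (\<Sum>a\<in>I. \<Sum>b\<in>I. (h k a * u a) * (h k b * v b))"
        by (simp only: mult.assoc[of "f k"] sum_product)
      then show "(\<Sum>a\<in>I. \<Sum>b\<in>I. f k * ((h k a * u a) * (h k b * v b)))
          = f k * (\<Sum>a\<in>I. h k a * u a) * (\<Sum>b\<in>I. h k b * v b)"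
        by (simp only: sum_distrib_left)
    qed simp
    finally show ?thesis .
  qed
  \<comment> \<open>The common form is evaluated at column \<open>l\<close> of \<open>g1\<close> and
    column \<open>m\<close> of \<open>g2\<close>. With the first diagonalization
    \<open>d1 g1 = 1\<close> leaves a single term, with the second \<open>d2 g2 = 1\<close>
    does.\<close>
  have sign: "f1 l * T' l m = f2 m * T m l" if l: "l \<in> I" and m: "m \<in> I" for l m
  proof -
    have "f1 l * T' l m = (\<Sum>k\<in>I. f1 k * ?m d1 g1 k l * ?m d1 g2 k m)"
    proof -
      have "(\<Sum>k\<in>I. f1 k * ?m d1 g1 k l * ?m d1 g2 k m) = (\<Sum>k\<in>I. if k = l then f1 l * T' l m else 0)"
        using g1(3)[OF _ l] by (intro sum.cong) (auto simp: mat_id_def T'_def)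
      then show ?thesis
        using fin l by simp
    qed
    also have "\<dots> = (\<Sum>a\<in>I. \<Sum>b\<in>I. g1 a l * (\<Sum>k\<in>I. f1 k * d1 k a * d1 k b) * g2 b m)"
      unfolding conj by (simp add: mat_mult_def)
    also have "\<dots> = (\<Sum>a\<in>I. \<Sum>b\<in>I. g1 a l * (\<Sum>k\<in>I. f2 k * d2 k a * d2 k b) * g2 b m)"
      using eq by (intro sum.cong) auto
    also have "\<dots> = (\<Sum>k\<in>I. f2 k * ?m d2 g1 k l * ?m d2 g2 k m)"
      unfolding conj by (simp add: mat_mult_def)
    also have "\<dots> = (\<Sum>k\<in>I. if k = m then f2 m * T m l else 0)"
      using g2(3)[OF _ m] by (intro sum.cong) (auto simp: mat_id_def T_def)
    also have "\<dots> = f2 m * T m l"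
      using fin m by simp
    finally show ?thesis .
  qed
  have prod_nonneg: "T m l * T' l m \<ge> 0" and zero_iff: "T m l * T' l m = 0 \<longleftrightarrow> T m l = 0"
    if l: "l \<in> I" and m: "m \<in> I" for l m
  proof -
    have eq: "T' l m = f2 m / f1 l * T m l"
      using sign[OF l m] f1[OF l] by (simp add: field_simps)
    have pos: "f2 m / f1 l > 0"
      using f1[OF l] f2[OF m] by simp
    have prod: "T m l * T' l m = f2 m / f1 l * (T m l)\<^sup>2"
      by (simp add: eq power2_eq_square)
    show "T m l * T' l m \<ge> 0"
      unfolding prod using pos by (intro mult_nonneg_nonneg) auto
    show "T m l * T' l m = 0 \<longleftrightarrow> T m l = 0"
      unfolding prod using pos by auto
  qed
  \<comment> \<open>The diagonal entry of \<open>T T' = 1\<close> at \<open>m\<close> is a sum of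
    nonnegative integers, so exactly one product is nonzero; a zero product means a zero entry of
    \<open>T\<close>.\<close>
  have "\<exists>l\<in>I. T m l * T' l m = 1 \<and> (\<forall>j\<in>I. j \<noteq> l \<longrightarrow> T m j = 0)" if m: "m \<in> I" for m
  proof -
    have sum: "(\<Sum>l\<in>I. T m l * T' l m) = 1"
      using TT'(1)[OF m m] by (simp add: mat_mult_def mat_id_def)
    have "T m l * T' l m \<in> \<int>" if "l \<in> I" for l
      using T_Ints(1)[OF m that] T_Ints(2)[OF that m] by (rule Ints_mult)
    then have "\<exists>l\<in>I. T m l * T' l m = 1 \<and> (\<forall>j\<in>I. j \<noteq> l \<longrightarrow> T m j * T' j m = 0)"
      by (rule Ints_sum_eq_1[OF fin _ prod_nonneg[OF _ m] sum])
    then show ?thesis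
      using zero_iff m by blast
  qed
  then obtain \<pi> where \<pi>: "\<And>m. m \<in> I \<Longrightarrow> \<pi> m \<in> I" "\<And>m. m \<in> I \<Longrightarrow> T m (\<pi> m) * T' (\<pi> m) m = 1"
    "\<And>m j. m \<in> I \<Longrightarrow> j \<in> I \<Longrightarrow> j \<noteq> \<pi> m \<Longrightarrow> T m j = 0"
    by metis
  have row: "d2 m b = T m (\<pi> m) * d1 (\<pi> m) b" if m: "m \<in> I" and b: "b \<in> I" for m b
  proof -
    have "d2 m b = (\<Sum>k\<in>I. T m k * d1 k b)"
      using Td1[OF m b] by (simp add: mat_mult_def)
    also have "\<dots> = (\<Sum>k\<in>I. if k = \<pi> m then T m (\<pi> m) * d1 (\<pi> m) b else 0)"
      using \<pi>(3)[OF m] by (intro sum.cong) auto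
    finally show ?thesis
      using fin \<pi>(1)[OF m] by simp
  qed
  have unit: "T m (\<pi> m) = 1" and le: "(m, \<pi> m) \<in> r1" if m: "m \<in> I" for m
  proof -
    have one: "1 = T m (\<pi> m) * d1 (\<pi> m) m"
      using row[OF m m] d2 m by (simp add: unitriangular_def)
    then have "d1 (\<pi> m) m \<noteq> 0"
      by auto
    then show "(m, \<pi> m) \<in> r1"
      using d1 m \<pi>(1)[OF m] by (simp add: unitriangular_def)
    \<comment> \<open>Here nonnegativity of \<open>d1\<close> excludes the sign -1.\<close>
    have pos: "T m (\<pi> m) > 0"
      using one nonneg[OF \<pi>(1)[OF m] m] by (metis mult_nonpos_nonneg not_le zero_less_one)
    obtain x y where xy: "T m (\<pi> m) = of_int x" "T' (\<pi> m) m = of_int y"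
      using T_Ints[OF m \<pi>(1)[OF m]] T_Ints[OF \<pi>(1)[OF m] m] by (metis Ints_cases)
    have "of_int (x * y) = (1 :: real)"
      using \<pi>(2)[OF m] xy by simp
    then have "x * y = 1"
      by linarith
    then show "T m (\<pi> m) = 1"
      using pos xy(1) by (simp add: zmult_eq_1_iff)
  qed
  \<comment> \<open>Two rows sharing a column would contribute 2 to a diagonal entry of
    \<open>T' T = 1\<close>, whose other summands are nonnegative.\<close>
  have "inj_on \<pi> I"
  proof (rule inj_onI, rule ccontr)
    fix m n assume mn: "m \<in> I" "n \<in> I" "\<pi> m = \<pi> n" "m \<noteq> n"
    let ?l = "\<pi> m"
    have "(\<Sum>k\<in>{m, n}. T k ?l * T' ?l k) \<le> (\<Sum>k\<in>I. T k ?l * T' ?l k)"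
      using fin mn \<pi>(1) prod_nonneg by (intro sum_mono2) auto
    also have "\<dots> = 1"
      using TT'(2)[OF \<pi>(1)[OF mn(1)] \<pi>(1)[OF mn(1)]] by (simp add: mat_mult_def mat_id_def mult.commute)
    finally show False
      using \<pi>(2)[OF mn(1)] \<pi>(2)[OF mn(2)] mn(3,4) by simp
  qed
  from increasing_permutation_id[OF fin r1 \<pi>(1) le this ij(1)] have "\<pi> i = i" .
  then show ?thesis
    using row[OF ij] unit[OF ij(1)] by simp
qed

lemma unitriangular_factorization_unique:
  fixes c p1 d1 p2 d2 :: "'i \<Rightarrow> 'i \<Rightarrow> nat" and e :: "'i \<Rightarrow> nat"
  assumes fin: "finite I" and r1: "partial_order_on I r1" and r2: "partial_order_on I r2"
    and c1: "\<And>l n. l \<in> I \<Longrightarrow> n \<in> I \<Longrightarrow> c l n = (\<Sum>m\<in>I. p1 l m * d1 m n)"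
    and c2: "\<And>l n. l \<in> I \<Longrightarrow> n \<in> I \<Longrightarrow> c l n = (\<Sum>m\<in>I. p2 l m * d2 m n)"
    and e: "\<And>l. l \<in> I \<Longrightarrow> e l > 0" and sym: "\<And>l m. l \<in> I \<Longrightarrow> m \<in> I \<Longrightarrow> e l * c m l = e m * c l m"
    and p1: "\<And>l m. l \<in> I \<Longrightarrow> m \<in> I \<Longrightarrow> p1 l m \<noteq> 0 \<Longrightarrow> (l, m) \<in> r1" "\<And>l. l \<in> I \<Longrightarrow> p1 l l \<noteq> 0"
    and p2: "\<And>l m. l \<in> I \<Longrightarrow> m \<in> I \<Longrightarrow> p2 l m \<noteq> 0 \<Longrightarrow> (l, m) \<in> r2" "\<And>l. l \<in> I \<Longrightarrow> p2 l l \<noteq> 0"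
    and d1: "\<And>l m. l \<in> I \<Longrightarrow> m \<in> I \<Longrightarrow> d1 l m \<noteq> 0 \<Longrightarrow> (m, l) \<in> r1" "\<And>l. l \<in> I \<Longrightarrow> d1 l l = 1"
    and d2: "\<And>l m. l \<in> I \<Longrightarrow> m \<in> I \<Longrightarrow> d2 l m \<noteq> 0 \<Longrightarrow> (m, l) \<in> r2" "\<And>l. l \<in> I \<Longrightarrow> d2 l l = 1"
    and lm: "l \<in> I" "m \<in> I"
  shows "d1 l m = d2 l m" and "p1 l m = p2 l m"
proof -
  \<comment> \<open>By \<open>sym\<close>, dividing row \<open>i\<close> by \<open>e i\<close>
    symmetrizes \<open>c\<close>. It keeps the factorization, with the rows of \<open>p\<close>
    divided likewise.\<close>
  define C where "C i j = real (c i j) / real (e i)" for i j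
  have C_sym: "C i j = C j i" if "i \<in> I" "j \<in> I" for i j
  proof -
    have "real (e i) * real (c j i) = real (e j) * real (c i j)"
      using sym[OF that] by (metis of_nat_mult)
    then show ?thesis
      using e[OF that(1)] e[OF that(2)] by (simp add: C_def field_simps)
  qed
  have key: "\<exists>g. (\<forall>i\<in>I. \<forall>j\<in>I. mat_mult I (\<lambda>i j. real (d i j)) g i j = mat_id i j) \<and>
      unitriangular I r (\<lambda>i j. real (d i j)) \<and>
      (\<forall>i\<in>I. \<forall>j\<in>I. C i j = (\<Sum>l\<in>I. (real (p l l) / real (e l)) * real (d l i) * real (d l j)))"
    if r: "partial_order_on I r"
      and c: "\<And>l n. l \<in> I \<Longrightarrow> n \<in> I \<Longrightarrow> c l n = (\<Sum>m\<in>I. p l m * d m n)"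
      and p: "\<And>l m. l \<in> I \<Longrightarrow> m \<in> I \<Longrightarrow> p l m \<noteq> 0 \<Longrightarrow> (l, m) \<in> r"
      and d: "\<And>l m. l \<in> I \<Longrightarrow> m \<in> I \<Longrightarrow> d l m \<noteq> 0 \<Longrightarrow> (m, l) \<in> r" "\<And>l. l \<in> I \<Longrightarrow> d l l = 1"
    for r and p d :: "'i \<Rightarrow> 'i \<Rightarrow> nat"
  proof -
    have r': "antisym r" "trans r" "refl_on I r"
      using r by (auto simp: partial_order_on_def preorder_on_def)
    have u: "unitriangular I r (\<lambda>i j. real (d i j))"
      using d by (auto simp: unitriangular_def)
    obtain g where g: "unitriangular I r g"
      "\<And>i j. i \<in> I \<Longrightarrow> j \<in> I \<Longrightarrow> mat_mult I g (\<lambda>i j. real (d i j)) i j = mat_id i j"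
      "\<And>i j. i \<in> I \<Longrightarrow> j \<in> I \<Longrightarrow> mat_mult I (\<lambda>i j. real (d i j)) g i j = mat_id i j"
      by (rule unitriangular_inverse[OF fin r' u]) (rule that)
    have C: "C i j = mat_mult I (\<lambda>i j. real (p i j) / real (e i)) (\<lambda>i j. real (d i j)) i j"
      if "i \<in> I" "j \<in> I" for i j
      using c[OF that] by (simp add: C_def mat_mult_def sum_divide_distrib)
    have P: "(i, j) \<in> r" if "i \<in> I" "j \<in> I" "real (p i j) / real (e i) \<noteq> 0" for i j
      using p[OF that(1,2)] that(3) by auto
    have "C i j = (\<Sum>l\<in>I. (real (p l l) / real (e l)) * real (d l i) * real (d l j))" if "i \<in> I" "j \<in> I" for i j
      by (rule symmetric_triangular_factorization[OF fin r'(1,2) u g C_sym C P that])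
    then show ?thesis
      using g(3) u by blast
  qed
  obtain g where g: "\<forall>i\<in>I. \<forall>j\<in>I. mat_mult I (\<lambda>i j. real (d1 i j)) g i j = mat_id i j"
    and u1: "unitriangular I r1 (\<lambda>i j. real (d1 i j))"
    and C1: "\<forall>i\<in>I. \<forall>j\<in>I. C i j = (\<Sum>l\<in>I. (real (p1 l l) / real (e l)) * real (d1 l i) * real (d1 l j))"
    using key[OF r1 c1 p1(1) d1] by blast
  have u2: "unitriangular I r2 (\<lambda>i j. real (d2 i j))"
    and C2: "\<forall>i\<in>I. \<forall>j\<in>I. C i j = (\<Sum>l\<in>I. (real (p2 l l) / real (e l)) * real (d2 l i) * real (d2 l j))"
    using key[OF r2 c2 p2(1) d2] by blast+
  have pos: "real (p1 l l) / real (e l) > 0" "real (p2 l l) / real (e l) > 0" if "l \<in> I" for l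
    using p1(2)[OF that] p2(2)[OF that] e[OF that] by simp_all
  have d_eq: "d1 i j = d2 i j" if "i \<in> I" "j \<in> I" for i j
  proof -
    have "real (d1 i j) = real (d2 i j)"
      by (rule unitriangular_isometry_unique[OF fin r1 r2 u1 u2 _ pos _ that]) (use C1 C2 in auto)
    then show ?thesis
      by simp
  qed
  then show "d1 l m = d2 l m"
    using lm by blast
  \<comment> \<open>Once the \<open>d\<close> agree, both \<open>p\<close> are the common
    \<open>c\<close> times the inverse of \<open>d\<close>.\<close>
  have recover: "real (p i j) = mat_mult I (\<lambda>i j. real (c i j)) g i j"
    if c: "\<And>l n. l \<in> I \<Longrightarrow> n \<in> I \<Longrightarrow> c l n = (\<Sum>m\<in>I. p l m * d1 m n)" and ij: "i \<in> I" "j \<in> I" for p i j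
  proof -
    have "mat_mult I (\<lambda>i j. real (c i j)) g i j
        = mat_mult I (mat_mult I (\<lambda>i j. real (p i j)) (\<lambda>i j. real (d1 i j))) g i j"
      using c ij by (intro mat_mult_cong) (simp_all add: mat_mult_def)
    also have "\<dots> = mat_mult I (\<lambda>i j. real (p i j)) (mat_mult I (\<lambda>i j. real (d1 i j)) g) i j"
      by (rule mat_mult_assoc)
    also have "\<dots> = mat_mult I (\<lambda>i j. real (p i j)) mat_id i j"
      using g ij by (intro mat_mult_cong) auto
    finally show ?thesis
      using mat_mult_id(2)[OF fin ij(2)] by simp
  qed
  have "c i j = (\<Sum>m\<in>I. p2 i m * d1 m j)" if "i \<in> I" "j \<in> I" for i j
    using c2[OF that] d_eq that by simp
  then show "p1 l m = p2 l m"
    using recover[OF c1 lm] recover[of p2, OF _ lm] by simp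
qed

section \<open>Uniqueness of the standard modules\<close>

context simple_preserving_duality
begin

text \<open>The modules \<open>proj_of\<close> and \<open>simple_of\<close> are chosen without
  reference to an order, so both quasi-hereditary structures factor the same Cartan matrix. The
  second claim does not follow from the first by rewriting: \<open>standard_mult\<close> chooses its
  filtration by a predicate that mentions the order. It comes from the matrix identity
  instead.\<close>

lemma quasi_hereditary_unique:
  assumes r1: "partial_order_on (Irr K A) r1" and r2: "partial_order_on (Irr K A) r2"
    and q1: "quasi_hereditary K A r1" and q2: "quasi_hereditary K A r2" and l: "l \<in> Irr K A"
  shows "standard_module K A r1 l = standard_module K A r2 l"
    and "m \<in> Irr K A \<Longrightarrow> standard_mult K A r1 l m = standard_mult K A r2 l m"
proof -
  let ?I = "Irr K A"
  let ?d = "\<lambda>r l m. comp_mult A (standard_module K A r l) (simple_of m)"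
  let ?p = "\<lambda>r l m. standard_mult K A r l m"
  let ?c = "\<lambda>l m. comp_mult A (proj_of K A l) (simple_of m)"
  have one: "?d r l l = 1" if "quasi_hereditary K A r" "l \<in> ?I" for r l
    using that by (simp add: quasi_hereditary_def)
  have p: "\<exists>Ns. standard_filtration K A r l Ns \<and>
      (\<forall>m. ?p r l m = factor_count A (proj_of K A l) Ns (standard_module K A r m))"
    if q: "quasi_hereditary K A r" "l \<in> ?I" for r l
  proof -
    have "\<exists>Ns. standard_filtration K A r l Ns"
      using q by (simp add: quasi_hereditary_def)
    then have "standard_filtration K A r l (SOME Ns. standard_filtration K A r l Ns)"
      by (rule someI_ex)
    then show ?thesis
      unfolding standard_mult_def by blast
  qed
  have diag: "?p r l l \<noteq> 0" if q: "quasi_hereditary K A r" and l: "l \<in> ?I" for r l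
    using p[OF q l] standard_filtration_top[OF l one[OF q]] by metis
  have facts: "?c l n = (\<Sum>m\<in>?I. ?p r l m * ?d r m n)" "?p r l n \<noteq> 0 \<Longrightarrow> (l, n) \<in> r"
    if r: "partial_order_on ?I r" and q: "quasi_hereditary K A r" and l: "l \<in> ?I" and n: "n \<in> ?I" for r l n
  proof -
    have anti: "antisym r"
      using r by (simp add: partial_order_on_def)
    obtain Ns where Ns: "standard_filtration K A r l Ns"
      and p: "\<And>m. ?p r l m = factor_count A (proj_of K A l) Ns (standard_module K A r m)"
      using p[OF q l] by metis
    show "?c l n = (\<Sum>m\<in>?I. ?p r l m * ?d r m n)"
      unfolding p by (rule standard_filtration_mult[OF anti l n one[OF q] Ns])
    show "(l, n) \<in> r" if "?p r l n \<noteq> 0"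
      by (rule standard_filtration_le[OF anti l n one[OF q] Ns that[unfolded p]])
  qed
  have uniq: "?d r1 l m = ?d r2 l m \<and> ?p r1 l m = ?p r2 l m" if m: "m \<in> ?I" for m
  proof (rule conjI)
    note unique = unitriangular_factorization_unique[where I = ?I and c = ?c and e = hom_dim and ?r1.0 = r1
        and ?r2.0 = r2 and ?p1.0 = "?p r1" and ?d1.0 = "?d r1" and ?p2.0 = "?p r2" and ?d2.0 = "?d r2"]
    show "?d r1 l m = ?d r2 l m"
      by (rule unique(1)[OF finite_Irr r1 r2]) (fact facts[OF r1 q1] facts[OF r2 q2] diag[OF q1] diag[OF q2] one[OF q1] one[OF q2]
        standard_mult_le hom_dim_pos Cartan_symmetric l m)+
    show "?p r1 l m = ?p r2 l m"
      by (rule unique(2)[OF finite_Irr r1 r2]) (fact facts[OF r1 q1] facts[OF r2 q2] diag[OF q1] diag[OF q2] one[OF q1] one[OF q2]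
        standard_mult_le hom_dim_pos Cartan_symmetric l m)+
  qed
  then show "standard_module K A r1 l = standard_module K A r2 l"
    by (intro standard_module_eqI[OF l]) simp
  show "standard_mult K A r1 l m = standard_mult K A r2 l m" if "m \<in> ?I"
    using uniq[OF that] by simp
qed

end

theorem theorem2p1p1:
  fixes K :: "'k ring" and A :: "('k, 'a) module"
    and r1 r2 :: "('a, 'k list) module set rel"
  assumes "fin_dim_algebra K A"
    and "has_simple_preserving_duality K A"
    and "partial_order_on (Irr K A) r1" and "partial_order_on (Irr K A) r2"
    and "quasi_hereditary K A r1" and "quasi_hereditary K A r2"
  shows "essential_order K A r1 = essential_order K A r2
    \<and> (\<forall>l\<in>Irr K A. lmod_iso A (standard_module K A r1 l) (standard_module K A r2 l))"
proof -
  obtain D Dm where "contravariant_autoequivalence K A D Dm" "involutive_functor K A D Dm"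
    "\<forall>l\<in>Irr K A. lmod_iso A (D (simple_of l)) (simple_of l)"
    using assms(2) unfolding has_simple_preserving_duality_def by blast
  then interpret simple_preserving_duality K A D Dm
    using assms(1) by (simp add: simple_preserving_duality_def simple_preserving_duality_axioms_def)
  note uniq = quasi_hereditary_unique[OF assms(3-6)]
  \<comment> \<open>The generating relations are already equal before transitive closure, since both
    kinds of multiplicities agree.\<close>
  have "essential_order K A r1 = essential_order K A r2"
    unfolding essential_order_def using uniq by (intro arg_cong[of _ _ trancl]) auto
  moreover have "lmod_iso A (standard_module K A r1 l) (standard_module K A r2 l)" if "l \<in> Irr K A" for l
    using uniq(1)[OF that] lmod_iso_refl[OF fdmod_left_module[OF standard_fdmod[OF that]]] by metis
  ultimately show ?thesis
    by blast
qed

end
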